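(* Let $\ell\in\mathbb{N}$ and let $V$ be a closed subspace of $L^2(\mathbb{R}^d)$. Then $V\in\mathcal{T}^{\ell}$ if and only if $V=V_\Omega$ for some measurable set $\Omega\subset\mathbb{R}^d$ that is an $\ell$ multi-tile of $\mathbb{R}^d$.
   Context: Fourier transform: $\widehat f(\omega)=\int_{\mathbb{R}^d}e^{-2\pi i\omega\cdot x}f(x)\,dx$, extended to $L^2(\mathbb{R}^d)$. Translation: $T_xf=f(\cdot-x)$. For $\varphi_1,\dots,\varphi_\ell\in L^2(\mathbb{R}^d)$, $S(\varphi_1,\dots,\varphi_\ell)=\overline{\mathrm{span}}\{T_k\varphi_j:k\in\mathbb{Z}^d,\ j=1,\dots,\ell\}$. $\mathcal{T}^\ell$ is the set of all spaces $V=S(\varphi_1,\dots,\varphi_\ell)$, for some $\varphi_1,\dots,\varphi_\ell\in L^2(\mathbb{R}^d)$, such that $V$ is translation invariant (i.e. $T_xf\in V$ for all $x\in\mathbb{R}^d$ and $f\in V$) and the integer translates $\{T_k\varphi_j:k\in\mathbb{Z}^d,\ j=1,\dots,\ell\}$ form a Riesz basis of $V$. For measurable $\Omega\subset\mathbb{R}^d$ (not necessarily bounded), $V_\Omega=\{f\in L^2(\mathbb{R}^d):\widehat f(\omega)=0\text{ for a.e. }\omega\in\mathbb{R}^d\setminus\Omega\}$. A measurable set $\Omega\subset\mathbb{R}^d$ is an $\ell$ multi-tile of $\mathbb{R}^d$ if $\sum_{k\in\mathbb{Z}^d}\chi_\Omega(\omega-k)=\ell$ for a.e. $\omega\in\mathbb{R}^d$.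 *)

theory Defs
  imports "HOL-Analysis.Analysis"
begin

text \<open>
  Elements of \<open>L\<^sup>2(\<real>\<^sup>d)\<close> are represented by functions rather than by classes modulo null sets.
  A subset of \<open>L\<^sup>2\<close> is a set of representatives. The closed ones are automatically
  unions of a.e.-classes, because \<open>L2_closure\<close> below adds every function at distance 0.
\<close>

definition L1_space :: "(real^'d \<Rightarrow> complex) set"
  where "L1_space = {f. integrable lebesgue f}"

definition L2_space :: "(real^'d \<Rightarrow> complex) set"
  where "L2_space = {f \<in> borel_measurable lebesgue. integrable lebesgue (\<lambda>x. (cmod (f x))\<^sup>2)}"

text \<open>Meaningful on \<open>L2_space\<close> only: the integral of a non-integrable function is 0.\<close>

definition L2_norm :: "(real^'d \<Rightarrow> complex) \<Rightarrow> real"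
  where "L2_norm f = sqrt (LINT x|lebesgue. (cmod (f x))\<^sup>2)"

definition L2_closure :: "(real^'d \<Rightarrow> complex) set \<Rightarrow> (real^'d \<Rightarrow> complex) set"
  where "L2_closure A = {f \<in> L2_space. \<forall>\<epsilon>>0. \<exists>g\<in>A. L2_norm (\<lambda>x. f x - g x) < \<epsilon>}"

definition closed_L2_subspace :: "(real^'d \<Rightarrow> complex) set \<Rightarrow> bool"
  where "closed_L2_subspace V \<longleftrightarrow>
    V \<subseteq> L2_space \<and>
    (\<lambda>x. 0) \<in> V \<and>
    (\<forall>f\<in>V. \<forall>g\<in>V. (\<lambda>x. f x + g x) \<in> V) \<and>
    (\<forall>c. \<forall>f\<in>V. (\<lambda>x. c * f x) \<in> V) \<and>
    L2_closure V \<subseteq> V"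

definition lin_span :: "'i set \<Rightarrow> ('i \<Rightarrow> real^'d \<Rightarrow> complex) \<Rightarrow> (real^'d \<Rightarrow> complex) set"
  where "lin_span I e = {(\<lambda>x. \<Sum>i\<in>F. c i * e i x) | F c. finite F \<and> F \<subseteq> I}"

definition closed_span :: "'i set \<Rightarrow> ('i \<Rightarrow> real^'d \<Rightarrow> complex) \<Rightarrow> (real^'d \<Rightarrow> complex) set"
  where "closed_span I e = L2_closure (lin_span I e)"

text \<open>The basis is an indexed family, so a repeated vector violates the lower bound.\<close>

definition riesz_basis ::
    "'i set \<Rightarrow> ('i \<Rightarrow> real^'d \<Rightarrow> complex) \<Rightarrow> (real^'d \<Rightarrow> complex) set \<Rightarrow> bool"
  where "riesz_basis I e V \<longleftrightarrow>
    (\<forall>i\<in>I. e i \<in> L2_space) \<and>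
    closed_span I e = V \<and>
    (\<exists>A>0. \<exists>B>0. \<forall>F c. finite F \<and> F \<subseteq> I \<longrightarrow>
       A * (\<Sum>i\<in>F. (cmod (c i))\<^sup>2) \<le> (L2_norm (\<lambda>x. \<Sum>i\<in>F. c i * e i x))\<^sup>2 \<and>
       (L2_norm (\<lambda>x. \<Sum>i\<in>F. c i * e i x))\<^sup>2 \<le> B * (\<Sum>i\<in>F. (cmod (c i))\<^sup>2))"

definition fourier_L1 :: "(real^'d \<Rightarrow> complex) \<Rightarrow> real^'d \<Rightarrow> complex"
  where "fourier_L1 f \<omega> =
    (LINT x|lebesgue. exp (- 2 * complex_of_real pi * \<i> * complex_of_real (\<omega> \<bullet> x)) * f x)"

text \<open>
  The continuous extension from \<open>L\<^sup>1 \<inter> L\<^sup>2\<close> to \<open>L\<^sup>2\<close>: an \<open>L\<^sup>2\<close>-limit of the transforms of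
  some \<open>L\<^sup>2\<close>-approximation of \<open>f\<close>. By Plancherel's theorem such a limit exists for every \<open>f\<close>
  in \<open>L\<^sup>2\<close> and is unique up to null sets, so the choice only selects a representative.
\<close>

definition fourier_L2 :: "(real^'d \<Rightarrow> complex) \<Rightarrow> real^'d \<Rightarrow> complex"
  where "fourier_L2 f = (SOME g. g \<in> L2_space \<and>
    (\<exists>h :: nat \<Rightarrow> real^'d \<Rightarrow> complex.
       (\<forall>n. h n \<in> L1_space \<inter> L2_space \<and> fourier_L1 (h n) \<in> L2_space) \<and>
       (\<lambda>n. L2_norm (\<lambda>x. h n x - f x)) \<longlonglongrightarrow> 0 \<and>
       (\<lambda>n. L2_norm (\<lambda>\<omega>. fourier_L1 (h n) \<omega> - g \<omega>)) \<longlonglongrightarrow> 0))"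

definition translation :: "real^'d \<Rightarrow> (real^'d \<Rightarrow> complex) \<Rightarrow> real^'d \<Rightarrow> complex"
  where "translation x f = (\<lambda>y. f (y - x))"

definition translation_invariant :: "(real^'d \<Rightarrow> complex) set \<Rightarrow> bool"
  where "translation_invariant V \<longleftrightarrow> (\<forall>x. \<forall>f\<in>V. translation x f \<in> V)"

definition int_lattice :: "(real^'d) set"
  where "int_lattice = {k. \<forall>i. k $ i \<in> \<int>}"

definition shift_index :: "nat \<Rightarrow> ((real^'d) \<times> nat) set"
  where "shift_index l = int_lattice \<times> {1..l}"

definition integer_shifts ::
    "(nat \<Rightarrow> real^'d \<Rightarrow> complex) \<Rightarrow> (real^'d) \<times> nat \<Rightarrow> real^'d \<Rightarrow> complex"
  where "integer_shifts \<phi> = (\<lambda>(k, j). translation k (\<phi> j))"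

definition shift_space :: "nat \<Rightarrow> (nat \<Rightarrow> real^'d \<Rightarrow> complex) \<Rightarrow> (real^'d \<Rightarrow> complex) set"
  where "shift_space l \<phi> = closed_span (shift_index l) (integer_shifts \<phi>)"

definition TI_riesz_spaces :: "nat \<Rightarrow> (real^'d \<Rightarrow> complex) set set"
  where "TI_riesz_spaces l = {V. \<exists>\<phi>.
    (\<forall>j\<in>{1..l}. \<phi> j \<in> L2_space) \<and>
    V = shift_space l \<phi> \<and>
    translation_invariant V \<and>
    riesz_basis (shift_index l) (integer_shifts \<phi>) V}"

definition paley_wiener :: "(real^'d) set \<Rightarrow> (real^'d \<Rightarrow> complex) set"
  where "paley_wiener \<Omega> =
    {f \<in> L2_space. AE \<omega> in lebesgue. \<omega> \<notin> \<Omega> \<longrightarrow> fourier_L2 f \<omega> = 0}"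

definition multi_tile :: "nat \<Rightarrow> (real^'d) set \<Rightarrow> bool"
  where "multi_tile l \<Omega> \<longleftrightarrow>
    \<Omega> \<in> sets lebesgue \<and>
    (AE \<omega> in lebesgue.
       ((\<lambda>k. indicator \<Omega> (\<omega> - k) :: real) has_sum real l) int_lattice)"

end

theory Submission
  imports Defs
begin

text \<open>
  On the Fourier side translations become multiplications by characters, so both conditions on
  \<open>V\<close> can be read off, orbit by orbit, from the sets \<open>\<Omega> \<inter> (\<omega> + \<int>\<^sup>d)\<close>. The \<open>l\<close> generators
  give \<open>l\<close> vectors on each orbit, and the Riesz basis property makes them a basis of the
  functions on the points of \<open>\<Omega>\<close> in that orbit. Hence there are \<open>l\<close> such points.

  \<^emph>\<open>From the basis to the multi-tile.\<close> Let \<open>\<Omega>\<close> be the set where some \<open>\<Phi>\<^sub>j\<close>, the transform of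
  \<open>\<phi>\<^sub>j\<close>, does not vanish. If \<open>g\<close> is orthogonal to \<open>V\<close>, it is orthogonal to all real translates
  of every \<open>\<phi>\<^sub>j\<close>, so the product of the transform of \<open>g\<close> with \<open>cnj \<Phi>\<^sub>j\<close> has zero Fourier transform and
  vanishes a.e. by \<open>fourier_uniqueness\<close>. Thus \<open>V = V\<^sub>\<Omega>\<close>
  (\<open>translation_invariant_shift_space_eq_paley_wiener\<close>). The points of \<open>\<Omega>\<close> on an orbit are counted
  by a trace, which avoids choosing vectors measurably in the orbits. Projection provides functions
  \<open>\<psi>\<^sub>j\<close>, with transforms \<open>\<Psi>\<^sub>j\<close>, that are biorthogonal to the basis (\<open>riesz_basis_biorthogonal\<close>).
  Biorthogonality says that the periodization of \<open>\<Phi>\<^sub>i * cnj \<Psi>\<^sub>j\<close> is constantly 1 for \<open>i = j\<close> and 0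
  otherwise. Completeness says that \<open>\<Sum>\<^sub>j \<Phi>\<^sub>j * cnj \<Psi>\<^sub>j\<close> is the indicator of \<open>\<Omega>\<close>. Summing this last
  identity over an orbit gives \<open>l\<close> on one side and the number of points of \<open>\<Omega>\<close> on the
  other (\<open>multi_tile_if_riesz_basis\<close>).

  \<^emph>\<open>From the multi-tile to the basis.\<close> Numbering the \<open>l\<close> points of \<open>\<Omega>\<close> on each orbit cuts \<open>\<Omega>\<close> into
  \<open>l\<close> measurable tiles (\<open>layer_tile\<close>). On a tile the characters with integer frequency are an
  orthonormal basis, and the inverse transforms of the indicators of the tiles are generators whose
  integer translates are even orthonormal (\<open>paley_wiener_multi_tile_in_TI_riesz_spaces\<close>).

  \<^emph>\<open>Harmonic analysis.\<close> Everything rests on one uniqueness principle, obtained from the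
  Stone--Weierstrass theorem on the circle: the bounded functions by which one may multiply without
  leaving the integrable functions annihilated by a group of characters form an algebra closed under
  bounded pointwise limits, hence contain the indicators of a \<open>\<sigma>\<close>-algebra. For all characters this
  yields uniqueness of the Fourier transform, and for integer frequencies it yields
  \<open>periodize_zero_if_annihilated\<close>, the uniqueness of Fourier coefficients. The latter gives Parseval's
  identity on the unit cell, and averaging it over all shifts of the frequency lattice is
  Plancherel's theorem for functions on the cell. Scaling, truncation and Fatou's lemma extend it
  to \<open>L\<^sup>2\<close>.
\<close>

section \<open>Affine changes of variable for Lebesgue measure\<close>

lemma
  fixes t :: "'a::euclidean_space"
  assumes "c \<noteq> 0"
  shows measurable_lebesgue_affine: "(\<lambda>x. t + c *\<^sub>R x) \<in> lebesgue \<rightarrow>\<^sub>M lebesgue"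
    and lebesgue_eq_density_affine:
      "lebesgue = density (distr lebesgue lebesgue (\<lambda>x. t + c *\<^sub>R x)) (\<lambda>_. ennreal (\<bar>c\<bar> ^ DIM('a)))"
proof -
  have *: "(\<lambda>x. t + (\<Sum>j\<in>Basis. (c * (x \<bullet> j)) *\<^sub>R j)) = (\<lambda>x. t + c *\<^sub>R x)"
    unfolding scaleR_scaleR[symmetric] scaleR_sum_right[symmetric] by (simp add: euclidean_representation)
  show "(\<lambda>x. t + c *\<^sub>R x) \<in> lebesgue \<rightarrow>\<^sub>M lebesgue"
    using lebesgue_affine_measurable[of "\<lambda>_. c" t] assms unfolding * by simp
  show "lebesgue = density (distr lebesgue lebesgue (\<lambda>x. t + c *\<^sub>R x)) (\<lambda>_. ennreal (\<bar>c\<bar> ^ DIM('a)))"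
    using lebesgue_affine_euclidean[of "\<lambda>_. c" t] assms unfolding * by simp
qed

lemma nn_integral_lebesgue_affine:
  fixes t :: "'a::euclidean_space"
  assumes "c \<noteq> 0" and [measurable]: "f \<in> borel_measurable lebesgue"
  shows "(\<integral>\<^sup>+x. f x \<partial>lebesgue) = ennreal (\<bar>c\<bar> ^ DIM('a)) * (\<integral>\<^sup>+x. f (t + c *\<^sub>R x) \<partial>lebesgue)"
proof -
  note [measurable] = measurable_lebesgue_affine[OF assms(1), of t]
  show ?thesis
    apply (subst lebesgue_eq_density_affine[OF assms(1), of t])
    apply (subst nn_integral_density)
      apply simp
     apply (simp add: measurable_distr_eq1)
    apply (subst nn_integral_distr)
      apply simp
     apply simp
    apply (simp add: nn_integral_cmult)
    done
qed

lemma measurable_add_right_lebesgue [measurable]: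
  "(\<lambda>x. x + t :: 'a::euclidean_space) \<in> lebesgue \<rightarrow>\<^sub>M lebesgue"
  using measurable_lebesgue_affine[of 1 t] by (simp add: add.commute)

lemma lebesgue_eq_distr_translation:
  "lebesgue = distr lebesgue lebesgue (\<lambda>x. x + t :: 'a::euclidean_space)"
  using lebesgue_eq_density_affine[of 1 t] by (simp add: density_1 add.commute)

lemma nn_integral_translation:
  fixes t :: "'a::euclidean_space"
  assumes [measurable]: "f \<in> borel_measurable lebesgue"
  shows "(\<integral>\<^sup>+x. f (x + t) \<partial>lebesgue) = (\<integral>\<^sup>+x. f x \<partial>lebesgue)"
  by (subst (2) lebesgue_eq_distr_translation[of t]) (simp add: nn_integral_distr)

lemma measurable_translation:
  fixes t :: "'a::euclidean_space"
  assumes "f \<in> borel_measurable lebesgue"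
  shows "(\<lambda>x. f (x + t)) \<in> borel_measurable lebesgue"
  using measurable_compose[OF measurable_add_right_lebesgue assms] .

lemma
  fixes t :: "'a::euclidean_space" and f :: "'a \<Rightarrow> 'b::{banach, second_countable_topology}"
  shows integrable_translation: "integrable lebesgue f \<Longrightarrow> integrable lebesgue (\<lambda>x. f (x + t))"
    and integral_translation:
      "f \<in> borel_measurable lebesgue \<Longrightarrow> (LINT x|lebesgue. f (x + t)) = (LINT x|lebesgue. f x)"
proof -
  show "integrable lebesgue f \<Longrightarrow> integrable lebesgue (\<lambda>x. f (x + t))"
    by (subst (asm) lebesgue_eq_distr_translation[of t]) (rule integrable_distr[OF measurable_add_right_lebesgue])
  show "f \<in> borel_measurable lebesgue \<Longrightarrow> (LINT x|lebesgue. f (x + t)) = (LINT x|lebesgue. f x)"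
    by (subst (2) lebesgue_eq_distr_translation[of t], subst integral_distr) (auto simp: measurable_distr_eq1)
qed

lemma AE_translation:
  fixes t :: "'a::euclidean_space"
  assumes "AE x in lebesgue. P x"
  shows "AE x in lebesgue. P (x + t)"
  using assms by (subst (asm) lebesgue_eq_distr_translation[of t]) (auto dest: AE_distrD[rotated])

lemma borel_measurable_cnj: "f \<in> borel_measurable M \<Longrightarrow> (\<lambda>x. cnj (f x)) \<in> borel_measurable M"
  by (intro borel_measurable_continuous_on[where f = cnj] continuous_intros)

section \<open>The Hilbert space \<open>L\<^sup>2\<close>\<close>

definition L2_inner :: "(real^'d \<Rightarrow> complex) \<Rightarrow> (real^'d \<Rightarrow> complex) \<Rightarrow> complex"
  where "L2_inner f g = (LINT x|lebesgue. f x * cnj (g x))"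

lemma L2_space_measurable: "f \<in> L2_space \<Longrightarrow> f \<in> borel_measurable lebesgue"
  and L2_space_integrable: "f \<in> L2_space \<Longrightarrow> integrable lebesgue (\<lambda>x. (cmod (f x))\<^sup>2)"
  by (auto simp: L2_space_def)

lemma L2_space_iff_nn:
  "f \<in> L2_space \<longleftrightarrow>
    f \<in> borel_measurable lebesgue \<and> (\<integral>\<^sup>+x. ennreal ((cmod (f x))\<^sup>2) \<partial>lebesgue) < \<infinity>"
  by (auto simp: L2_space_def integrable_iff_bounded)

lemma L2_norm_nonneg [simp]: "L2_norm f \<ge> 0"
  by (simp add: L2_norm_def)

lemma L2_norm_sq: "(L2_norm f)\<^sup>2 = (LINT x|lebesgue. (cmod (f x))\<^sup>2)"
  by (simp add: L2_norm_def)

lemma L2_norm_sq_nn: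
  "f \<in> L2_space \<Longrightarrow> ennreal ((L2_norm f)\<^sup>2) = (\<integral>\<^sup>+x. ennreal ((cmod (f x))\<^sup>2) \<partial>lebesgue)"
  unfolding L2_norm_sq by (subst nn_integral_eq_integral) (auto simp: L2_space_integrable)

lemma L2_inner_integrable:
  assumes "f \<in> L2_space" "g \<in> L2_space"
  shows "integrable lebesgue (\<lambda>x. f x * cnj (g x))"
proof (rule Bochner_Integration.integrable_bound)
  show "integrable lebesgue (\<lambda>x. (cmod (f x))\<^sup>2 + (cmod (g x))\<^sup>2)"
    using assms by (auto simp: L2_space_integrable)
  show "(\<lambda>x. f x * cnj (g x)) \<in> borel_measurable lebesgue"
    using assms[THEN L2_space_measurable] by (auto intro!: borel_measurable_times borel_measurable_cnj)
  have "cmod (f x) * cmod (g x) \<le> (cmod (f x))\<^sup>2 + (cmod (g x))\<^sup>2" for x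
    using sum_squares_bound[of "cmod (f x)" "cmod (g x)"] mult_nonneg_nonneg[OF norm_ge_zero[of "f x"] norm_ge_zero[of "g x"]]
    by linarith
  then show "AE x in lebesgue. norm (f x * cnj (g x)) \<le> norm ((cmod (f x))\<^sup>2 + (cmod (g x))\<^sup>2)"
    by (auto simp: norm_mult)
qed

lemma L2_zero: "(\<lambda>x. 0) \<in> L2_space"
  by (simp add: L2_space_def)

lemma L2_add:
  assumes "f \<in> L2_space" "g \<in> L2_space"
  shows "(\<lambda>x. f x + g x) \<in> L2_space"
proof -
  have m: "(\<lambda>x. f x + g x) \<in> borel_measurable lebesgue"
    using assms[THEN L2_space_measurable] by auto
  have "integrable lebesgue (\<lambda>x. (cmod (f x + g x))\<^sup>2)"
  proof (rule Bochner_Integration.integrable_bound)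
    show "integrable lebesgue (\<lambda>x. 2 * (cmod (f x))\<^sup>2 + 2 * (cmod (g x))\<^sup>2)"
      using assms by (auto simp: L2_space_integrable)
    show "(\<lambda>x. (cmod (f x + g x))\<^sup>2) \<in> borel_measurable lebesgue" using m by simp
    have "(cmod (f x + g x))\<^sup>2 \<le> 2 * (cmod (f x))\<^sup>2 + 2 * (cmod (g x))\<^sup>2" for x
    proof -
      have "(cmod (f x + g x))\<^sup>2 \<le> (cmod (f x) + cmod (g x))\<^sup>2"
        by (intro power_mono norm_triangle_ineq) auto
      also have "\<dots> \<le> 2 * (cmod (f x))\<^sup>2 + 2 * (cmod (g x))\<^sup>2"
        using sum_squares_bound[of "cmod (f x)" "cmod (g x)"] by (simp add: power2_sum)
      finally show ?thesis .
    qed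
    then show "AE x in lebesgue. norm ((cmod (f x + g x))\<^sup>2) \<le> norm (2 * (cmod (f x))\<^sup>2 + 2 * (cmod (g x))\<^sup>2)"
      by auto
  qed
  with m show ?thesis by (simp add: L2_space_def)
qed

lemma L2_bounded_mult:
  assumes "f \<in> L2_space" "p \<in> borel_measurable lebesgue" "\<And>x. cmod (p x) \<le> C"
  shows "(\<lambda>x. p x * f x) \<in> L2_space"
proof -
  have m: "(\<lambda>x. p x * f x) \<in> borel_measurable lebesgue"
    using assms(1)[THEN L2_space_measurable] assms(2) by auto
  have "integrable lebesgue (\<lambda>x. (cmod (p x * f x))\<^sup>2)"
  proof (rule Bochner_Integration.integrable_bound)
    show "integrable lebesgue (\<lambda>x. C\<^sup>2 * (cmod (f x))\<^sup>2)"
      using assms by (auto simp: L2_space_integrable)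
    show "(\<lambda>x. (cmod (p x * f x))\<^sup>2) \<in> borel_measurable lebesgue" using m by simp
    show "AE x in lebesgue. norm ((cmod (p x * f x))\<^sup>2) \<le> norm (C\<^sup>2 * (cmod (f x))\<^sup>2)"
      by (auto simp: norm_mult power_mult_distrib intro!: mult_right_mono power_mono assms)
  qed
  with m show ?thesis by (simp add: L2_space_def)
qed

lemma L2_cmult: "f \<in> L2_space \<Longrightarrow> (\<lambda>x. c * f x) \<in> L2_space"
  by (rule L2_bounded_mult[where C = "cmod c"]) auto

lemma L2_uminus: "f \<in> L2_space \<Longrightarrow> (\<lambda>x. - f x) \<in> L2_space"
  using L2_cmult[of f "-1"] by simp

lemma L2_diff: "f \<in> L2_space \<Longrightarrow> g \<in> L2_space \<Longrightarrow> (\<lambda>x. f x - g x) \<in> L2_space"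
  using L2_add[of f "\<lambda>x. - g x"] L2_uminus[of g] by simp

lemma L2_sum: "(\<And>i. i \<in> F \<Longrightarrow> f i \<in> L2_space) \<Longrightarrow> (\<lambda>x. \<Sum>i\<in>F. f i x) \<in> L2_space"
  by (induction F rule: infinite_finite_induct) (auto simp: L2_zero intro!: L2_add)

lemma L2_inner_self: "f \<in> L2_space \<Longrightarrow> L2_inner f f = complex_of_real ((L2_norm f)\<^sup>2)"
  by (simp add: L2_inner_def L2_norm_sq complex_norm_square[symmetric] del: of_real_power)

lemma L2_inner_commute: "L2_inner g f = cnj (L2_inner f g)"
proof -
  have "cnj (L2_inner f g) = (LINT x|lebesgue. cnj (f x * cnj (g x)))"
    unfolding L2_inner_def by (rule Bochner_Integration.integral_cnj[symmetric])
  then show ?thesis by (simp add: L2_inner_def mult.commute)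
qed

lemma L2_inner_add_left:
  "f \<in> L2_space \<Longrightarrow> g \<in> L2_space \<Longrightarrow> h \<in> L2_space \<Longrightarrow>
    L2_inner (\<lambda>x. f x + g x) h = L2_inner f h + L2_inner g h"
  by (simp add: L2_inner_def ring_distribs L2_inner_integrable)

lemma L2_inner_diff_left:
  "f \<in> L2_space \<Longrightarrow> g \<in> L2_space \<Longrightarrow> h \<in> L2_space \<Longrightarrow>
    L2_inner (\<lambda>x. f x - g x) h = L2_inner f h - L2_inner g h"
  by (simp add: L2_inner_def ring_distribs L2_inner_integrable)

lemma L2_inner_cmult_left: "L2_inner (\<lambda>x. c * f x) h = c * L2_inner f h"
  by (simp add: L2_inner_def mult.assoc)

lemma L2_inner_cmult_right: "L2_inner f (\<lambda>x. c * h x) = cnj c * L2_inner f h"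
  by (simp add: L2_inner_def mult.left_commute)

lemma L2_inner_add_right:
  "f \<in> L2_space \<Longrightarrow> g \<in> L2_space \<Longrightarrow> h \<in> L2_space \<Longrightarrow>
    L2_inner h (\<lambda>x. f x + g x) = L2_inner h f + L2_inner h g"
  by (simp add: L2_inner_def ring_distribs L2_inner_integrable)

lemma L2_inner_sum_left:
  assumes "h \<in> L2_space" "\<And>i. i \<in> F \<Longrightarrow> f i \<in> L2_space"
  shows "L2_inner (\<lambda>x. \<Sum>i\<in>F. c i * f i x) h = (\<Sum>i\<in>F. c i * L2_inner (f i) h)"
  using assms(2)
proof (induction F rule: infinite_finite_induct)
  case (insert i F)
  then show ?case
    by (simp add: L2_inner_add_left assms(1) L2_sum L2_cmult L2_inner_cmult_left)
qed (auto simp: L2_inner_def)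

lemma L2_norm_add_sq:
  assumes "f \<in> L2_space" "g \<in> L2_space"
  shows "(L2_norm (\<lambda>x. f x + g x))\<^sup>2 = (L2_norm f)\<^sup>2 + 2 * Re (L2_inner f g) + (L2_norm g)\<^sup>2"
proof -
  have "complex_of_real ((L2_norm (\<lambda>x. f x + g x))\<^sup>2) =
      L2_inner f f + (L2_inner f g + cnj (L2_inner f g)) + L2_inner g g"
    using assms L2_inner_self[OF L2_add[OF assms]]
    by (simp add: L2_inner_add_left L2_inner_add_right L2_add L2_inner_commute[of g f] add.assoc)
  also have "\<dots> = complex_of_real ((L2_norm f)\<^sup>2 + 2 * Re (L2_inner f g) + (L2_norm g)\<^sup>2)"
    by (simp add: L2_inner_self assms complex_add_cnj del: of_real_power)
  finally show ?thesis
    using of_real_eq_iff by blast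
qed

lemma L2_norm_cmult: "L2_norm (\<lambda>x. c * f x) = cmod c * L2_norm f"
  by (simp add: L2_norm_def norm_mult power_mult_distrib real_sqrt_mult)

lemma L2_norm_minus_commute: "L2_norm (\<lambda>x. f x - g x) = L2_norm (\<lambda>x. g x - f x)"
  by (simp add: L2_norm_def norm_minus_commute)

lemma L2_norm_diff_sq:
  assumes "f \<in> L2_space" "g \<in> L2_space"
  shows "(L2_norm (\<lambda>x. f x - g x))\<^sup>2 = (L2_norm f)\<^sup>2 - 2 * Re (L2_inner f g) + (L2_norm g)\<^sup>2"
  using L2_norm_add_sq[OF assms(1) L2_cmult[OF assms(2), of "-1"]]
  by (simp add: L2_norm_cmult[of "-1" g, simplified] L2_inner_cmult_right[of _ "-1", simplified])

lemma L2_norm_cong_AE: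
  assumes "AE x in lebesgue. f x = g x" "f \<in> borel_measurable lebesgue" "g \<in> borel_measurable lebesgue"
  shows "L2_norm f = L2_norm g"
  unfolding L2_norm_def using assms by (intro arg_cong[where f = sqrt] integral_cong_AE) auto

lemma L2_inner_cong_AE:
  assumes "f \<in> L2_space" "f' \<in> L2_space" "g \<in> L2_space" "g' \<in> L2_space"
    "AE x in lebesgue. f x = f' x" "AE x in lebesgue. g x = g' x"
  shows "L2_inner f g = L2_inner f' g'"
  unfolding L2_inner_def using assms(5,6) assms(1-4)[THEN L2_space_measurable]
  by (intro integral_cong_AE) (auto intro!: borel_measurable_times borel_measurable_cnj)

lemma L2_norm_zero_iff:
  assumes "f \<in> L2_space"
  shows "L2_norm f = 0 \<longleftrightarrow> (AE x in lebesgue. f x = 0)"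
  using integral_nonneg_eq_0_iff_AE[OF L2_space_integrable[OF assms]]
  by (auto simp: L2_norm_def)

lemma L2_Cauchy_Schwarz:
  assumes "f \<in> L2_space" "g \<in> L2_space"
  shows "cmod (L2_inner f g) \<le> L2_norm f * L2_norm g"
proof (cases "L2_norm g = 0")
  case True
  then have "AE x in lebesgue. g x = 0" using L2_norm_zero_iff assms by blast
  then have "L2_inner f g = L2_inner f (\<lambda>x. 0)"
    by (intro L2_inner_cong_AE) (auto simp: assms L2_zero)
  then show ?thesis using True by (simp add: L2_inner_def)
next
  case False
  define n where "n = (L2_norm g)\<^sup>2"
  define a where "a = L2_inner f g"
  have n: "n > 0" using False by (simp add: n_def)
  have "0 \<le> (L2_norm (\<lambda>x. f x - (a / n) * g x))\<^sup>2" by simp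
  also have "\<dots> = (L2_norm f)\<^sup>2 - 2 * Re (cnj (a / n) * a) + (cmod (a / n))\<^sup>2 * n"
    unfolding a_def[symmetric] n_def[symmetric]
    by (simp only: L2_norm_diff_sq[OF assms(1) L2_cmult[OF assms(2)]] L2_inner_cmult_right L2_norm_cmult
        power_mult_distrib a_def n_def)
  also have "Re (cnj (a / n) * a) = (cmod a)\<^sup>2 / n"
    by (simp only: cmod_power2) (simp add: power2_eq_square algebra_simps add_divide_distrib)
  also have "(cmod (a / n))\<^sup>2 * n = (cmod a)\<^sup>2 / n"
    using n by (simp add: norm_divide power_divide power2_eq_square)
  finally have "(cmod a)\<^sup>2 / n \<le> (L2_norm f)\<^sup>2" by simp
  then have "(cmod a)\<^sup>2 \<le> (L2_norm f * L2_norm g)\<^sup>2"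
    using n by (simp add: field_simps n_def)
  then show ?thesis unfolding a_def by (rule power2_le_imp_le) simp
qed

lemma L2_norm_triangle:
  assumes "f \<in> L2_space" "g \<in> L2_space"
  shows "L2_norm (\<lambda>x. f x + g x) \<le> L2_norm f + L2_norm g"
proof (rule power2_le_imp_le)
  have "Re (L2_inner f g) \<le> L2_norm f * L2_norm g"
    using L2_Cauchy_Schwarz[OF assms] complex_Re_le_cmod[of "L2_inner f g"] by linarith
  then show "(L2_norm (\<lambda>x. f x + g x))\<^sup>2 \<le> (L2_norm f + L2_norm g)\<^sup>2"
    unfolding L2_norm_add_sq[OF assms] by (simp add: power2_sum)
qed simp

lemma L2_norm_triangle_diff:
  assumes "f \<in> L2_space" "g \<in> L2_space" "h \<in> L2_space"
  shows "L2_norm (\<lambda>x. f x - h x) \<le> L2_norm (\<lambda>x. f x - g x) + L2_norm (\<lambda>x. g x - h x)"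
  using L2_norm_triangle[OF L2_diff[OF assms(1,2)] L2_diff[OF assms(2,3)]] by simp

lemma L2_norm_le_add_diff:
  assumes "f \<in> L2_space" "g \<in> L2_space"
  shows "L2_norm f \<le> L2_norm (\<lambda>x. f x - g x) + L2_norm g"
  using L2_norm_triangle_diff[OF assms L2_zero] by simp

lemma L2_norm_tendsto:
  assumes "\<And>n. f n \<in> L2_space" "g \<in> L2_space" "(\<lambda>n. L2_norm (\<lambda>x. f n x - g x)) \<longlonglongrightarrow> 0"
  shows "(\<lambda>n. L2_norm (f n)) \<longlonglongrightarrow> L2_norm g"
proof -
  have "\<bar>L2_norm (f n) - L2_norm g\<bar> \<le> L2_norm (\<lambda>x. f n x - g x)" for n
    using L2_norm_le_add_diff[OF assms(1)[of n] assms(2)] L2_norm_le_add_diff[OF assms(2) assms(1)[of n]]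
    by (simp add: L2_norm_minus_commute[of g] abs_le_iff)
  then have "(\<lambda>n. L2_norm (f n) - L2_norm g) \<longlonglongrightarrow> 0"
    by (intro Lim_null_comparison[OF _ assms(3)]) (auto simp: real_norm_def)
  then show ?thesis by (simp add: LIM_zero_iff)
qed

text \<open>
  Only pointwise limits are at hand when Fourier transforms of truncations are compared with the
  transform of the whole function, or when a Cauchy sequence is thinned out. Fatou's lemma upgrades
  them: a bound on the norms passes to the limit, which thereby lies in \<open>L\<^sup>2\<close>.
\<close>

lemma L2_Fatou:
  assumes f: "\<And>n. f n \<in> L2_space" and g: "g \<in> borel_measurable lebesgue"
    and lim: "AE x in lebesgue. (\<lambda>n. f n x) \<longlonglongrightarrow> g x"
    and bound: "eventually (\<lambda>n. L2_norm (f n) \<le> C) sequentially"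
  shows "g \<in> L2_space" "L2_norm g \<le> C"
proof -
  obtain n where "L2_norm (f n) \<le> C" using bound eventually_sequentially by auto
  then have C: "C \<ge> 0" using L2_norm_nonneg order_trans by blast
  have [measurable]: "f n \<in> borel_measurable lebesgue" for n using f L2_space_measurable by auto
  have "(\<integral>\<^sup>+x. ennreal ((cmod (g x))\<^sup>2) \<partial>lebesgue) =
      (\<integral>\<^sup>+x. liminf (\<lambda>n. ennreal ((cmod (f n x))\<^sup>2)) \<partial>lebesgue)"
  proof (rule nn_integral_cong_AE)
    show "AE x in lebesgue. ennreal ((cmod (g x))\<^sup>2) = liminf (\<lambda>n. ennreal ((cmod (f n x))\<^sup>2))"
      using lim
    proof eventually_elim
      case (elim x)
      then have "(\<lambda>n. ennreal ((cmod (f n x))\<^sup>2)) \<longlonglongrightarrow> ennreal ((cmod (g x))\<^sup>2)"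
        by (intro tendsto_ennrealI tendsto_power tendsto_norm)
      from lim_imp_Liminf[OF _ this] show ?case by simp
    qed
  qed
  also have "\<dots> \<le> liminf (\<lambda>n. \<integral>\<^sup>+x. ennreal ((cmod (f n x))\<^sup>2) \<partial>lebesgue)"
    by (intro nn_integral_liminf) auto
  also have "\<dots> \<le> ennreal (C\<^sup>2)"
  proof -
    have "eventually (\<lambda>n. (\<integral>\<^sup>+x. ennreal ((cmod (f n x))\<^sup>2) \<partial>lebesgue) \<le> ennreal (C\<^sup>2)) sequentially"
      using bound
    proof eventually_elim
      case (elim n)
      then have "(L2_norm (f n))\<^sup>2 \<le> C\<^sup>2" by (intro power_mono) auto
      then show ?case by (subst L2_norm_sq_nn[OF f, symmetric]) (simp add: ennreal_leI)
    qed
    then have "liminf (\<lambda>n. \<integral>\<^sup>+x. ennreal ((cmod (f n x))\<^sup>2) \<partial>lebesgue) \<le> liminf (\<lambda>n. ennreal (C\<^sup>2))"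
      by (rule Liminf_mono)
    then show ?thesis by (simp add: Liminf_const)
  qed
  finally have le: "(\<integral>\<^sup>+x. ennreal ((cmod (g x))\<^sup>2) \<partial>lebesgue) \<le> ennreal (C\<^sup>2)" .
  then show L2: "g \<in> L2_space"
    using g by (simp add: L2_space_iff_nn order_le_less_trans[OF le])
  have "ennreal ((L2_norm g)\<^sup>2) \<le> ennreal (C\<^sup>2)"
    using le L2_norm_sq_nn[OF L2] by simp
  then have "(L2_norm g)\<^sup>2 \<le> C\<^sup>2" by (simp add: ennreal_le_iff)
  then show "L2_norm g \<le> C" using C power2_le_imp_le by blast
qed

theorem L2_complete:
  assumes f: "\<And>n. f n \<in> L2_space"
    and Cauchy: "\<And>e. e > 0 \<Longrightarrow> \<exists>N. \<forall>m\<ge>N. \<forall>n\<ge>N. L2_norm (\<lambda>x. f m x - f n x) < e"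
  obtains g where "g \<in> L2_space" "(\<lambda>n. L2_norm (\<lambda>x. f n x - g x)) \<longlonglongrightarrow> 0"
proof -
  have [measurable]: "f n \<in> borel_measurable lebesgue" for n using f L2_space_measurable by auto
  have "\<exists>r::nat\<Rightarrow>nat. \<forall>n. (\<forall>m\<ge>r n. L2_norm (\<lambda>x. f m x - f (r n) x) < 1 / 4 ^ n) \<and> r n < r (Suc n)"
  proof (rule dependent_nat_choice)
    obtain N where "\<forall>m\<ge>N. \<forall>n\<ge>N. L2_norm (\<lambda>x. f m x - f n x) < 1 / 4 ^ 0" using Cauchy[of "1 / 4 ^ 0"] by auto
    then show "\<exists>x. \<forall>m\<ge>x. L2_norm (\<lambda>y. f m y - f x y) < 1 / 4 ^ 0" by blast
  next
    fix r n :: nat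
    obtain N where N: "\<And>m n'. m\<ge>N \<Longrightarrow> n'\<ge>N \<Longrightarrow> L2_norm (\<lambda>x. f m x - f n' x) < 1 / 4 ^ Suc n"
      using Cauchy[of "1 / 4 ^ Suc n"] by auto
    show "\<exists>y. (\<forall>m\<ge>y. L2_norm (\<lambda>x. f m x - f y x) < 1 / 4 ^ Suc n) \<and> r < y"
      by (rule exI[of _ "max N (Suc r)"]) (use N in auto)
  qed
  then obtain r where r1: "\<And>n m. m \<ge> r n \<Longrightarrow> L2_norm (\<lambda>x. f m x - f (r n) x) < 1 / 4 ^ n"
    and r2: "\<And>n. r n < r (Suc n)" by blast
  have sm: "strict_mono r" using r2 by (simp add: strict_mono_Suc_iff)
  define d where "d n x = f (r (Suc n)) x - f (r n) x" for n x
  have d2: "d n \<in> L2_space" for n unfolding d_def by (intro L2_diff f)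
  have [measurable]: "d n \<in> borel_measurable lebesgue" for n using d2 L2_space_measurable by auto
  have dn: "L2_norm (d n) \<le> 1 / 4 ^ n" for n
    using r1[of n "r (Suc n)"] r2[of n] by (simp add: d_def[abs_def] less_imp_le)
  \<comment> \<open>The weight \<open>4 ^ n\<close> still leaves a convergent series of integrals, and where the weighted
      series is finite its terms are bounded, so the differences decay like \<open>2 ^ -n\<close>.\<close>
  have "(\<integral>\<^sup>+x. (\<Sum>n. ennreal (4 ^ n * (cmod (d n x))\<^sup>2)) \<partial>lebesgue) =
      (\<Sum>n. \<integral>\<^sup>+x. ennreal (4 ^ n * (cmod (d n x))\<^sup>2) \<partial>lebesgue)"
    by (intro nn_integral_suminf) auto
  also have "\<dots> \<le> (\<Sum>n. ennreal ((1/4) ^ n))"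
  proof (intro suminf_le summableI)
    fix n
    have "(\<integral>\<^sup>+x. ennreal (4 ^ n * (cmod (d n x))\<^sup>2) \<partial>lebesgue) = ennreal (4 ^ n) * ennreal ((L2_norm (d n))\<^sup>2)"
      by (subst L2_norm_sq_nn[OF d2]) (simp add: ennreal_mult' nn_integral_cmult)
    also have "\<dots> \<le> ennreal (4 ^ n) * ennreal ((1 / 4 ^ n)\<^sup>2)"
      by (intro mult_left_mono ennreal_leI power_mono dn) auto
    also have "\<dots> = ennreal ((1/4) ^ n)"
      by (subst ennreal_mult'[symmetric]) (auto simp: power2_eq_square power_one_over)
    finally show "(\<integral>\<^sup>+x. ennreal (4 ^ n * (cmod (d n x))\<^sup>2) \<partial>lebesgue) \<le> ennreal ((1/4) ^ n)" .
  qed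
  also have "\<dots> < \<infinity>"
    by (simp add: suminf_ennreal2 summable_geometric less_top)
  finally have "(\<integral>\<^sup>+x. (\<Sum>n. ennreal (4 ^ n * (cmod (d n x))\<^sup>2)) \<partial>lebesgue) \<noteq> \<infinity>" by simp
  then have "AE x in lebesgue. (\<Sum>n. ennreal (4 ^ n * (cmod (d n x))\<^sup>2)) \<noteq> \<infinity>"
    by (intro nn_integral_noteq_infinite) auto
  then have conv: "AE x in lebesgue. convergent (\<lambda>n. f (r n) x)"
  proof eventually_elim
    case (elim x)
    have "summable (\<lambda>n. 4 ^ n * (cmod (d n x))\<^sup>2)"
      using elim by (intro summable_suminf_not_top) (auto simp: top_ennreal_def infinity_ennreal_def)
    then have "(\<lambda>n. 4 ^ n * (cmod (d n x))\<^sup>2) \<longlonglongrightarrow> 0" by (rule summable_LIMSEQ_zero)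
    then have "Bseq (\<lambda>n. 4 ^ n * (cmod (d n x))\<^sup>2)" by (intro convergent_imp_Bseq convergentI)
    then obtain K where K: "K > 0" "\<And>n. 4 ^ n * (cmod (d n x))\<^sup>2 \<le> K"
      by (auto simp: Bseq_def)
    have "cmod (d n x) \<le> sqrt K * (1/2) ^ n" for n
    proof -
      have "(2 ^ n * cmod (d n x))\<^sup>2 \<le> K"
        using K(2)[of n] by (simp add: power2_eq_square mult_ac flip: power_mult_distrib)
      then have "2 ^ n * cmod (d n x) \<le> sqrt K" by (rule real_le_rsqrt)
      then show ?thesis by (simp add: field_simps power_one_over)
    qed
    moreover have "summable (\<lambda>n. sqrt K * (1/2) ^ n)"
      by (rule summable_mult[OF summable_geometric]) simp
    ultimately have "summable (\<lambda>n. d n x)"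
      using summable_comparison_test'[of "\<lambda>n. sqrt K * (1/2) ^ n" 0 "\<lambda>n. d n x"] by simp
    then have "convergent (\<lambda>n. \<Sum>i<n. d i x)" by (simp add: summable_iff_convergent)
    then have "convergent (\<lambda>n. f (r n) x - f (r 0) x)"
      unfolding d_def by (subst (asm) sum_lessThan_telescope) 
    then show ?case
      using convergent_add[of "\<lambda>n. f (r n) x - f (r 0) x" "\<lambda>n. f (r 0) x"] by (auto simp: convergent_const)
  qed
  define g where "g x = lim (\<lambda>n. f (r n) x)" for x
  have gm[measurable]: "g \<in> borel_measurable lebesgue" unfolding g_def by measurable
  have lim: "AE x in lebesgue. (\<lambda>n. f (r n) x) \<longlonglongrightarrow> g x"
    using conv by eventually_elim (simp add: g_def convergent_LIMSEQ_iff)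
  have est: "(\<lambda>x. f m x - g x) \<in> L2_space \<and> L2_norm (\<lambda>x. f m x - g x) \<le> e"
    if N: "\<And>m n. m \<ge> N \<Longrightarrow> n \<ge> N \<Longrightarrow> L2_norm (\<lambda>x. f m x - f n x) < e" and m: "m \<ge> N" for m N e
  proof -
    have 1: "(\<lambda>x. f m x - f (r n) x) \<in> L2_space" for n by (intro L2_diff f)
    have 2: "(\<lambda>x. f m x - g x) \<in> borel_measurable lebesgue" by auto
    have 3: "AE x in lebesgue. (\<lambda>n. f m x - f (r n) x) \<longlonglongrightarrow> f m x - g x"
      using lim by eventually_elim (intro tendsto_intros)
    have 4: "eventually (\<lambda>n. L2_norm (\<lambda>x. f m x - f (r n) x) \<le> e) sequentially"
      using eventually_ge_at_top[of N]
    proof eventually_elim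
      case (elim n)
      then have "r n \<ge> N" using seq_suble[OF sm, of n] by simp
      then show ?case using N m by (simp add: less_imp_le)
    qed
    show ?thesis using L2_Fatou[OF 1 2 3 4] by simp
  qed
  obtain N where N: "\<forall>m\<ge>N. \<forall>n\<ge>N. L2_norm (\<lambda>x. f m x - f n x) < 1" using Cauchy[of 1] by auto
  then have "(\<lambda>x. f N x - g x) \<in> L2_space" using est[of N 1 N] by auto
  from L2_diff[OF f[of N] this] have gL: "g \<in> L2_space" by simp
  have "(\<lambda>n. L2_norm (\<lambda>x. f n x - g x)) \<longlonglongrightarrow> 0"
  proof (rule LIMSEQ_I)
    fix e :: real assume e: "e > 0"
    then obtain N where N: "\<forall>m\<ge>N. \<forall>n\<ge>N. L2_norm (\<lambda>x. f m x - f n x) < e / 2" using Cauchy[of "e/2"] by auto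
    show "\<exists>N. \<forall>n\<ge>N. norm (L2_norm (\<lambda>x. f n x - g x) - 0) < e"
    proof (rule exI[of _ N], intro allI impI)
      fix n assume "n \<ge> N"
      then have "L2_norm (\<lambda>x. f n x - g x) \<le> e / 2" using est[of N "e/2" n] N by auto
      then show "norm (L2_norm (\<lambda>x. f n x - g x) - 0) < e" using e by simp
    qed
  qed
  with gL show ?thesis using that by blast
qed

lemma closed_L2_subspaceD:
  assumes "closed_L2_subspace V"
  shows "f \<in> V \<Longrightarrow> f \<in> L2_space" "(\<lambda>x. 0) \<in> V"
    "f \<in> V \<Longrightarrow> g \<in> V \<Longrightarrow> (\<lambda>x. f x + g x) \<in> V" "f \<in> V \<Longrightarrow> (\<lambda>x. c * f x) \<in> V"
    "f \<in> V \<Longrightarrow> g \<in> V \<Longrightarrow> (\<lambda>x. f x - g x) \<in> V"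
    "f \<in> L2_closure V \<Longrightarrow> f \<in> V"
proof -
  show "(\<lambda>x. f x - g x) \<in> V" if "f \<in> V" "g \<in> V"
  proof -
    have add: "\<forall>f\<in>V. \<forall>g\<in>V. (\<lambda>x. f x + g x) \<in> V" and cmult: "\<forall>c. \<forall>f\<in>V. (\<lambda>x. c * f x) \<in> V"
      using assms by (simp_all add: closed_L2_subspace_def)
    show ?thesis
      using add[rule_format, OF that(1) cmult[rule_format, OF that(2), of "-1"]] by simp
  qed
qed (use assms in \<open>simp_all add: closed_L2_subspace_def subset_iff\<close>)

lemma L2_closureI_seq:
  assumes "f \<in> L2_space" "\<And>n. g n \<in> A" "(\<lambda>n. L2_norm (\<lambda>x. g n x - f x)) \<longlonglongrightarrow> 0"
  shows "f \<in> L2_closure A"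
  unfolding L2_closure_def
proof (clarsimp simp: assms(1))
  fix e :: real assume "e > 0"
  then obtain n where "L2_norm (\<lambda>x. g n x - f x) < e"
    using assms(3) LIMSEQ_D[of _ 0 e] by fastforce
  then show "\<exists>g\<in>A. L2_norm (\<lambda>x. f x - g x) < e"
    using assms(2) L2_norm_minus_commute by metis
qed

lemma L2_closureD:
  assumes "f \<in> L2_closure A" "e > 0"
  obtains g where "g \<in> A" "L2_norm (\<lambda>x. f x - g x) < e"
  using assms by (auto simp: L2_closure_def)

lemma L2_closureE_seq:
  assumes "f \<in> L2_closure A"
  obtains g where "\<And>n. g n \<in> A" "(\<lambda>n. L2_norm (\<lambda>x. g n x - f x)) \<longlonglongrightarrow> 0"
proof -
  have "\<forall>n. \<exists>g\<in>A. L2_norm (\<lambda>x. f x - g x) < 1 / Suc n"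
    using assms unfolding L2_closure_def by simp
  then obtain g where g: "\<And>n. g n \<in> A" "\<And>n. L2_norm (\<lambda>x. f x - g n x) < 1 / Suc n"
    by metis
  have "(\<lambda>n. L2_norm (\<lambda>x. g n x - f x)) \<longlonglongrightarrow> 0"
    by (rule Lim_null_comparison[OF _ LIMSEQ_inverse_real_of_nat])
      (use g(2) in \<open>auto simp: L2_norm_minus_commute[of _ f] inverse_eq_divide less_imp_le intro!: always_eventually\<close>)
  with g(1) show ?thesis using that by blast
qed

lemma L2_parallelogram:
  assumes "f \<in> L2_space" "g \<in> L2_space"
  shows "(L2_norm (\<lambda>x. f x + g x))\<^sup>2 + (L2_norm (\<lambda>x. f x - g x))\<^sup>2 = 2 * (L2_norm f)\<^sup>2 + 2 * (L2_norm g)\<^sup>2"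
  by (simp add: L2_norm_add_sq L2_norm_diff_sq assms)

theorem L2_projection:
  assumes V: "closed_L2_subspace V" and f: "f \<in> L2_space"
  obtains p where "p \<in> V" "\<And>v. v \<in> V \<Longrightarrow> L2_inner (\<lambda>x. f x - p x) v = 0"
proof -
  note VD = closed_L2_subspaceD[OF V]
  define D where "D = (\<lambda>v. (L2_norm (\<lambda>x. f x - v x))\<^sup>2) ` V"
  define d where "d = Inf D"
  have Dne: "D \<noteq> {}" and Dbdd: "bdd_below D"
    using VD(2) by (auto simp: D_def intro!: bdd_belowI[of _ 0])
  have d_le: "d \<le> (L2_norm (\<lambda>x. f x - v x))\<^sup>2" if "v \<in> V" for v
    unfolding d_def by (rule cInf_lower[OF _ Dbdd]) (auto simp: D_def that)
  have "\<exists>v\<in>V. (L2_norm (\<lambda>x. f x - v x))\<^sup>2 < d + 1 / Suc n" for n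
  proof -
    have "Inf D < d + 1 / Suc n" unfolding d_def by simp
    then show ?thesis using cInf_lessD[OF Dne] unfolding D_def by blast
  qed
  then obtain v where v: "\<And>n. v n \<in> V" "\<And>n. (L2_norm (\<lambda>x. f x - v n x))\<^sup>2 < d + 1 / Suc n"
    by metis
  have vL: "v n \<in> L2_space" for n using VD(1) v(1) by blast
  have est: "(L2_norm (\<lambda>x. v m x - v n x))\<^sup>2 \<le> 2 / Suc m + 2 / Suc n" for m n
  proof -
    define u where "u x = (1/2) * (v m x + v n x)" for x
    have u: "u \<in> V" unfolding u_def by (intro VD(3,4) v)
    have "(L2_norm (\<lambda>x. (f x - v n x) + (f x - v m x)))\<^sup>2 + (L2_norm (\<lambda>x. (f x - v n x) - (f x - v m x)))\<^sup>2
        = 2 * (L2_norm (\<lambda>x. f x - v n x))\<^sup>2 + 2 * (L2_norm (\<lambda>x. f x - v m x))\<^sup>2"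
      by (intro L2_parallelogram L2_diff f vL)
    moreover have "(\<lambda>x. (f x - v n x) + (f x - v m x)) = (\<lambda>x. 2 * (f x - u x))"
      by (auto simp: u_def algebra_simps)
    moreover have "(\<lambda>x. (f x - v n x) - (f x - v m x)) = (\<lambda>x. v m x - v n x)" by auto
    moreover have "L2_norm (\<lambda>x. 2 * (f x - u x)) = 2 * L2_norm (\<lambda>x. f x - u x)"
      by (simp only: L2_norm_cmult) simp
    ultimately have "4 * (L2_norm (\<lambda>x. f x - u x))\<^sup>2 + (L2_norm (\<lambda>x. v m x - v n x))\<^sup>2
        = 2 * (L2_norm (\<lambda>x. f x - v n x))\<^sup>2 + 2 * (L2_norm (\<lambda>x. f x - v m x))\<^sup>2"
      by (simp only: power_mult_distrib) simp
    then show ?thesis using d_le[OF u] v(2)[of m] v(2)[of n] by linarith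
  qed
  \<comment> \<open>By the parallelogram law a minimizing sequence is a Cauchy sequence.\<close>
  have "\<exists>N. \<forall>m\<ge>N. \<forall>n\<ge>N. L2_norm (\<lambda>x. v m x - v n x) < e" if e: "e > 0" for e
  proof -
    obtain N where N: "1 / real (Suc N) < e\<^sup>2 / 4"
      using reals_Archimedean[of "e\<^sup>2/4"] e by (auto simp: inverse_eq_divide)
    have "L2_norm (\<lambda>x. v m x - v n x) < e" if "m \<ge> N" "n \<ge> N" for m n
    proof -
      have "1 / real (Suc m) \<le> 1 / real (Suc N)" "1 / real (Suc n) \<le> 1 / real (Suc N)"
        using that by (auto simp: divide_simps)
      then have "(L2_norm (\<lambda>x. v m x - v n x))\<^sup>2 < e\<^sup>2" using est[of m n] N by linarith
      then show ?thesis using e power2_less_imp_less by (metis less_imp_le)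
    qed
    then show ?thesis by blast
  qed
  from L2_complete[OF vL this] obtain p where p: "p \<in> L2_space" "(\<lambda>n. L2_norm (\<lambda>x. v n x - p x)) \<longlonglongrightarrow> 0"
    by blast
  have pV: "p \<in> V" using L2_closureI_seq[OF p(1) v(1) p(2)] VD(6) by blast
  have "(\<lambda>n. L2_norm (\<lambda>x. f x - v n x)) \<longlonglongrightarrow> L2_norm (\<lambda>x. f x - p x)"
    by (rule L2_norm_tendsto) (use p in \<open>auto intro!: L2_diff f vL simp: L2_norm_minus_commute[of p]\<close>)
  then have "(\<lambda>n. (L2_norm (\<lambda>x. f x - v n x))\<^sup>2) \<longlonglongrightarrow> (L2_norm (\<lambda>x. f x - p x))\<^sup>2"
    by (intro tendsto_intros)
  moreover have "(\<lambda>n. d + 1 / Suc n) \<longlonglongrightarrow> d + 0"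
    by (rule tendsto_add[OF tendsto_const LIMSEQ_inverse_real_of_nat[unfolded inverse_eq_divide]])
  ultimately have pd: "(L2_norm (\<lambda>x. f x - p x))\<^sup>2 \<le> d"
    using LIMSEQ_le[of "\<lambda>n. (L2_norm (\<lambda>x. f x - v n x))\<^sup>2" _ "\<lambda>n. d + 1 / Suc n" "d + 0"] v(2)[THEN less_imp_le]
    by simp
  have "L2_inner (\<lambda>x. f x - p x) w = 0" if w: "w \<in> V" for w
  proof -
    define a where "a = L2_inner (\<lambda>x. f x - p x) w"
    define n where "n = (L2_norm w)\<^sup>2"
    \<comment> \<open>Moving from \<open>p\<close> by \<open>t * a\<close> along \<open>w\<close> changes the squared distance to \<open>f\<close> by
        \<open>(t\<^sup>2 * n - 2 * t) * (cmod a)\<^sup>2\<close>, which is negative for this \<open>t\<close> unless \<open>a = 0\<close>.\<close>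
    define t where "t = 1 / (n + 1)"
    have n: "n \<ge> 0" by (simp add: n_def)
    have t: "t > 0" "t * n \<le> 1" using n by (auto simp: t_def)
    have wL: "w \<in> L2_space" using VD(1) w .
    have "(L2_norm (\<lambda>x. f x - p x))\<^sup>2 \<le> (L2_norm (\<lambda>x. f x - (p x + (t * a) * w x)))\<^sup>2"
      using pd d_le[OF VD(3)[OF pV VD(4)[OF w]]] by (rule order_trans)
    also have "(\<lambda>x. f x - (p x + (t * a) * w x)) = (\<lambda>x. (f x - p x) - (t * a) * w x)" by auto
    also have "(L2_norm \<dots>)\<^sup>2 = (L2_norm (\<lambda>x. f x - p x))\<^sup>2 - 2 * Re (cnj (t * a) * a) + (cmod (t * a))\<^sup>2 * n"
      using f p(1) wL by (simp add: L2_norm_diff_sq L2_cmult L2_diff L2_inner_cmult_right L2_norm_cmult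
          power_mult_distrib a_def n_def)
    also have "Re (cnj (t * a) * a) = t * (cmod a)\<^sup>2"
      by (simp only: cmod_power2) (simp add: power2_eq_square algebra_simps)
    also have "(cmod (t * a))\<^sup>2 * n = (t * n) * (t * (cmod a)\<^sup>2)"
      using t by (simp add: norm_mult power_mult_distrib power2_eq_square)
    finally have "2 * (t * (cmod a)\<^sup>2) \<le> (t * n) * (t * (cmod a)\<^sup>2)" by simp
    also have "\<dots> \<le> 1 * (t * (cmod a)\<^sup>2)" using t by (intro mult_right_mono) auto
    finally have "t * (cmod a)\<^sup>2 \<le> 0" by simp
    then show ?thesis using t by (simp add: a_def mult_le_0_iff)
  qed
  with pV show ?thesis using that by blast
qed

lemma L2_closure_subspace:
  assumes A: "A \<subseteq> L2_space" "(\<lambda>x. 0) \<in> A"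
    "\<And>f g. f \<in> A \<Longrightarrow> g \<in> A \<Longrightarrow> (\<lambda>x. f x + g x) \<in> A"
    "\<And>c f. f \<in> A \<Longrightarrow> (\<lambda>x. c * f x) \<in> A"
  shows "closed_L2_subspace (L2_closure A)"
proof -
  have sub: "L2_closure A \<subseteq> L2_space" by (auto simp: L2_closure_def)
  have Asub: "f \<in> L2_closure A" if "f \<in> A" for f
    by (rule L2_closureI_seq[where g = "\<lambda>_. f"]) (use that A(1) in \<open>auto simp: L2_norm_def\<close>)
  have add: "(\<lambda>x. f x + g x) \<in> L2_closure A" if fg: "f \<in> L2_closure A" "g \<in> L2_closure A" for f g
  proof -
    have L: "f \<in> L2_space" "g \<in> L2_space" using fg sub by auto
    have "\<exists>h\<in>A. L2_norm (\<lambda>x. (f x + g x) - h x) < e" if e: "e > 0" for e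
    proof -
      have e2: "e / 2 > 0" using e by simp
      obtain f' where f': "f' \<in> A" "L2_norm (\<lambda>x. f x - f' x) < e/2" using L2_closureD[OF fg(1) e2] .
      obtain g' where g': "g' \<in> A" "L2_norm (\<lambda>x. g x - g' x) < e/2" using L2_closureD[OF fg(2) e2] .
      note * = f'(1) g'(1) f'(2) g'(2)
      have "L2_norm (\<lambda>x. (f x - f' x) + (g x - g' x)) \<le> L2_norm (\<lambda>x. f x - f' x) + L2_norm (\<lambda>x. g x - g' x)"
        using * A(1) L by (intro L2_norm_triangle L2_diff) auto
      also have "(\<lambda>x. (f x - f' x) + (g x - g' x)) = (\<lambda>x. (f x + g x) - (f' x + g' x))" by auto
      finally show ?thesis using * A(3)[OF *(1,2)] by (intro bexI[of _ "\<lambda>x. f' x + g' x"]) auto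
    qed
    then show ?thesis using L by (simp add: L2_closure_def L2_add)
  qed
  have cmult: "(\<lambda>x. c * f x) \<in> L2_closure A" if f: "f \<in> L2_closure A" for f c
  proof -
    have L: "f \<in> L2_space" using f sub by auto
    have "\<exists>h\<in>A. L2_norm (\<lambda>x. c * f x - h x) < e" if e: "e > 0" for e
    proof -
      have "e / (cmod c + 1) > 0" using e by (simp add: add_nonneg_pos)
      then obtain f' where *: "f' \<in> A" "L2_norm (\<lambda>x. f x - f' x) < e / (cmod c + 1)"
        using L2_closureD[OF f] by blast
      have "L2_norm (\<lambda>x. c * f x - c * f' x) = cmod c * L2_norm (\<lambda>x. f x - f' x)"
        by (simp only: L2_norm_cmult right_diff_distrib[symmetric])
      also have "\<dots> \<le> (cmod c + 1) * L2_norm (\<lambda>x. f x - f' x)" by (intro mult_right_mono) auto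
      also have "\<dots> < e" using *(2) by (simp add: pos_less_divide_eq add_nonneg_pos mult.commute)
      finally show ?thesis using A(4)[OF *(1)] by (intro bexI[of _ "\<lambda>x. c * f' x"]) auto
    qed
    then show ?thesis using L by (simp add: L2_closure_def L2_cmult)
  qed
  have "f \<in> L2_closure A" if f: "f \<in> L2_closure (L2_closure A)" for f
  proof -
    have L: "f \<in> L2_space" using f by (auto simp: L2_closure_def)
    have "\<exists>h\<in>A. L2_norm (\<lambda>x. f x - h x) < e" if e: "e > 0" for e
    proof -
      obtain g where g: "g \<in> L2_closure A" "L2_norm (\<lambda>x. f x - g x) < e/2"
        using L2_closureD[OF f half_gt_zero[OF e]] .
      then obtain h where h: "h \<in> A" "L2_norm (\<lambda>x. g x - h x) < e/2"
        using L2_closureD[OF _ half_gt_zero[OF e]] by blast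
      have "L2_norm (\<lambda>x. f x - h x) \<le> L2_norm (\<lambda>x. f x - g x) + L2_norm (\<lambda>x. g x - h x)"
        using L g h sub A(1) by (intro L2_norm_triangle_diff) auto
      then show ?thesis using g h by (intro bexI[of _ h]) auto
    qed
    then show ?thesis using L by (simp add: L2_closure_def[of A])
  qed
  then show ?thesis
    using sub Asub[OF A(2)] add cmult unfolding closed_L2_subspace_def by blast
qed

lemma lin_span_subset_L2: "(\<And>i. i \<in> I \<Longrightarrow> e i \<in> L2_space) \<Longrightarrow> lin_span I e \<subseteq> L2_space"
  by (auto simp: lin_span_def intro!: L2_sum L2_cmult)

lemma closed_span_subspace:
  assumes "\<And>i. i \<in> I \<Longrightarrow> e i \<in> L2_space"
  shows "closed_L2_subspace (closed_span I e)"
  unfolding closed_span_def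
proof (rule L2_closure_subspace)
  show "lin_span I e \<subseteq> L2_space" by (rule lin_span_subset_L2[OF assms])
  show "(\<lambda>x. 0) \<in> lin_span I e" by (auto simp: lin_span_def intro!: exI[of _ "{}"])
  show "(\<lambda>x. c * f x) \<in> lin_span I e" if f: "f \<in> lin_span I e" for c f
  proof -
    obtain F d where "finite F" "F \<subseteq> I" "f = (\<lambda>x. \<Sum>i\<in>F. d i * e i x)" using f by (auto simp: lin_span_def)
    then show ?thesis
      by (auto simp: lin_span_def sum_distrib_left mult.assoc[symmetric] intro!: exI[of _ F] exI[of _ "\<lambda>i. c * d i"])
  qed
  show "(\<lambda>x. f x + g x) \<in> lin_span I e" if fg: "f \<in> lin_span I e" "g \<in> lin_span I e" for f g
  proof -
    obtain F c where F: "finite F" "F \<subseteq> I" "f = (\<lambda>x. \<Sum>i\<in>F. c i * e i x)" using fg(1) by (auto simp: lin_span_def)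
    obtain G d where G: "finite G" "G \<subseteq> I" "g = (\<lambda>x. \<Sum>i\<in>G. d i * e i x)" using fg(2) by (auto simp: lin_span_def)
    define b where "b i = (if i \<in> F then c i else 0) + (if i \<in> G then d i else 0)" for i
    have "f x + g x = (\<Sum>i\<in>F \<union> G. b i * e i x)" for x
    proof -
      have "f x = (\<Sum>i\<in>F \<union> G. (if i \<in> F then c i else 0) * e i x)"
        unfolding F(3) using F(1) G(1) by (intro sum.mono_neutral_cong_left) auto
      moreover have "g x = (\<Sum>i\<in>F \<union> G. (if i \<in> G then d i else 0) * e i x)"
        unfolding G(3) using F(1) G(1) by (intro sum.mono_neutral_cong_left) auto
      ultimately show ?thesis by (simp add: b_def ring_distribs sum.distrib)
    qed
    then show ?thesis using F(1,2) G(1,2) unfolding lin_span_def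
      by (auto intro!: exI[of _ "F \<union> G"] exI[of _ b])
  qed
qed

lemma in_lin_span: "i \<in> I \<Longrightarrow> e i \<in> lin_span I e"
  unfolding lin_span_def by (auto intro!: exI[of _ "{i}"] exI[of _ "\<lambda>_. 1"])

lemma in_closed_span: "i \<in> I \<Longrightarrow> e i \<in> L2_space \<Longrightarrow> e i \<in> closed_span I e"
  unfolding closed_span_def
  by (rule L2_closureI_seq[where g = "\<lambda>_. e i"]) (auto simp: in_lin_span L2_norm_def)

lemma closed_span_minimal:
  assumes V: "closed_L2_subspace V" and e: "\<And>i. i \<in> I \<Longrightarrow> e i \<in> V"
  shows "closed_span I e \<subseteq> V"
proof -
  note VD = closed_L2_subspaceD[OF V]
  have sums: "(\<lambda>x. \<Sum>i\<in>F. c i * e i x) \<in> V" if "finite F" "F \<subseteq> I" for F c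
    using that by (induction F) (auto simp: VD(2) intro!: VD(3) VD(4) e)
  have sub: "lin_span I e \<subseteq> V" unfolding lin_span_def using sums by blast
  show ?thesis
  proof
    fix f assume "f \<in> closed_span I e"
    then have "f \<in> L2_closure V" using sub unfolding closed_span_def L2_closure_def by blast
    then show "f \<in> V" by (rule VD(6))
  qed
qed

lemma closed_L2_subspace_orthogonal:
  assumes w: "w \<in> L2_space"
  shows "closed_L2_subspace {f \<in> L2_space. L2_inner f w = 0}"
proof -
  have cl: "L2_inner f w = 0" if f: "f \<in> L2_closure {f \<in> L2_space. L2_inner f w = 0}" for f
  proof -
    have L: "f \<in> L2_space" using f by (auto simp: L2_closure_def)
    have "cmod (L2_inner f w) \<le> e" if e: "e > 0" for e
    proof -
      have pos: "L2_norm w + 1 > 0" by (simp add: add_nonneg_pos)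
      then have "e / (L2_norm w + 1) > 0" using e by simp
      then obtain g where g: "g \<in> L2_space" "L2_inner g w = 0" "L2_norm (\<lambda>x. f x - g x) < e / (L2_norm w + 1)"
        using L2_closureD[OF f] by blast
      have "cmod (L2_inner f w) = cmod (L2_inner (\<lambda>x. f x - g x) w)"
        using L w g by (simp add: L2_inner_diff_left)
      also have "\<dots> \<le> L2_norm (\<lambda>x. f x - g x) * L2_norm w"
        using L w g by (intro L2_Cauchy_Schwarz L2_diff)
      also have "\<dots> \<le> e / (L2_norm w + 1) * (L2_norm w + 1)"
        using g e by (intro mult_mono) auto
      also have "\<dots> = e" using pos by simp
      finally show ?thesis .
    qed
    then have "cmod (L2_inner f w) \<le> 0" by (rule field_le_epsilon) simp
    then show ?thesis by simp
  qed
  show ?thesis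
    unfolding closed_L2_subspace_def
  proof (intro conjI ballI allI subsetI CollectI)
    fix f assume f: "f \<in> L2_closure {f \<in> L2_space. L2_inner f w = 0}"
    show "L2_inner f w = 0" by (rule cl[OF f])
    show "f \<in> L2_space" using f by (simp add: L2_closure_def)
  qed (auto simp: L2_inner_add_left L2_inner_cmult_left w intro: L2_zero L2_add L2_cmult, simp add: L2_inner_def)
qed

section \<open>Functions annihilated by a group of characters\<close>

definition chr :: "real^'d \<Rightarrow> real^'d \<Rightarrow> complex"
  where "chr v \<omega> = cis (2 * pi * (v \<bullet> \<omega>))"

lemma chr_add_left: "chr (v + w) \<omega> = chr v \<omega> * chr w \<omega>"
  and chr_add_right: "chr v (\<omega> + \<eta>) = chr v \<omega> * chr v \<eta>"
  and chr_minus_left: "chr (- v) \<omega> = cnj (chr v \<omega>)"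
  and chr_diff_left: "chr (v - w) \<omega> = chr v \<omega> * cnj (chr w \<omega>)"
  and chr_diff_right: "chr v (\<omega> - \<eta>) = chr v \<omega> * cnj (chr v \<eta>)"
  by (simp_all add: chr_def cis_mult cis_cnj inner_add_left inner_add_right inner_diff_left
      inner_diff_right ring_distribs)

lemma chr_commute: "chr v \<omega> = chr \<omega> v"
  by (simp add: chr_def inner_commute)

lemma chr_zero [simp]: "chr 0 \<omega> = 1" "chr v 0 = 1"
  by (simp_all add: chr_def)

lemma norm_chr [simp]: "cmod (chr v \<omega>) = 1"
  by (simp add: chr_def)

lemma continuous_chr: "continuous_on UNIV (chr v)"
  unfolding chr_def[abs_def] by (intro continuous_intros)

lemma chr_borel [measurable]: "chr v \<in> borel_measurable borel"
  by (rule borel_measurable_continuous_onI[OF continuous_chr])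

lemma borel_imp_lebesgue_measurable:
  "f \<in> borel_measurable borel \<Longrightarrow> f \<in> borel_measurable lebesgue"
  by (simp add: measurable_completion)

lemma chr_lebesgue [measurable]: "chr v \<in> borel_measurable lebesgue"
  by (rule borel_imp_lebesgue_measurable) simp

lemma integrable_mult_bounded:
  fixes h p :: "real^'d \<Rightarrow> complex"
  assumes "integrable lebesgue h" "p \<in> borel_measurable lebesgue" "\<And>\<omega>. cmod (p \<omega>) \<le> C"
  shows "integrable lebesgue (\<lambda>\<omega>. h \<omega> * p \<omega>)"
proof (rule Bochner_Integration.integrable_bound)
  show "integrable lebesgue (\<lambda>\<omega>. C * norm (h \<omega>))"
    using assms by auto
  have "C \<ge> 0" using norm_ge_zero order_trans assms(3) by blast
  then show "AE \<omega> in lebesgue. norm (h \<omega> * p \<omega>) \<le> norm (C * norm (h \<omega>))"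
    using assms(3) by (auto simp: norm_mult mult.commute[of C] abs_mult intro!: mult_left_mono)
qed (use assms in auto)

lemma integrable_mult_chr:
  "integrable lebesgue h \<Longrightarrow> integrable lebesgue (\<lambda>\<omega>. h \<omega> * chr v \<omega>)"
  by (rule integrable_mult_bounded[where C = 1]) auto

definition annihilated :: "(real^'d) set \<Rightarrow> (real^'d \<Rightarrow> complex) \<Rightarrow> bool"
  where "annihilated \<Gamma> h \<longleftrightarrow>
    integrable lebesgue h \<and> (\<forall>v\<in>\<Gamma>. (LINT \<omega>|lebesgue. h \<omega> * chr v \<omega>) = 0)"

text \<open>
  The quantification over all annihilated functions, rather than over one of them, makes this
  class closed under products.
\<close>

definition annihilator_multiplier :: "(real^'d) set \<Rightarrow> (real^'d \<Rightarrow> complex) \<Rightarrow> bool"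
  where "annihilator_multiplier \<Gamma> p \<longleftrightarrow>
    p \<in> borel_measurable lebesgue \<and> (\<exists>C. \<forall>\<omega>. cmod (p \<omega>) \<le> C) \<and>
    (\<forall>h. annihilated \<Gamma> h \<longrightarrow> annihilated \<Gamma> (\<lambda>\<omega>. h \<omega> * p \<omega>))"

lemma annihilated_add:
  "annihilated \<Gamma> f \<Longrightarrow> annihilated \<Gamma> g \<Longrightarrow> annihilated \<Gamma> (\<lambda>\<omega>. f \<omega> + g \<omega>)"
  by (simp add: annihilated_def ring_distribs integrable_mult_chr)

lemma annihilated_cmult: "annihilated \<Gamma> f \<Longrightarrow> annihilated \<Gamma> (\<lambda>\<omega>. c * f \<omega>)"
  by (simp add: annihilated_def mult.assoc)

lemma annihilator_multiplier_const: "annihilator_multiplier \<Gamma> (\<lambda>_. c)"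
  using annihilated_cmult[of \<Gamma> _ c] by (auto simp: annihilator_multiplier_def mult.commute)

lemma annihilator_multiplier_add:
  assumes "annihilator_multiplier \<Gamma> p" "annihilator_multiplier \<Gamma> q"
  shows "annihilator_multiplier \<Gamma> (\<lambda>\<omega>. p \<omega> + q \<omega>)"
proof -
  obtain C D where "\<And>\<omega>. cmod (p \<omega>) \<le> C" "\<And>\<omega>. cmod (q \<omega>) \<le> D"
    using assms by (auto simp: annihilator_multiplier_def)
  then have "cmod (p \<omega> + q \<omega>) \<le> C + D" for \<omega> by (meson add_mono norm_triangle_le)
  moreover have "(\<lambda>\<omega>. p \<omega> + q \<omega>) \<in> borel_measurable lebesgue"
    using assms by (auto simp: annihilator_multiplier_def)
  ultimately show ?thesis
    using assms annihilated_add unfolding annihilator_multiplier_def ring_distribs by blast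
qed

lemma annihilator_multiplier_mult:
  assumes "annihilator_multiplier \<Gamma> p" "annihilator_multiplier \<Gamma> q"
  shows "annihilator_multiplier \<Gamma> (\<lambda>\<omega>. p \<omega> * q \<omega>)"
proof -
  obtain C D where *: "\<And>\<omega>. cmod (p \<omega>) \<le> C" "\<And>\<omega>. cmod (q \<omega>) \<le> D"
    using assms by (auto simp: annihilator_multiplier_def)
  then have "C \<ge> 0" by (meson norm_ge_zero order_trans)
  then have "cmod (p \<omega> * q \<omega>) \<le> C * D" for \<omega> unfolding norm_mult by (intro mult_mono *) auto
  moreover have "(\<lambda>\<omega>. p \<omega> * q \<omega>) \<in> borel_measurable lebesgue"
    using assms by (auto simp: annihilator_multiplier_def)
  ultimately show ?thesis
    using assms unfolding annihilator_multiplier_def mult.assoc[symmetric] by blast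
qed

lemma annihilator_multiplier_limit:
  assumes p: "\<And>n. annihilator_multiplier \<Gamma> (p n)" and C: "\<And>n \<omega>. cmod (p n \<omega>) \<le> C"
    and lim: "\<And>\<omega>. (\<lambda>n. p n \<omega>) \<longlonglongrightarrow> q \<omega>"
  shows "annihilator_multiplier \<Gamma> q"
proof -
  have pm[measurable]: "p n \<in> borel_measurable lebesgue" for n
    using p by (auto simp: annihilator_multiplier_def)
  have qm: "q \<in> borel_measurable lebesgue"
    by (rule borel_measurable_LIMSEQ_metric[OF pm lim])
  have qC: "cmod (q \<omega>) \<le> C" for \<omega>
    by (rule tendsto_upperbound[OF tendsto_norm[OF lim]]) (auto simp: C)
  have "annihilated \<Gamma> (\<lambda>\<omega>. h \<omega> * q \<omega>)" if h: "annihilated \<Gamma> h" for h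
    unfolding annihilated_def
  proof (intro conjI ballI)
    have hi: "integrable lebesgue h" using h by (simp add: annihilated_def)
    then show hq: "integrable lebesgue (\<lambda>\<omega>. h \<omega> * q \<omega>)" by (rule integrable_mult_bounded[OF _ qm qC])
    fix v assume v: "v \<in> \<Gamma>"
    have "(\<lambda>n. LINT \<omega>|lebesgue. h \<omega> * p n \<omega> * chr v \<omega>) \<longlonglongrightarrow> (LINT \<omega>|lebesgue. h \<omega> * q \<omega> * chr v \<omega>)"
    proof (rule integral_dominated_convergence[where w = "\<lambda>\<omega>. C * norm (h \<omega>)"])
      have "C \<ge> 0" using C norm_ge_zero order_trans by blast
      then show "AE \<omega> in lebesgue. norm (h \<omega> * p n \<omega> * chr v \<omega>) \<le> C * norm (h \<omega>)" for n
        using C by (auto simp: norm_mult mult.commute[of C] intro!: mult_left_mono)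
      show "AE \<omega> in lebesgue. (\<lambda>n. h \<omega> * p n \<omega> * chr v \<omega>) \<longlonglongrightarrow> h \<omega> * q \<omega> * chr v \<omega>"
        by (intro always_eventually allI tendsto_intros lim)
    qed (use hi qm in \<open>auto intro!: borel_measurable_times\<close>)
    moreover have "(LINT \<omega>|lebesgue. h \<omega> * p n \<omega> * chr v \<omega>) = 0" for n
      using p[of n] h v by (auto simp: annihilator_multiplier_def annihilated_def)
    ultimately show "(LINT \<omega>|lebesgue. h \<omega> * q \<omega> * chr v \<omega>) = 0"
      by (simp add: LIMSEQ_const_iff)
  qed
  with qm qC show ?thesis unfolding annihilator_multiplier_def by blast
qed

lemma annihilator_multiplier_chr:
  assumes "v \<in> \<Gamma>" "\<And>v w. v \<in> \<Gamma> \<Longrightarrow> w \<in> \<Gamma> \<Longrightarrow> v + w \<in> \<Gamma>"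
  shows "annihilator_multiplier \<Gamma> (chr v)"
proof -
  have "annihilated \<Gamma> (\<lambda>\<omega>. h \<omega> * chr v \<omega>)" if h: "annihilated \<Gamma> h" for h
    unfolding annihilated_def
  proof (intro conjI ballI)
    show "integrable lebesgue (\<lambda>\<omega>. h \<omega> * chr v \<omega>)"
      using h by (intro integrable_mult_chr) (simp add: annihilated_def)
    fix w assume "w \<in> \<Gamma>"
    then have "(LINT \<omega>|lebesgue. h \<omega> * chr (v + w) \<omega>) = 0"
      using h assms by (auto simp: annihilated_def)
    then show "(LINT \<omega>|lebesgue. h \<omega> * chr v \<omega> * chr w \<omega>) = 0"
      by (simp add: chr_add_left mult.assoc)
  qed
  then show ?thesis unfolding annihilator_multiplier_def using norm_chr by auto
qed

text \<open>
  The sets whose indicators are multipliers. Integrals of an annihilated function over them vanish as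
  soon as \<open>0 \<in> \<Gamma>\<close>, so uniqueness theorems reduce to showing that there are enough of them.
\<close>

definition multiplier_sets :: "(real^'d) set \<Rightarrow> (real^'d) set set"
  where "multiplier_sets \<Gamma> = {E. annihilator_multiplier \<Gamma> (indicator E)}"

text \<open>
  Multipliers form an algebra containing the constants, which gives complements and finite unions.
  A countable union is the bounded pointwise limit of finite ones.
\<close>

lemma sigma_algebra_multiplier_sets:
  fixes \<Gamma> :: "(real^'d) set"
  shows "sigma_algebra UNIV (multiplier_sets \<Gamma>)"
  unfolding sigma_algebra_iff2
proof (intro conjI ballI allI impI)
  show "{} \<in> multiplier_sets \<Gamma>"
    using annihilator_multiplier_const[of \<Gamma> 0] by (simp add: multiplier_sets_def indicator_def[abs_def])
  fix s assume s: "s \<in> multiplier_sets \<Gamma>"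
  have "annihilator_multiplier \<Gamma> (\<lambda>\<omega>. 1 + (- 1) * indicator s \<omega>)"
    using s by (intro annihilator_multiplier_add annihilator_multiplier_mult annihilator_multiplier_const)
      (simp add: multiplier_sets_def)
  also have "(\<lambda>\<omega>. 1 + (- 1) * indicator s \<omega>) = (indicator (UNIV - s) :: _ \<Rightarrow> complex)"
    by (auto simp: indicator_def)
  finally show "UNIV - s \<in> multiplier_sets \<Gamma>" by (simp add: multiplier_sets_def)
next
  fix A :: "nat \<Rightarrow> (real^'d) set" assume A: "range A \<subseteq> multiplier_sets \<Gamma>"
  define q where "q n \<omega> = (\<Prod>i<n. 1 + (- 1) * indicator (A i) \<omega> :: complex)" for n \<omega>
  have m: "annihilator_multiplier \<Gamma> (q n)" for n
  proof (induction n)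
    case 0
    show ?case using annihilator_multiplier_const[of \<Gamma> 1] by (simp add: q_def[abs_def])
  next
    case (Suc n)
    have "annihilator_multiplier \<Gamma> (indicator (A n))" using A by (auto simp: multiplier_sets_def)
    then have "annihilator_multiplier \<Gamma> (\<lambda>\<omega>. q n \<omega> * (1 + (- 1) * indicator (A n) \<omega>))"
      by (intro annihilator_multiplier_mult Suc annihilator_multiplier_add annihilator_multiplier_const)
    then show ?case by (simp add: q_def[abs_def])
  qed
  have q: "q n \<omega> = (if \<exists>i<n. \<omega> \<in> A i then 0 else 1)" for n \<omega>
  proof (cases "\<exists>i<n. \<omega> \<in> A i")
    case True
    then obtain i where "i < n" "\<omega> \<in> A i" by auto
    then have "q n \<omega> = 0" unfolding q_def by (intro prod_zero) (auto intro!: bexI[of _ i])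
    with True show ?thesis by simp
  next
    case False
    then show ?thesis by (auto simp: q_def intro!: prod.neutral)
  qed
  have "annihilator_multiplier \<Gamma> (indicator (\<Union>(range A)))"
  proof (rule annihilator_multiplier_limit[where p = "\<lambda>n \<omega>. 1 + (- 1) * q n \<omega>" and C = 1])
    show "annihilator_multiplier \<Gamma> (\<lambda>\<omega>. 1 + (- 1) * q n \<omega>)" for n
      by (intro annihilator_multiplier_add annihilator_multiplier_mult annihilator_multiplier_const m)
    show "cmod (1 + (- 1) * q n \<omega>) \<le> 1" for n \<omega> by (simp add: q)
    show "(\<lambda>n. 1 + (- 1) * q n \<omega>) \<longlonglongrightarrow> indicator (\<Union>(range A)) \<omega>" for \<omega>
    proof (cases "\<exists>i. \<omega> \<in> A i")
      case True
      then obtain i where i: "\<omega> \<in> A i" by auto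
      have "eventually (\<lambda>n. 1 + (- 1) * q n \<omega> = indicator (\<Union>(range A)) \<omega>) sequentially"
        using eventually_gt_at_top[of i] by eventually_elim (use i in \<open>auto simp: q indicator_def\<close>)
      then show ?thesis by (rule tendsto_eventually)
    next
      case False
      then have "1 + (- 1) * q n \<omega> = indicator (\<Union>(range A)) \<omega>" for n by (auto simp: q indicator_def)
      then show ?thesis by simp
    qed
  qed
  then show "\<Union>(range A) \<in> multiplier_sets \<Gamma>" by (simp add: multiplier_sets_def)
qed auto

lemma real_polynomial_complex_expand:
  assumes "bounded_linear (f :: complex \<Rightarrow> real)"
  shows "f z = Re z * f 1 + Im z * f \<i>"
proof -
  interpret bounded_linear f by fact
  have "f z = f (Re z *\<^sub>R 1 + Im z *\<^sub>R \<i>)"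
    by (rule arg_cong[where f = f]) (simp add: complex_eq_iff)
  then show ?thesis by (simp only: add scaleR real_scaleR_def)
qed

lemma annihilator_multiplier_polynomial:
  assumes \<Gamma>: "\<And>v w. v \<in> \<Gamma> \<Longrightarrow> w \<in> \<Gamma> \<Longrightarrow> v + w \<in> \<Gamma>" "\<And>v. v \<in> \<Gamma> \<Longrightarrow> - v \<in> \<Gamma>" and v: "v \<in> \<Gamma>"
    and p: "real_polynomial_function (p :: complex \<Rightarrow> real)"
  shows "annihilator_multiplier \<Gamma> (\<lambda>\<omega>. complex_of_real (p (chr v \<omega>)))"
  using p
proof induction
  case (linear f)
  have "annihilator_multiplier \<Gamma> (\<lambda>\<omega>. (complex_of_real (f 1) / 2) * (chr v \<omega> + chr (- v) \<omega>)
      + (complex_of_real (f \<i>) / (2 * \<i>)) * (chr v \<omega> + (- 1) * chr (- v) \<omega>))"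
    by (intro annihilator_multiplier_add annihilator_multiplier_mult annihilator_multiplier_const
        annihilator_multiplier_chr \<Gamma> v)
  also have "(\<lambda>\<omega>. (complex_of_real (f 1) / 2) * (chr v \<omega> + chr (- v) \<omega>)
      + (complex_of_real (f \<i>) / (2 * \<i>)) * (chr v \<omega> + (- 1) * chr (- v) \<omega>)) = (\<lambda>\<omega>. complex_of_real (f (chr v \<omega>)))"
    by (subst real_polynomial_complex_expand[OF linear])
      (auto simp: chr_minus_left complex_add_cnj complex_diff_cnj complex_eq_iff)
  finally show ?case .
qed (auto intro: annihilator_multiplier_const annihilator_multiplier_add annihilator_multiplier_mult)

text \<open>
  By Stone--Weierstrass, a continuous function on the circle is a uniform limit of polynomials in the
  real and imaginary part of the circle variable. Composed with a character \<open>chr v\<close>, these are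
  linear combinations of products of \<open>chr v\<close> and \<open>chr (- v)\<close>.
\<close>

lemma annihilator_multiplier_continuous:
  assumes \<Gamma>: "\<And>v w. v \<in> \<Gamma> \<Longrightarrow> w \<in> \<Gamma> \<Longrightarrow> v + w \<in> \<Gamma>" "\<And>v. v \<in> \<Gamma> \<Longrightarrow> - v \<in> \<Gamma>" and v: "v \<in> \<Gamma>"
    and f: "continuous_on UNIV (f :: complex \<Rightarrow> real)"
  shows "annihilator_multiplier \<Gamma> (\<lambda>\<omega>. complex_of_real (f (chr v \<omega>)))"
proof -
  have cont: "continuous_on (sphere 0 1) f" using f continuous_on_subset by blast
  have "\<exists>g. real_polynomial_function g \<and> (\<forall>z\<in>sphere 0 1. \<bar>f z - g z\<bar> < 1 / Suc n)" for n
    by (rule Stone_Weierstrass_real_polynomial_function[OF compact_sphere cont, of "1 / Suc n"]) auto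
  then obtain g where g: "\<And>n. real_polynomial_function (g n)"
    "\<And>n z. z \<in> sphere 0 1 \<Longrightarrow> \<bar>f z - g n z\<bar> < 1 / Suc n" by metis
  have "bounded (f ` sphere 0 1)"
    by (intro compact_imp_bounded compact_continuous_image cont compact_sphere)
  then obtain B where B: "\<And>z. z \<in> sphere 0 1 \<Longrightarrow> \<bar>f z\<bar> \<le> B"
    unfolding bounded_iff real_norm_def by blast
  have S: "chr v \<omega> \<in> sphere 0 1" for \<omega> by simp
  show ?thesis
  proof (rule annihilator_multiplier_limit)
    show "annihilator_multiplier \<Gamma> (\<lambda>\<omega>. complex_of_real (g n (chr v \<omega>)))" for n
      by (rule annihilator_multiplier_polynomial[OF \<Gamma> v g(1)])
    show "cmod (complex_of_real (g n (chr v \<omega>))) \<le> B + 1" for n \<omega>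
    proof -
      have "1 / real (Suc n) \<le> 1" by simp
      then show ?thesis unfolding norm_of_real using g(2)[OF S, of \<omega> n] B[OF S, of \<omega>] by linarith
    qed
    show "(\<lambda>n. complex_of_real (g n (chr v \<omega>))) \<longlonglongrightarrow> complex_of_real (f (chr v \<omega>))" for \<omega>
    proof (rule tendsto_of_real, rule LIM_zero_cancel)
      have "norm (g n (chr v \<omega>) - f (chr v \<omega>)) \<le> inverse (real (Suc n))" for n
        using g(2)[OF S, of \<omega> n] unfolding real_norm_def inverse_eq_divide by linarith
      then show "(\<lambda>n. g n (chr v \<omega>) - f (chr v \<omega>)) \<longlonglongrightarrow> 0"
        by (intro Lim_null_comparison[OF _ LIMSEQ_inverse_real_of_nat] always_eventually allI)
    qed
  qed
qed

lemma chr_vimage_open_multiplier: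
  assumes \<Gamma>: "\<And>v w. v \<in> \<Gamma> \<Longrightarrow> w \<in> \<Gamma> \<Longrightarrow> v + w \<in> \<Gamma>" "\<And>v. v \<in> \<Gamma> \<Longrightarrow> - v \<in> \<Gamma>" and v: "v \<in> \<Gamma>"
    and U: "open U"
  shows "chr v -` U \<in> multiplier_sets \<Gamma>"
proof (cases "U = UNIV")
  case True
  then show ?thesis
    using annihilator_multiplier_const[of \<Gamma> 1] by (simp add: multiplier_sets_def indicator_def[abs_def])
next
  case False
  \<comment> \<open>Continuous functions increasing to the indicator of \<open>U\<close>.\<close>
  define f where "f n z = min 1 (real n * infdist z (- U))" for n and z :: complex
  have ne: "- U \<noteq> {}" "closed (- U)" using False U by auto
  have "annihilator_multiplier \<Gamma> (indicator (chr v -` U))"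
  proof (rule annihilator_multiplier_limit)
    show "annihilator_multiplier \<Gamma> (\<lambda>\<omega>. complex_of_real (f n (chr v \<omega>)))" for n
      by (rule annihilator_multiplier_continuous[OF \<Gamma> v]) (auto simp: f_def[abs_def] intro!: continuous_intros)
    show "cmod (complex_of_real (f n (chr v \<omega>))) \<le> 1" for n \<omega>
      by (auto simp: f_def infdist_nonneg)
    show "(\<lambda>n. complex_of_real (f n (chr v \<omega>))) \<longlonglongrightarrow> indicator (chr v -` U) \<omega>" for \<omega>
    proof (cases "chr v \<omega> \<in> U")
      case True
      then have "infdist (chr v \<omega>) (- U) > 0"
        using in_closed_iff_infdist_zero[OF ne(2,1)] infdist_nonneg[of "chr v \<omega>" "- U"] by force
      then obtain N where N: "1 \<le> real N * infdist (chr v \<omega>) (- U)"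
        using reals_Archimedean3 less_imp_le by metis
      have "eventually (\<lambda>n. complex_of_real (f n (chr v \<omega>)) = indicator (chr v -` U) \<omega>) sequentially"
        using eventually_ge_at_top[of N]
      proof eventually_elim
        case (elim n)
        then have "real N * infdist (chr v \<omega>) (- U) \<le> real n * infdist (chr v \<omega>) (- U)"
          by (intro mult_right_mono infdist_nonneg) auto
        then show ?case using N True by (simp add: f_def min_def)
      qed
      then show ?thesis by (rule tendsto_eventually)
    next
      case False
      then have "infdist (chr v \<omega>) (- U) = 0" by simp
      then show ?thesis using False by (simp add: f_def)
    qed
  qed
  then show ?thesis by (simp add: multiplier_sets_def)
qed

lemma chr_measurable_multiplier:
  assumes \<Gamma>: "\<And>v w. v \<in> \<Gamma> \<Longrightarrow> w \<in> \<Gamma> \<Longrightarrow> v + w \<in> \<Gamma>" "\<And>v. v \<in> \<Gamma> \<Longrightarrow> - v \<in> \<Gamma>" and v: "v \<in> \<Gamma>"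
  shows "chr v \<in> borel_measurable (sigma UNIV (multiplier_sets \<Gamma>))"
proof (rule borel_measurableI)
  fix U :: "complex set" assume "open U"
  then show "chr v -` U \<inter> space (sigma UNIV (multiplier_sets \<Gamma>)) \<in> sets (sigma UNIV (multiplier_sets \<Gamma>))"
    using chr_vimage_open_multiplier[OF \<Gamma> v]
    by (simp add: sigma_algebra.sets_measure_of_eq[OF sigma_algebra_multiplier_sets])
qed

lemma integral_vimage_zero_if_annihilated:
  assumes h: "annihilated \<Gamma> h" and "0 \<in> \<Gamma>"
    and g: "g \<in> borel_measurable (sigma UNIV (multiplier_sets \<Gamma>))" and A: "A \<in> sets borel"
  shows "(LINT \<omega>|lebesgue. h \<omega> * indicator A (g \<omega>)) = 0"
proof -
  have "g -` A \<in> multiplier_sets \<Gamma>"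
    using measurable_sets[OF g A] by (simp add: sigma_algebra.sets_measure_of_eq[OF sigma_algebra_multiplier_sets])
  then have "annihilated \<Gamma> (\<lambda>\<omega>. h \<omega> * indicator (g -` A) \<omega>)"
    using h by (auto simp: multiplier_sets_def annihilator_multiplier_def)
  then have "(LINT \<omega>|lebesgue. h \<omega> * indicator (g -` A) \<omega> * chr 0 \<omega>) = 0"
    using \<open>0 \<in> \<Gamma>\<close> by (auto simp: annihilated_def)
  then show ?thesis by (simp add: indicator_vimage)
qed

lemma sigma_finite_lebesgue: "sigma_finite_measure (lebesgue :: 'a::euclidean_space measure)"
proof
  obtain A :: "'a set set" where "countable A" "A \<subseteq> sets lborel" "\<Union>A = space lborel"
    "\<forall>a\<in>A. emeasure lborel a \<noteq> \<infinity>"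
    using lborel.sigma_finite_countable by blast
  then show "\<exists>A. countable A \<and> A \<subseteq> sets lebesgue \<and> \<Union>A = space (lebesgue :: 'a measure) \<and>
      (\<forall>a\<in>A. emeasure lebesgue a \<noteq> \<infinity>)"
  proof (intro exI[of _ A] conjI)
    show "A \<subseteq> sets lebesgue" using \<open>A \<subseteq> sets lborel\<close> by (meson sets_completionI_sets subset_iff)
    show "\<forall>a\<in>A. emeasure lebesgue a \<noteq> \<infinity>"
    proof
      fix a assume a: "a \<in> A"
      then have "a \<in> sets lborel" using \<open>A \<subseteq> sets lborel\<close> by blast
      then have "emeasure lebesgue a = emeasure lborel a" by simp
      with a show "emeasure lebesgue a \<noteq> \<infinity>" using \<open>\<forall>a\<in>A. emeasure lborel a \<noteq> \<infinity>\<close> by metis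
    qed
  qed auto
qed

text \<open>
  The multiplier argument only reaches Borel sets, whereas functions here are merely Lebesgue
  measurable. A Lebesgue set differs from a Borel set by a null set.
\<close>

lemma AE_zero_if_borel_integrals_zero:
  fixes f :: "real^'d \<Rightarrow> complex"
  assumes f: "integrable lebesgue f"
    and zero: "\<And>A. A \<in> sets borel \<Longrightarrow> (LINT \<omega>|lebesgue. f \<omega> * indicator A \<omega>) = 0"
  shows "AE \<omega> in lebesgue. f \<omega> = 0"
proof (rule sigma_finite_measure.density_zero[OF sigma_finite_lebesgue f])
  fix A :: "(real^'d) set" assume A: "A \<in> sets lebesgue"
  then obtain S N N' where S: "A = S \<union> N" "N \<subseteq> N'" "N' \<in> null_sets lborel" "S \<in> sets lborel"
    using sets_completionE by blast
  have "AE \<omega> in lebesgue. \<omega> \<notin> N'" using S(3) by (intro AE_completion AE_not_in)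
  then have "AE \<omega> in lebesgue. indicator A \<omega> *\<^sub>R f \<omega> = f \<omega> * indicator S \<omega>"
    by eventually_elim (use S in \<open>auto simp: indicator_def\<close>)
  moreover have "S \<in> sets lebesgue" using S(4) by auto
  ultimately have "set_lebesgue_integral lebesgue A f = (LINT \<omega>|lebesgue. f \<omega> * indicator S \<omega>)"
    unfolding set_lebesgue_integral_def using f A
    by (intro integral_cong_AE) (auto intro!: borel_measurable_times borel_measurable_scaleR)
  then show "set_lebesgue_integral lebesgue A f = 0" using zero S(4) by simp
qed

lemma borel_measurable_Arg: "Arg \<in> borel_measurable borel"
proof -
  have nz: "z \<noteq> 0 \<and> z \<in> \<real>\<^sub>\<le>\<^sub>0 \<Longrightarrow> Arg z = pi" for z
    by (metis Arg_eq_pi complex_nonpos_Reals_iff less_eq_real_def complex_is_Real_iff complex_eq_iff zero_complex.simps)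
  have "(\<lambda>z. indicator (- \<real>\<^sub>\<le>\<^sub>0) z *\<^sub>R Arg z + pi * indicator (\<real>\<^sub>\<le>\<^sub>0 - {0}) z) \<in> borel_measurable borel"
  proof (intro borel_measurable_add borel_measurable_times borel_measurable_const borel_measurable_indicator)
    have o: "open (- \<real>\<^sub>\<le>\<^sub>0 :: complex set)" by (simp add: closed_nonpos_Reals_complex open_Compl)
    show "(\<lambda>z. indicator (- \<real>\<^sub>\<le>\<^sub>0) z *\<^sub>R Arg z) \<in> borel_measurable borel"
      by (intro borel_measurable_continuous_on_indicator borel_open o continuous_at_imp_continuous_on)
        (auto intro: continuous_at_Arg)
    show "\<real>\<^sub>\<le>\<^sub>0 - {0} \<in> sets (borel :: complex measure)"
      by (intro sets.Diff borel_closed closed_nonpos_Reals_complex) auto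
  qed
  also have "(\<lambda>z. indicator (- \<real>\<^sub>\<le>\<^sub>0) z *\<^sub>R Arg z + pi * indicator (\<real>\<^sub>\<le>\<^sub>0 - {0}) z) = Arg"
    using nz by (auto simp: fun_eq_iff indicator_def Arg_zero)
  finally show ?thesis .
qed

lemma borel_measurable_vecI:
  fixes f :: "'a \<Rightarrow> real^'d"
  assumes "\<And>i. (\<lambda>x. f x $ i) \<in> borel_measurable M"
  shows "f \<in> borel_measurable M"
  by (subst borel_measurable_euclidean_space) (use assms in \<open>auto simp: Basis_vec_def inner_axis\<close>)

text \<open>
  The coordinate \<open>\<omega> $ i\<close> equals \<open>N * Arg (chr v \<omega>) / (2 * pi)\<close> for \<open>v = axis i (1 / N)\<close>, once \<open>N\<close>
  exceeds \<open>2 * \<bar>\<omega> $ i\<bar>\<close>. Hence, when all characters are available, the coordinates are measurable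
  with respect to the multiplier sets, and every Borel set is a multiplier set.
\<close>

theorem fourier_uniqueness:
  fixes h :: "real^'d \<Rightarrow> complex"
  assumes h: "integrable lebesgue h" and zero: "\<And>v. (LINT \<omega>|lebesgue. h \<omega> * chr v \<omega>) = 0"
  shows "AE \<omega> in lebesgue. h \<omega> = 0"
proof (rule AE_zero_if_borel_integrals_zero[OF h])
  define M where "M = sigma UNIV (multiplier_sets (UNIV :: (real^'d) set))"
  have "(\<lambda>\<omega>. \<omega> $ i) \<in> borel_measurable M" for i :: 'd
  proof (rule borel_measurable_LIMSEQ_real)
    define v :: "nat \<Rightarrow> real^'d" where "v n = axis i (1 / Suc n)" for n
    show "(\<lambda>\<omega>. Suc n * (Arg (chr (v n) \<omega>) / (2 * pi))) \<in> borel_measurable M" for n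
      unfolding M_def
      by (intro borel_measurable_times borel_measurable_divide borel_measurable_const
          measurable_compose[OF chr_measurable_multiplier borel_measurable_Arg]) auto
    show "(\<lambda>n. Suc n * (Arg (chr (v n) \<omega>) / (2 * pi))) \<longlonglongrightarrow> \<omega> $ i" for \<omega>
    proof (rule tendsto_eventually)
      obtain N where N: "2 * \<bar>\<omega> $ i\<bar> < real N" using reals_Archimedean2 by blast
      show "eventually (\<lambda>n. Suc n * (Arg (chr (v n) \<omega>) / (2 * pi)) = \<omega> $ i) sequentially"
        using eventually_ge_at_top[of N]
      proof eventually_elim
        case (elim n)
        then have "2 * \<bar>\<omega> $ i\<bar> < real (Suc n)" using N by simp
        then have "\<bar>\<omega> $ i / Suc n\<bar> < 1 / 2" by (simp add: abs_divide divide_simps)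
        then have "(2 * pi) * \<bar>\<omega> $ i / Suc n\<bar> < (2 * pi) * (1 / 2)" by (intro mult_strict_left_mono) auto
        then have "\<bar>2 * pi * (\<omega> $ i / Suc n)\<bar> < pi" by (simp only: abs_mult) simp
        then have "2 * pi * (\<omega> $ i / Suc n) \<in> {- pi<..pi}"
          unfolding abs_less_iff greaterThanAtMost_iff by linarith
        then have "Arg (cis (2 * pi * (\<omega> $ i / Suc n))) = 2 * pi * (\<omega> $ i / Suc n)"
          by (rule Arg_cis)
        moreover have "chr (v n) \<omega> = cis (2 * pi * (\<omega> $ i / Suc n))"
          by (simp add: chr_def v_def inner_axis')
        ultimately have "Arg (chr (v n) \<omega>) = 2 * pi * (\<omega> $ i / Suc n)" by simp
        then show ?case by simp
      qed
    qed
  qed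
  then have id: "(\<lambda>\<omega>. \<omega>) \<in> borel_measurable M" by (rule borel_measurable_vecI)
  fix A :: "(real^'d) set" assume "A \<in> sets borel"
  then show "(LINT \<omega>|lebesgue. h \<omega> * indicator A \<omega>) = 0"
    using integral_vimage_zero_if_annihilated[OF _ _ id[unfolded M_def]] h zero
    by (auto simp: annihilated_def)
qed

section \<open>Periodization over the integer lattice\<close>

lemma int_lattice_zero: "0 \<in> int_lattice"
  and int_lattice_add: "k \<in> int_lattice \<Longrightarrow> l \<in> int_lattice \<Longrightarrow> k + l \<in> int_lattice"
  and int_lattice_minus: "k \<in> int_lattice \<Longrightarrow> - k \<in> int_lattice"
  and int_lattice_diff: "k \<in> int_lattice \<Longrightarrow> l \<in> int_lattice \<Longrightarrow> k - l \<in> int_lattice"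
  by (auto simp: int_lattice_def)

lemma countable_int_lattice: "countable (int_lattice :: (real^'d) set)"
proof -
  have "(int_lattice :: (real^'d) set) \<subseteq> vec_lambda ` (PiE UNIV (\<lambda>_. \<int>))"
  proof
    fix k :: "real^'d" assume "k \<in> int_lattice"
    then have "vec_nth k \<in> PiE UNIV (\<lambda>_. \<int>)" by (auto simp: int_lattice_def)
    then show "k \<in> vec_lambda ` (PiE UNIV (\<lambda>_. \<int>))" by (metis image_eqI vec_nth_inverse)
  qed
  moreover have "countable (PiE (UNIV :: 'd set) (\<lambda>_. \<int> :: real set))"
    by (intro countable_PiE) (auto simp: countable_int)
  ultimately show ?thesis by (rule countable_subset[OF _ countable_image])
qed

lemma infinite_int_lattice: "infinite (int_lattice :: (real^'d) set)"
proof
  assume fin: "finite (int_lattice :: (real^'d) set)"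
  have "range (\<lambda>n. (\<chi> i. real n) :: real^'d) \<subseteq> int_lattice" by (auto simp: int_lattice_def)
  then have "finite (range (\<lambda>n. (\<chi> i. real n) :: real^'d))" using fin finite_subset by blast
  moreover have "inj (\<lambda>n. (\<chi> i. real n) :: real^'d)" by (auto simp: inj_def vec_eq_iff)
  ultimately show False using finite_imageD by fastforce
qed

text \<open>
  An enumeration of the lattice, so that sums over it become series.
\<close>

definition lattice_point :: "nat \<Rightarrow> real^'d"
  where "lattice_point = from_nat_into int_lattice"

lemma bij_lattice_point: "bij_betw lattice_point UNIV int_lattice"
  unfolding lattice_point_def
  by (rule bij_betw_from_nat_into[OF countable_int_lattice infinite_int_lattice])

lemma lattice_point_in [simp]: "lattice_point n \<in> int_lattice"
  using bij_lattice_point by (auto simp: bij_betw_def)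

lemma lattice_pointE:
  assumes "k \<in> int_lattice"
  obtains n where "lattice_point n = k"
proof -
  have "k \<in> range lattice_point"
    unfolding bij_betw_imp_surj_on[OF bij_lattice_point] by (rule assms)
  then show ?thesis using that by auto
qed

lemma lattice_point_inj: "lattice_point m = lattice_point n \<longleftrightarrow> m = n"
  using bij_lattice_point by (auto simp: bij_betw_def inj_def)

lemma inner_int_lattice: "k \<in> int_lattice \<Longrightarrow> l \<in> int_lattice \<Longrightarrow> k \<bullet> l \<in> \<int>"
  by (auto simp: int_lattice_def inner_vec_def intro!: Ints_sum Ints_mult)

lemma chr_int_lattice [simp]:
  assumes "k \<in> int_lattice" "l \<in> int_lattice"
  shows "chr k l = 1"
proof -
  obtain n where "k \<bullet> l = of_int n" using inner_int_lattice[OF assms] Ints_cases by blast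
  then show ?thesis using cis_multiple_2pi[of "of_int n"] by (simp add: chr_def)
qed

lemma chr_periodic: "k \<in> int_lattice \<Longrightarrow> l \<in> int_lattice \<Longrightarrow> chr k (\<omega> + l) = chr k \<omega>"
  by (simp add: chr_add_right)

text \<open>
  The cell contains its upper faces and not its lower ones, in agreement with the range
  \<open>- pi < Arg z \<le> pi\<close> of the argument: with this choice the reduction of a point modulo the lattice
  is a function of the characters with integer frequency at every point.
\<close>

definition unit_cell :: "(real^'d) set"
  where "unit_cell = {\<omega>. \<forall>i. - (1/2) < \<omega> $ i \<and> \<omega> $ i \<le> 1/2}"

definition round_vec :: "real^'d \<Rightarrow> real^'d"
  where "round_vec \<omega> = (\<chi> i. of_int \<lceil>\<omega> $ i - 1/2\<rceil>)"

lemma round_vec_in_lattice [simp]: "round_vec \<omega> \<in> int_lattice"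
  by (simp add: round_vec_def int_lattice_def)

lemma diff_round_in_cell: "\<omega> - round_vec \<omega> \<in> unit_cell"
proof -
  have "- (1/2) < t - of_int \<lceil>t - 1/2\<rceil> \<and> t - of_int \<lceil>t - 1/2\<rceil> \<le> 1/2" for t :: real
    by linarith
  then show ?thesis by (simp add: unit_cell_def round_vec_def)
qed

lemma diff_in_cell_iff:
  assumes "k \<in> int_lattice"
  shows "\<omega> - k \<in> unit_cell \<longleftrightarrow> k = round_vec \<omega>"
proof
  assume c: "\<omega> - k \<in> unit_cell"
  have "k $ i = of_int \<lceil>\<omega> $ i - 1/2\<rceil>" for i
  proof -
    obtain n where n: "k $ i = of_int n" using assms by (auto simp: int_lattice_def elim: Ints_cases)
    have "- (1/2) < \<omega> $ i - of_int n" "\<omega> $ i - of_int n \<le> 1/2"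
      using c unfolding unit_cell_def n[symmetric] by simp_all
    then have "\<lceil>\<omega> $ i - 1/2\<rceil> = n" by (intro ceiling_unique) auto
    then show ?thesis using n by simp
  qed
  then show "k = round_vec \<omega>" by (simp add: round_vec_def vec_eq_iff)
qed (use diff_round_in_cell in simp)

lemma round_vec_cell: "\<omega> \<in> unit_cell \<Longrightarrow> round_vec \<omega> = 0"
  using diff_in_cell_iff[OF int_lattice_zero, of \<omega>] by simp

lemma round_vec_add: "k \<in> int_lattice \<Longrightarrow> round_vec (\<omega> + k) = round_vec \<omega> + k"
  using diff_in_cell_iff[of "round_vec \<omega> + k" "\<omega> + k"] diff_round_in_cell[of \<omega>]
  by (simp add: int_lattice_add)

lemma unit_cell_borel [measurable]: "unit_cell \<in> sets borel"
proof -
  have "unit_cell = (\<Inter>i. {\<omega> :: real^'d. - (1/2) < \<omega> $ i} \<inter> {\<omega>. \<omega> $ i \<le> 1/2})"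
    by (auto simp: unit_cell_def)
  also have "\<dots> \<in> sets borel"
    by (intro sets.finite_INT sets.Int borel_open borel_closed open_Collect_less closed_Collect_le
        continuous_intros) auto
  finally show ?thesis .
qed

lemma unit_cell_lebesgue [measurable]: "unit_cell \<in> sets lebesgue"
  using unit_cell_borel by simp

lemma unit_cell_bounded: "unit_cell \<subseteq> cbox (- (\<chi> i. 1/2)) (\<chi> i. 1/2)"
  by (auto simp: unit_cell_def mem_box_cart less_imp_le)

lemma emeasure_unit_cell_finite: "emeasure lebesgue (unit_cell :: (real^'d) set) < \<infinity>"
proof -
  have "emeasure lebesgue (unit_cell :: (real^'d) set) \<le> emeasure lebesgue (cbox (- (\<chi> i. 1/2)) (\<chi> i. 1/2) :: (real^'d) set)"
    by (intro emeasure_mono unit_cell_bounded) auto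
  also have "\<dots> < \<infinity>" using emeasure_lborel_cbox_finite by simp
  finally show ?thesis .
qed

lemma suminf_indicator_cell_translates:
  fixes f :: "nat \<Rightarrow> 'a::{t2_space, topological_comm_monoid_add, semiring_1}"
  assumes "lattice_point n = round_vec \<omega>"
  shows "(\<Sum>m. f m * indicator unit_cell (\<omega> - lattice_point m)) = f n"
proof -
  have "(\<Sum>m. f m * indicator unit_cell (\<omega> - lattice_point m)) =
      (\<Sum>m\<in>{n}. f m * indicator unit_cell (\<omega> - lattice_point m))"
  proof (rule suminf_finite)
    fix m assume "m \<notin> {n}"
    then have "lattice_point m \<noteq> round_vec \<omega>" using assms lattice_point_inj by (metis singletonI)
    then show "f m * indicator unit_cell (\<omega> - lattice_point m) = 0"
      using diff_in_cell_iff[of "lattice_point m" \<omega>] by simp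
  qed simp
  then show ?thesis using assms diff_round_in_cell[of \<omega>] by simp
qed

text \<open>
  The translates of the unit cell by lattice points partition the space. The integral over each of
  them is moved back to the unit cell.
\<close>

lemma nn_integral_periodize:
  fixes f :: "real^'d \<Rightarrow> ennreal"
  assumes f: "f \<in> borel_measurable lebesgue"
  shows "(\<integral>\<^sup>+\<omega>. f \<omega> \<partial>lebesgue) = (\<integral>\<^sup>+\<omega>. (\<Sum>n. f (\<omega> + lattice_point n)) * indicator unit_cell \<omega> \<partial>lebesgue)"
proof -
  note [measurable] = f measurable_translation[OF f]
  have c[measurable]: "(\<lambda>\<omega>. indicator unit_cell (\<omega> + t) :: ennreal) \<in> borel_measurable lebesgue" for t :: "real^'d"
    by (rule measurable_translation) simp
  have c'[measurable]: "(\<lambda>\<omega>. indicator unit_cell (\<omega> - t) :: ennreal) \<in> borel_measurable lebesgue" for t :: "real^'d"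
    using c[of "- t"] by simp
  have "(\<Sum>n. f \<omega> * indicator unit_cell (\<omega> - lattice_point n)) = f \<omega>" for \<omega>
  proof -
    obtain n where "lattice_point n = round_vec \<omega>" using lattice_pointE[OF round_vec_in_lattice] .
    then show ?thesis using suminf_indicator_cell_translates[of n \<omega> "\<lambda>_. f \<omega>"] by simp
  qed
  then have "(\<integral>\<^sup>+\<omega>. f \<omega> \<partial>lebesgue) = (\<integral>\<^sup>+\<omega>. (\<Sum>n. f \<omega> * indicator unit_cell (\<omega> - lattice_point n)) \<partial>lebesgue)"
    by simp
  also have "\<dots> = (\<Sum>n. \<integral>\<^sup>+\<omega>. f \<omega> * indicator unit_cell (\<omega> - lattice_point n) \<partial>lebesgue)"
    by (intro nn_integral_suminf) auto
  also have "\<dots> = (\<Sum>n. \<integral>\<^sup>+\<omega>. f (\<omega> + lattice_point n) * indicator unit_cell \<omega> \<partial>lebesgue)"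
  proof (rule suminf_cong)
    fix n
    show "(\<integral>\<^sup>+\<omega>. f \<omega> * indicator unit_cell (\<omega> - lattice_point n) \<partial>lebesgue) =
        (\<integral>\<^sup>+\<omega>. f (\<omega> + lattice_point n) * indicator unit_cell \<omega> \<partial>lebesgue)"
      by (subst nn_integral_translation[symmetric, of _ "lattice_point n"]) auto
  qed
  also have "\<dots> = (\<integral>\<^sup>+\<omega>. (\<Sum>n. f (\<omega> + lattice_point n) * indicator unit_cell \<omega>) \<partial>lebesgue)"
    by (intro nn_integral_suminf[symmetric]) auto
  also have "\<dots> = (\<integral>\<^sup>+\<omega>. (\<Sum>n. f (\<omega> + lattice_point n)) * indicator unit_cell \<omega> \<partial>lebesgue)"
    by simp
  finally show ?thesis .
qed

text \<open>
  A property of orbits need only be checked on the unit cell, for all the points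
  \<open>\<omega> + lattice_point n\<close> of the orbit of \<open>\<omega>\<close>. In this form no invariance of \<open>P\<close> has to be shown.
\<close>

lemma AE_unit_cell_extend:
  assumes "\<And>n. AE \<omega> in lebesgue. \<omega> \<in> unit_cell \<longrightarrow> P (\<omega> + lattice_point n)"
  shows "AE \<omega> in lebesgue. P \<omega>"
proof -
  have "AE \<omega> in lebesgue. \<forall>n. \<omega> - lattice_point n \<in> unit_cell \<longrightarrow> P \<omega>"
    unfolding AE_all_countable
  proof
    fix n
    show "AE \<omega> in lebesgue. \<omega> - lattice_point n \<in> unit_cell \<longrightarrow> P \<omega>"
      using AE_translation[OF assms[of n], of "- lattice_point n"] by simp
  qed
  then show ?thesis
  proof eventually_elim
    case (elim \<omega>)
    obtain n where "lattice_point n = round_vec \<omega>" using lattice_pointE[OF round_vec_in_lattice] .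
    then show ?case using elim diff_round_in_cell[of \<omega>] by metis
  qed
qed

definition periodize :: "(real^'d \<Rightarrow> complex) \<Rightarrow> real^'d \<Rightarrow> complex"
  where "periodize h \<omega> = (\<Sum>n. h (\<omega> + lattice_point n))"

lemma AE_summable_periodize:
  fixes h :: "real^'d \<Rightarrow> complex"
  assumes h: "integrable lebesgue h"
  shows "AE \<omega> in lebesgue. summable (\<lambda>n. norm (h (\<omega> + lattice_point n)))"
proof (rule AE_unit_cell_extend)
  fix m
  define h' where "h' \<omega> = h (\<omega> + lattice_point m)" for \<omega>
  have h': "integrable lebesgue h'" unfolding h'_def by (rule integrable_translation[OF h])
  note [measurable] = measurable_translation[OF borel_measurable_integrable[OF h']]
  have "(\<integral>\<^sup>+\<omega>. (\<Sum>n. ennreal (norm (h' (\<omega> + lattice_point n)))) * indicator unit_cell \<omega> \<partial>lebesgue)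
      = (\<integral>\<^sup>+\<omega>. ennreal (norm (h' \<omega>)) \<partial>lebesgue)"
    using h' by (intro nn_integral_periodize[symmetric]) auto
  also have "\<dots> < \<infinity>" using h' by (simp add: integrable_iff_bounded)
  finally have fin: "(\<integral>\<^sup>+\<omega>. (\<Sum>n. ennreal (norm (h' (\<omega> + lattice_point n)))) * indicator unit_cell \<omega> \<partial>lebesgue) \<noteq> \<infinity>"
    by simp
  have "AE \<omega> in lebesgue. (\<Sum>n. ennreal (norm (h' (\<omega> + lattice_point n)))) * indicator unit_cell \<omega> \<noteq> \<infinity>"
    by (rule nn_integral_noteq_infinite[OF _ fin]) measurable
  then show "AE \<omega> in lebesgue. \<omega> \<in> unit_cell \<longrightarrow>
      summable (\<lambda>n. norm (h (\<omega> + lattice_point m + lattice_point n)))"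
  proof eventually_elim
    case (elim \<omega>)
    show ?case
    proof
      assume "\<omega> \<in> unit_cell"
      then have "(\<Sum>n. ennreal (norm (h' (\<omega> + lattice_point n)))) \<noteq> \<infinity>" using elim by simp
      then have "summable (\<lambda>n. norm (h' (\<omega> + lattice_point n)))"
        by (intro summable_suminf_not_top) (auto simp: infinity_ennreal_def)
      then show "summable (\<lambda>n. norm (h (\<omega> + lattice_point m + lattice_point n)))"
        by (simp add: h'_def ac_simps)
    qed
  qed
qed

lemma
  fixes h :: "real^'d \<Rightarrow> complex"
  assumes h: "integrable lebesgue h"
  shows integrable_periodize: "integrable lebesgue (\<lambda>\<omega>. indicator unit_cell \<omega> * periodize h \<omega>)"
    and integral_periodize: "(LINT \<omega>|lebesgue. h \<omega>) = (LINT \<omega>|lebesgue. indicator unit_cell \<omega> * periodize h \<omega>)"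
proof -
  have hm[measurable]: "h \<in> borel_measurable lebesgue" using h by simp
  note [measurable] = measurable_translation[OF hm]
  define F where "F n \<omega> = indicator unit_cell \<omega> * h (\<omega> + lattice_point n)" for n \<omega>
  define G where "G n \<omega> = h \<omega> * indicator unit_cell (\<omega> - lattice_point n)" for n \<omega>
  have FG: "F n \<omega> = G n (\<omega> + lattice_point n)" for n \<omega> by (simp add: F_def G_def)
  have c: "(\<lambda>\<omega>. indicator unit_cell (\<omega> - t) :: complex) \<in> borel_measurable lebesgue" for t :: "real^'d"
    using measurable_translation[of "indicator unit_cell" "- t"] by simp
  have iG: "integrable lebesgue (G n)" for n
    unfolding G_def by (rule integrable_mult_bounded[OF h c, where C = 1]) (auto simp: indicator_def)
  have iF: "integrable lebesgue (F n)" for n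
    unfolding FG by (rule integrable_translation[OF iG])
  have eq: "(LINT \<omega>|lebesgue. F n \<omega>) = (LINT \<omega>|lebesgue. G n \<omega>)" for n
    unfolding FG using iG by (intro integral_translation) auto
  have eqn: "(LINT \<omega>|lebesgue. norm (F n \<omega>)) = (LINT \<omega>|lebesgue. norm (G n \<omega>))" for n
    unfolding FG using iG integral_translation[of "\<lambda>\<omega>. norm (G n \<omega>)"] by simp
  have sG: "(\<Sum>n. G n \<omega>) = h \<omega>" "(\<Sum>n. ennreal (norm (G n \<omega>))) = ennreal (norm (h \<omega>))"
      "summable (\<lambda>n. norm (G n \<omega>))" for \<omega>
  proof -
    obtain n where n: "lattice_point n = round_vec \<omega>" using lattice_pointE[OF round_vec_in_lattice] .
    show "(\<Sum>n. G n \<omega>) = h \<omega>"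
      using suminf_indicator_cell_translates[OF n, of "\<lambda>_. h \<omega>"] by (simp add: G_def)
    have "ennreal (norm (G m \<omega>)) = ennreal (norm (h \<omega>)) * indicator unit_cell (\<omega> - lattice_point m)" for m
      by (auto simp: G_def indicator_def)
    then show *: "(\<Sum>n. ennreal (norm (G n \<omega>))) = ennreal (norm (h \<omega>))"
      using suminf_indicator_cell_translates[OF n, of "\<lambda>_. ennreal (norm (h \<omega>))"] by simp
    show "summable (\<lambda>n. norm (G n \<omega>))"
      by (rule summable_suminf_not_top) (auto simp: *)
  qed
  have sums: "summable (\<lambda>n. LINT \<omega>|lebesgue. norm (G n \<omega>))"
  proof (rule summable_suminf_not_top)
    have "(\<Sum>n. ennreal (LINT \<omega>|lebesgue. norm (G n \<omega>))) = (\<Sum>n. \<integral>\<^sup>+\<omega>. ennreal (norm (G n \<omega>)) \<partial>lebesgue)"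
      by (intro suminf_cong nn_integral_eq_integral[symmetric]) (auto simp: iG)
    also have "\<dots> = (\<integral>\<^sup>+\<omega>. (\<Sum>n. ennreal (norm (G n \<omega>))) \<partial>lebesgue)"
      using iG by (intro nn_integral_suminf[symmetric]) auto
    also have "\<dots> < \<infinity>" using h by (simp add: sG integrable_iff_bounded)
    finally show "(\<Sum>n. ennreal (LINT \<omega>|lebesgue. norm (G n \<omega>))) \<noteq> top" by simp
  qed simp
  have sF: "AE \<omega> in lebesgue. summable (\<lambda>n. norm (F n \<omega>))"
    using AE_summable_periodize[OF h]
    by eventually_elim (auto simp: F_def indicator_def)
  have per: "indicator unit_cell \<omega> * periodize h \<omega> = (\<Sum>n. F n \<omega>)" for \<omega>
    by (simp add: F_def periodize_def indicator_def)
  show "integrable lebesgue (\<lambda>\<omega>. indicator unit_cell \<omega> * periodize h \<omega>)"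
    unfolding per by (rule integrable_suminf[OF iF sF]) (simp add: eqn sums)
  have "(LINT \<omega>|lebesgue. h \<omega>) = (LINT \<omega>|lebesgue. (\<Sum>n. G n \<omega>))" by (simp add: sG)
  also have "\<dots> = (\<Sum>n. LINT \<omega>|lebesgue. G n \<omega>)"
    by (rule integral_suminf[OF iG _ sums]) (simp add: sG)
  also have "\<dots> = (\<Sum>n. LINT \<omega>|lebesgue. F n \<omega>)" by (simp add: eq)
  also have "\<dots> = (LINT \<omega>|lebesgue. (\<Sum>n. F n \<omega>))"
    by (rule integral_suminf[symmetric, OF iF sF]) (simp add: eqn sums)
  finally show "(LINT \<omega>|lebesgue. h \<omega>) = (LINT \<omega>|lebesgue. indicator unit_cell \<omega> * periodize h \<omega>)"
    by (simp add: per)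
qed

definition lattice_periodic :: "(real^'d \<Rightarrow> 'a) \<Rightarrow> bool"
  where "lattice_periodic p \<longleftrightarrow> (\<forall>\<omega>. \<forall>k\<in>int_lattice. p (\<omega> + k) = p \<omega>)"

lemma lattice_periodic_chr: "k \<in> int_lattice \<Longrightarrow> lattice_periodic (chr k)"
  by (simp add: lattice_periodic_def chr_periodic)

lemma periodize_mult_periodic:
  assumes "lattice_periodic p" "summable (\<lambda>n. norm (h (\<omega> + lattice_point n)))"
  shows "periodize (\<lambda>\<omega>. h \<omega> * p \<omega>) \<omega> = periodize h \<omega> * p \<omega>"
proof -
  have "periodize (\<lambda>\<omega>. h \<omega> * p \<omega>) \<omega> = (\<Sum>n. h (\<omega> + lattice_point n) * p \<omega>)"
    using assms(1) by (simp add: periodize_def lattice_periodic_def)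
  also have "\<dots> = periodize h \<omega> * p \<omega>"
    unfolding periodize_def by (rule suminf_mult2[symmetric, OF summable_norm_cancel[OF assms(2)]])
  finally show ?thesis .
qed

lemma integral_mult_periodic:
  assumes h: "integrable lebesgue h" and p: "lattice_periodic p"
    "p \<in> borel_measurable lebesgue" "\<And>\<omega>. cmod (p \<omega>) \<le> C"
  shows "(LINT \<omega>|lebesgue. h \<omega> * p \<omega>) = (LINT \<omega>|lebesgue. indicator unit_cell \<omega> * periodize h \<omega> * p \<omega>)"
proof -
  have hp: "integrable lebesgue (\<lambda>\<omega>. h \<omega> * p \<omega>)" by (rule integrable_mult_bounded[OF h p(2,3)])
  have "(LINT \<omega>|lebesgue. h \<omega> * p \<omega>) = (LINT \<omega>|lebesgue. indicator unit_cell \<omega> * periodize (\<lambda>\<omega>. h \<omega> * p \<omega>) \<omega>)"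
    by (rule integral_periodize[OF hp])
  also have "\<dots> = (LINT \<omega>|lebesgue. indicator unit_cell \<omega> * periodize h \<omega> * p \<omega>)"
  proof (rule integral_cong_AE)
    show "(\<lambda>\<omega>. indicator unit_cell \<omega> * periodize (\<lambda>\<omega>. h \<omega> * p \<omega>) \<omega>) \<in> borel_measurable lebesgue"
      using integrable_periodize[OF hp] by simp
    show "(\<lambda>\<omega>. indicator unit_cell \<omega> * periodize h \<omega> * p \<omega>) \<in> borel_measurable lebesgue"
      by (intro borel_measurable_times borel_measurable_integrable[OF integrable_periodize[OF h]] p(2))
    show "AE \<omega> in lebesgue. indicator unit_cell \<omega> * periodize (\<lambda>\<omega>. h \<omega> * p \<omega>) \<omega> = indicator unit_cell \<omega> * periodize h \<omega> * p \<omega>"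
      using AE_summable_periodize[OF h] by eventually_elim (simp add: periodize_mult_periodic[OF p(1)])
  qed
  finally show ?thesis .
qed

text \<open>
  Against a periodic function, an integrable function acts through its periodization only. If
  that is a constant \<open>c\<close>, the function may be replaced by \<open>c\<close> times the indicator of the cell.
\<close>

lemma integral_mult_periodic_const:
  assumes h: "integrable lebesgue h" and c: "AE \<omega> in lebesgue. periodize h \<omega> = c"
    and p: "lattice_periodic p" "p \<in> borel_measurable lebesgue" "\<And>\<omega>. cmod (p \<omega>) \<le> C"
  shows "(LINT \<omega>|lebesgue. h \<omega> * p \<omega>) = c * (LINT \<omega>|lebesgue. indicator unit_cell \<omega> * p \<omega>)"
proof -
  have "(LINT \<omega>|lebesgue. h \<omega> * p \<omega>) = (LINT \<omega>|lebesgue. c * (indicator unit_cell \<omega> * p \<omega>))"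
    unfolding integral_mult_periodic[OF h p]
  proof (rule integral_cong_AE)
    show "AE \<omega> in lebesgue. indicator unit_cell \<omega> * periodize h \<omega> * p \<omega> = c * (indicator unit_cell \<omega> * p \<omega>)"
      using c by eventually_elim simp
  qed (use p in \<open>auto intro!: borel_measurable_times borel_measurable_integrable[OF integrable_periodize[OF h]]\<close>)
  then show ?thesis by simp
qed

lemma periodize_unit_cell: "periodize (indicator unit_cell) \<omega> = 1"
proof -
  obtain n where n: "lattice_point n = - round_vec \<omega>" 
    using lattice_pointE[OF int_lattice_minus[OF round_vec_in_lattice]] .
  have "periodize (indicator unit_cell) \<omega> = (\<Sum>m\<in>{n}. indicator unit_cell (\<omega> + lattice_point m))"
    unfolding periodize_def
  proof (rule suminf_finite)
    fix m assume "m \<notin> {n}"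
    then have "lattice_point m \<noteq> - round_vec \<omega>" using n lattice_point_inj by (metis singletonI)
    then have "- lattice_point m \<noteq> round_vec \<omega>" by (metis minus_minus)
    then show "indicator unit_cell (\<omega> + lattice_point m) = (0::complex)"
      using diff_in_cell_iff[OF int_lattice_minus[OF lattice_point_in], of \<omega> m] by simp
  qed simp
  then show ?thesis using n diff_round_in_cell[of \<omega>] by simp
qed

lemma integrable_indicator_unit_cell: "integrable lebesgue (indicator unit_cell :: real^'d \<Rightarrow> complex)"
proof -
  have "integrable lebesgue (indicator unit_cell :: real^'d \<Rightarrow> real)"
    using emeasure_unit_cell_finite by (intro integrable_real_indicator) auto
  then have "integrable lebesgue (\<lambda>\<omega>. complex_of_real (indicator (unit_cell :: (real^'d) set) \<omega>))"
    by (rule integrable_of_real)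
  moreover have "(\<lambda>\<omega>. complex_of_real (indicator (unit_cell :: (real^'d) set) \<omega>)) = indicator unit_cell"
    by (auto simp: indicator_def)
  ultimately show ?thesis by simp
qed

lemma periodize_translate: "periodize (\<lambda>\<omega>. h (\<omega> + t)) \<omega> = periodize h (\<omega> + t)"
  by (simp add: periodize_def ac_simps)

lemma nontrivial_chr:
  assumes "k \<noteq> 0" obtains t where "chr k t \<noteq> 1"
proof
  have "chr k ((1 / (2 * (k \<bullet> k))) *\<^sub>R k) = cis pi" using assms by (simp add: chr_def)
  then show "chr k ((1 / (2 * (k \<bullet> k))) *\<^sub>R k) \<noteq> 1" by simp
qed

text \<open>
  The cell and its translate by \<open>t\<close> have the same periodization, so they give the same integral of
  \<open>chr k\<close>. Translating the integrand instead shows that the two integrals differ by the factor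
  \<open>cnj (chr k t)\<close>, and \<open>t\<close> can be chosen to make it different from 1.
\<close>

lemma integral_unit_cell_chr_zero:
  assumes k: "k \<in> int_lattice" "k \<noteq> 0"
  shows "(LINT \<omega>|lebesgue. indicator unit_cell \<omega> * chr k \<omega>) = 0"
proof -
  obtain t where t: "chr k t \<noteq> 1" using nontrivial_chr[OF k(2)] .
  let ?I = "LINT \<omega>|lebesgue. indicator unit_cell \<omega> * chr k \<omega>"
  have "(LINT \<omega>|lebesgue. indicator unit_cell (\<omega> + t) * chr k \<omega>) = 1 * ?I"
    by (rule integral_mult_periodic_const[where C = 1])
      (auto simp: periodize_translate periodize_unit_cell lattice_periodic_chr k
         intro!: integrable_translation integrable_indicator_unit_cell)
  moreover have "(LINT \<omega>|lebesgue. indicator unit_cell \<omega> * chr k (\<omega> - t)) =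
      (LINT \<omega>|lebesgue. indicator unit_cell (\<omega> + t) * chr k \<omega>)"
    using integral_translation[of "\<lambda>\<omega>. indicator unit_cell \<omega> * chr k (\<omega> - t)" t]
    by (simp add: chr_diff_right)
  moreover have "(LINT \<omega>|lebesgue. indicator unit_cell \<omega> * chr k (\<omega> - t)) = cnj (chr k t) * ?I"
  proof -
    have "(\<lambda>\<omega>. indicator unit_cell \<omega> * chr k (\<omega> - t)) = (\<lambda>\<omega>. cnj (chr k t) * (indicator unit_cell \<omega> * chr k \<omega>))"
      by (auto simp: chr_diff_right)
    then show ?thesis by (simp only: integral_mult_right_zero)
  qed
  ultimately have "?I = cnj (chr k t) * ?I" by simp
  then have "?I = 0 \<or> cnj (chr k t) = 1" by (metis mult_cancel_right1)
  then show ?thesis using t by (metis complex_cnj_cnj complex_cnj_one)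
qed

lemma measure_unit_cell: "measure lebesgue (unit_cell :: (real^'d) set) = 1"
proof -
  define B where "B = (cbox (- (\<chi> i. 1/2)) (\<chi> i. 1/2) :: (real^'d) set)"
  have "0 \<in> B" by (simp add: B_def mem_box_cart)
  then have "cbox (- (\<chi> i. 1/2)) (\<chi> i. 1/2) \<noteq> ({} :: (real^'d) set)" by (auto simp: B_def)
  from content_cbox_cart[OF this] have "measure lebesgue B = 1" by (simp add: B_def)
  moreover have "AE \<omega> in lebesgue. \<omega> \<in> unit_cell \<longleftrightarrow> \<omega> \<in> B"
  proof -
    have "negligible (cbox (- (\<chi> i. 1/2)) (\<chi> i. 1/2) - box (- (\<chi> i. 1/2)) (\<chi> i. 1/2) :: (real^'d) set)"
      by (rule negligible_frontier_interval)
    then have "AE \<omega> in lebesgue. \<omega> \<notin> B - box (- (\<chi> i. 1/2)) (\<chi> i. 1/2)"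
      unfolding B_def by (intro AE_not_in) (simp add: negligible_iff_null_sets)
    then show ?thesis
      by eventually_elim (auto simp: B_def unit_cell_def mem_box_cart less_imp_le)
  qed
  then have "measure lebesgue (unit_cell :: (real^'d) set) = measure lebesgue B"
    by (intro measure_eq_AE) (auto simp: B_def)
  ultimately show ?thesis by simp
qed

lemma integral_unit_cell_one: "(LINT \<omega>|lebesgue. indicator (unit_cell :: (real^'d) set) \<omega>) = (1::complex)"
proof -
  have "(LINT \<omega>|lebesgue. indicator (unit_cell :: (real^'d) set) \<omega>)
      = (LINT \<omega>|lebesgue. complex_of_real (indicator (unit_cell :: (real^'d) set) \<omega>))"
    by (intro Bochner_Integration.integral_cong) (auto simp: indicator_def)
  also have "\<dots> = complex_of_real (measure lebesgue (unit_cell :: (real^'d) set))"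
    unfolding integral_of_real by simp
  finally show ?thesis by (simp only: measure_unit_cell of_real_1)
qed

lemma integral_unit_cell_chr:
  assumes "k \<in> int_lattice"
  shows "(LINT \<omega>|lebesgue. indicator unit_cell \<omega> * chr k \<omega>) = (if k = 0 then 1 else 0)"
proof (cases "k = 0")
  case True
  then show ?thesis using integral_unit_cell_one[where 'd = 'a] by simp
qed (simp add: integral_unit_cell_chr_zero assms)

lemma measurable_fractional_part:
  "(\<lambda>\<omega> :: real^'d. \<omega> - round_vec \<omega>) \<in> borel_measurable (sigma UNIV (multiplier_sets int_lattice))"
proof (rule borel_measurable_vecI)
  fix i :: 'd
  define v :: "real^'d" where "v = axis i 1"
  have v: "v \<in> int_lattice" by (auto simp: v_def int_lattice_def axis_def)
  have "(\<omega> - round_vec \<omega>) $ i = Arg (chr v \<omega>) / (2 * pi)" for \<omega>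
  proof -
    let ?x = "(\<omega> - round_vec \<omega>) $ i"
    have "- (1/2) < ?x" "?x \<le> 1/2" using diff_round_in_cell[of \<omega>] by (auto simp: unit_cell_def)
    then have "2 * pi * - (1/2) < 2 * pi * ?x" "2 * pi * ?x \<le> 2 * pi * (1/2)"
      by (intro mult_strict_left_mono mult_left_mono; simp)+
    then have "2 * pi * ?x \<in> {- pi<..pi}" by simp
    then have "Arg (cis (2 * pi * ?x)) = 2 * pi * ?x" by (rule Arg_cis)
    moreover have "chr v \<omega> = cis (2 * pi * ?x)"
    proof -
      have "chr v \<omega> = chr v (\<omega> - round_vec \<omega>)" using v by (simp add: chr_diff_right)
      then show ?thesis by (simp add: chr_def v_def inner_axis')
    qed
    ultimately show ?thesis by simp
  qed
  then show "(\<lambda>\<omega>. (\<omega> - round_vec \<omega>) $ i) \<in> borel_measurable (sigma UNIV (multiplier_sets int_lattice))"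
    using v
    by (auto intro!: borel_measurable_divide measurable_compose[OF chr_measurable_multiplier borel_measurable_Arg]
        simp: int_lattice_add int_lattice_minus)
qed

text \<open>
  All Borel functions of the fractional part \<open>\<omega> - round_vec \<omega>\<close> are multipliers, because each of its
  coordinates is an argument of a character with integer frequency. So the periodization of \<open>h\<close> has
  zero integral over every Borel subset of the cell. The same applies to the lattice translates of
  \<open>h\<close>, which transports the result to the other cells.
\<close>

theorem periodize_zero_if_annihilated:
  assumes h: "annihilated int_lattice h"
  shows "AE \<omega> in lebesgue. periodize h \<omega> = 0"
proof -
  have cell: "AE \<omega> in lebesgue. \<omega> \<in> unit_cell \<longrightarrow> periodize h \<omega> = 0" if h: "annihilated int_lattice h" for h :: "real^'d \<Rightarrow> complex"
  proof -
    have hi: "integrable lebesgue h" using h by (simp add: annihilated_def)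
    have "AE \<omega> in lebesgue. indicator unit_cell \<omega> * periodize h \<omega> = 0"
    proof (rule AE_zero_if_borel_integrals_zero[OF integrable_periodize[OF hi]])
      fix A :: "(real^'d) set" assume A: "A \<in> sets borel"
      define p where "p \<omega> = (indicator A (\<omega> - round_vec \<omega>) :: complex)" for \<omega>
      have per: "lattice_periodic p" by (simp add: lattice_periodic_def p_def round_vec_add)
      have "p \<in> borel_measurable borel"
      proof -
        have "round_vec \<in> borel_measurable (borel :: (real^'d) measure)"
          by (rule borel_measurable_vecI) (simp add: round_vec_def)
        then show ?thesis unfolding p_def using A by measurable
      qed
      then have pm: "p \<in> borel_measurable lebesgue" by (rule borel_imp_lebesgue_measurable)
      have "0 = (LINT \<omega>|lebesgue. h \<omega> * p \<omega>)"
        unfolding p_def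
        by (rule integral_vimage_zero_if_annihilated[symmetric, OF h int_lattice_zero measurable_fractional_part A])
      also have "\<dots> = (LINT \<omega>|lebesgue. indicator unit_cell \<omega> * periodize h \<omega> * p \<omega>)"
        by (rule integral_mult_periodic[OF hi per pm, where C = 1]) (auto simp: p_def indicator_def)
      also have "\<dots> = (LINT \<omega>|lebesgue. indicator unit_cell \<omega> * periodize h \<omega> * indicator A \<omega>)"
        by (intro Bochner_Integration.integral_cong) (auto simp: p_def indicator_def round_vec_cell)
      finally show "(LINT \<omega>|lebesgue. indicator unit_cell \<omega> * periodize h \<omega> * indicator A \<omega>) = 0" by simp
    qed
    then show ?thesis by eventually_elim (auto simp: indicator_def)
  qed
  show ?thesis
  proof (rule AE_unit_cell_extend)
    fix n
    define h' where "h' \<omega> = h (\<omega> + lattice_point n)" for \<omega>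
    have hi: "integrable lebesgue h" using h by (simp add: annihilated_def)
    have "(LINT \<omega>|lebesgue. h' \<omega> * chr v \<omega>) = 0" if v: "v \<in> int_lattice" for v
    proof -
      have "(LINT \<omega>|lebesgue. h' \<omega> * chr v \<omega>) = (LINT \<omega>|lebesgue. h (\<omega> + lattice_point n) * chr v (\<omega> + lattice_point n))"
        unfolding h'_def using v by (simp add: chr_periodic)
      also have "\<dots> = (LINT \<omega>|lebesgue. h \<omega> * chr v \<omega>)"
        using hi by (intro integral_translation borel_measurable_times) auto
      finally show ?thesis using h v by (simp add: annihilated_def)
    qed
    then have "annihilated int_lattice h'"
      unfolding annihilated_def h'_def using integrable_translation[OF hi] by blast
    from cell[OF this] show "AE \<omega> in lebesgue. \<omega> \<in> unit_cell \<longrightarrow> periodize h (\<omega> + lattice_point n) = 0"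
      by eventually_elim (simp add: h'_def[abs_def] periodize_translate)
  qed
qed

text \<open>
  The function \<open>c\<close> times the indicator of the unit cell has the prescribed coefficients and
  periodization \<open>c\<close>.
\<close>

corollary periodize_const_if_fourier_coefficients:
  assumes h: "integrable lebesgue h"
    and c: "\<And>k. k \<in> int_lattice \<Longrightarrow> (LINT \<omega>|lebesgue. h \<omega> * chr k \<omega>) = (if k = 0 then c else 0)"
  shows "AE \<omega> in lebesgue. periodize h \<omega> = c"
proof -
  let ?g = "\<lambda>\<omega>. h \<omega> - c * indicator unit_cell \<omega>"
  have i: "integrable lebesgue (\<lambda>\<omega>. c * indicator unit_cell \<omega>)"
    using integrable_indicator_unit_cell by (rule integrable_mult_right)
  have "(LINT \<omega>|lebesgue. ?g \<omega> * chr k \<omega>) = 0" if k: "k \<in> int_lattice" for k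
  proof -
    have "(LINT \<omega>|lebesgue. ?g \<omega> * chr k \<omega>) =
        (LINT \<omega>|lebesgue. h \<omega> * chr k \<omega>) - (LINT \<omega>|lebesgue. c * indicator unit_cell \<omega> * chr k \<omega>)"
      unfolding left_diff_distrib
      by (intro Bochner_Integration.integral_diff integrable_mult_chr h i)
    also have "(LINT \<omega>|lebesgue. c * indicator unit_cell \<omega> * chr k \<omega>) = c * (if k = 0 then 1 else 0)"
      using integral_unit_cell_chr[OF k] by (simp only: mult.assoc integral_mult_right_zero)
    finally show ?thesis using c[OF k] by simp
  qed
  then have "annihilated int_lattice ?g"
    unfolding annihilated_def using Bochner_Integration.integrable_diff[OF h i] by blast
  from periodize_zero_if_annihilated[OF this] AE_summable_periodize[OF h] AE_summable_periodize[OF integrable_indicator_unit_cell]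
  show ?thesis
  proof eventually_elim
    case (elim \<omega>)
    have s: "summable (\<lambda>n. h (\<omega> + lattice_point n))" "summable (\<lambda>n. indicator unit_cell (\<omega> + lattice_point n) :: complex)"
      using elim(2,3) by (auto intro: summable_norm_cancel)
    have "periodize ?g \<omega> = periodize h \<omega> - c * periodize (indicator unit_cell) \<omega>"
      unfolding periodize_def
      by (subst suminf_mult[symmetric, OF s(2)], subst suminf_diff[OF s(1) summable_mult[OF s(2)]]) simp
    then show ?case using elim(1) by (simp add: periodize_unit_cell)
  qed
qed

section \<open>Orthonormal families and tiles\<close>

lemma closed_L2_subspace_AE:
  assumes "closed_L2_subspace V" "p \<in> V" "f \<in> L2_space" "AE x in lebesgue. f x = p x"
  shows "f \<in> V"
proof -
  have p: "p \<in> L2_space" using closed_L2_subspaceD(1)[OF assms(1,2)] .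
  have "AE x in lebesgue. p x - f x = 0" using assms(4) by eventually_elim simp
  then have "L2_norm (\<lambda>x. p x - f x) = 0" using L2_norm_zero_iff[OF L2_diff[OF p assms(3)]] by simp
  then have "f \<in> L2_closure V" by (intro L2_closureI_seq[where g = "\<lambda>_. p"] assms) auto
  then show ?thesis by (rule closed_L2_subspaceD(6)[OF assms(1)])
qed

text \<open>
  The projection theorem in the form in which completeness of a family is proved below: it is enough
  that \<open>f\<close> is orthogonal to everything orthogonal to \<open>V\<close>, since this applies to the difference of \<open>f\<close>
  and its projection.
\<close>

lemma in_closed_L2_subspace_if_orthogonal:
  assumes V: "closed_L2_subspace V" and f: "f \<in> L2_space"
    and orth: "\<And>g. g \<in> L2_space \<Longrightarrow> (\<And>v. v \<in> V \<Longrightarrow> L2_inner g v = 0) \<Longrightarrow> L2_inner f g = 0"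
  shows "f \<in> V"
proof -
  obtain p where p: "p \<in> V" "\<And>v. v \<in> V \<Longrightarrow> L2_inner (\<lambda>x. f x - p x) v = 0"
    using L2_projection[OF V f] by blast
  have pL: "p \<in> L2_space" using closed_L2_subspaceD(1)[OF V p(1)] .
  have gL: "(\<lambda>x. f x - p x) \<in> L2_space" by (intro L2_diff f pL)
  have "L2_inner f (\<lambda>x. f x - p x) = 0" by (rule orth[OF gL p(2)])
  moreover have "L2_inner p (\<lambda>x. f x - p x) = 0"
    using p(2)[OF p(1)] by (subst L2_inner_commute) simp
  ultimately have "L2_inner (\<lambda>x. f x - p x) (\<lambda>x. f x - p x) = 0"
    by (simp add: L2_inner_diff_left f pL gL)
  then have "L2_norm (\<lambda>x. f x - p x) = 0" using L2_inner_self[OF gL] by simp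
  then have "AE x in lebesgue. f x = p x" using L2_norm_zero_iff[OF gL] by simp
  then show ?thesis by (rule closed_L2_subspace_AE[OF V p(1) f])
qed

lemma in_closed_span_if_orthogonal:
  assumes e: "\<And>i. i \<in> I \<Longrightarrow> e i \<in> L2_space" and f: "f \<in> L2_space"
    and orth: "\<And>g. g \<in> L2_space \<Longrightarrow> (\<And>i. i \<in> I \<Longrightarrow> L2_inner g (e i) = 0) \<Longrightarrow> L2_inner f g = 0"
  shows "f \<in> closed_span I e"
proof (rule in_closed_L2_subspace_if_orthogonal[OF closed_span_subspace f])
  fix g :: "real^'b \<Rightarrow> complex"
  assume g: "g \<in> L2_space" "\<And>v. v \<in> closed_span I e \<Longrightarrow> L2_inner g v = 0"
  show "L2_inner f g = 0" by (rule orth[OF g(1) g(2)[OF in_closed_span]]) (auto simp: e)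
qed (rule e)

lemma closed_span_orthogonal:
  assumes e: "\<And>i. i \<in> I \<Longrightarrow> e i \<in> L2_space" and w: "w \<in> L2_space"
    and orth: "\<And>i. i \<in> I \<Longrightarrow> L2_inner (e i) w = 0" and f: "f \<in> closed_span I e"
  shows "L2_inner f w = 0"
proof -
  have "closed_span I e \<subseteq> {f \<in> L2_space. L2_inner f w = 0}"
    by (rule closed_span_minimal[OF closed_L2_subspace_orthogonal[OF w]]) (simp add: e orth)
  then show ?thesis using f by auto
qed

definition orthonormal :: "'i set \<Rightarrow> ('i \<Rightarrow> real^'d \<Rightarrow> complex) \<Rightarrow> bool"
  where "orthonormal I e \<longleftrightarrow> (\<forall>i\<in>I. e i \<in> L2_space) \<and>
    (\<forall>i\<in>I. \<forall>j\<in>I. L2_inner (e i) (e j) = (if i = j then 1 else 0))"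

lemma orthonormal_diff_norm:
  assumes o: "orthonormal I e" and F: "finite F" "F \<subseteq> I" and f: "f \<in> L2_space"
  shows "(L2_norm (\<lambda>x. f x - (\<Sum>i\<in>F. c i * e i x)))\<^sup>2 =
    (L2_norm f)\<^sup>2 - (\<Sum>i\<in>F. (cmod (L2_inner f (e i)))\<^sup>2) + (\<Sum>i\<in>F. (cmod (c i - L2_inner f (e i)))\<^sup>2)"
proof -
  let ?s = "\<lambda>x. \<Sum>i\<in>F. c i * e i x"
  have e: "e i \<in> L2_space" if "i \<in> F" for i using that o F by (auto simp: orthonormal_def)
  have s: "?s \<in> L2_space" by (intro L2_sum L2_cmult e)
  have ss: "L2_inner (e i) ?s = cnj (c i)" if i: "i \<in> F" for i
  proof -
    have "L2_inner ?s (e i) = (\<Sum>j\<in>F. c j * L2_inner (e j) (e i))" by (rule L2_inner_sum_left[OF e[OF i] e])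
    also have "\<dots> = (\<Sum>j\<in>F. if j = i then c j else 0)"
      using o F(2) i by (intro sum.cong) (auto simp: orthonormal_def subset_iff)
    also have "\<dots> = c i" using F(1) i by simp
    finally show ?thesis by (subst L2_inner_commute) simp
  qed
  have "complex_of_real ((L2_norm ?s)\<^sup>2) = (\<Sum>i\<in>F. c i * cnj (c i))"
    unfolding L2_inner_self[OF s, symmetric] by (subst L2_inner_sum_left[OF s e]) (auto simp: ss)
  also have "\<dots> = complex_of_real (\<Sum>i\<in>F. (cmod (c i))\<^sup>2)" by (simp only: of_real_sum complex_norm_square)
  finally have n: "(L2_norm ?s)\<^sup>2 = (\<Sum>i\<in>F. (cmod (c i))\<^sup>2)" using of_real_eq_iff by blast
  have "L2_inner f ?s = (\<Sum>i\<in>F. cnj (c i) * L2_inner f (e i))"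
  proof -
    have "L2_inner f ?s = cnj (\<Sum>i\<in>F. c i * L2_inner (e i) f)"
      by (subst L2_inner_commute, subst L2_inner_sum_left[OF f e]) auto
    also have "\<dots> = (\<Sum>i\<in>F. cnj (c i) * cnj (L2_inner (e i) f))" by simp
    finally show ?thesis unfolding L2_inner_commute[of f, symmetric] .
  qed
  then have "(L2_norm (\<lambda>x. f x - ?s x))\<^sup>2 =
      (L2_norm f)\<^sup>2 + (\<Sum>i\<in>F. (cmod (c i))\<^sup>2 - 2 * Re (cnj (c i) * L2_inner f (e i)))"
    unfolding L2_norm_diff_sq[OF f s] n by (simp add: sum_subtractf sum_distrib_left)
  also have "(\<Sum>i\<in>F. (cmod (c i))\<^sup>2 - 2 * Re (cnj (c i) * L2_inner f (e i))) =
      (\<Sum>i\<in>F. (cmod (c i - L2_inner f (e i)))\<^sup>2 - (cmod (L2_inner f (e i)))\<^sup>2)"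
    by (intro sum.cong refl) (simp add: cmod_power2, simp add: power2_eq_square algebra_simps)
  finally show ?thesis by (simp add: sum_subtractf)
qed

lemma orthonormal_sum_norm:
  assumes "orthonormal I e" "finite F" "F \<subseteq> I"
  shows "(L2_norm (\<lambda>x. \<Sum>i\<in>F. c i * e i x))\<^sup>2 = (\<Sum>i\<in>F. (cmod (c i))\<^sup>2)"
proof -
  have "(\<lambda>x. 0 - (\<Sum>i\<in>F. - c i * e i x)) = (\<lambda>x. \<Sum>i\<in>F. c i * e i x)" by (simp add: sum_negf)
  moreover have "L2_inner (\<lambda>x. 0) (e i) = 0" for i by (simp add: L2_inner_def)
  moreover have "L2_norm (\<lambda>x :: real^'b. 0) = 0" by (simp add: L2_norm_def)
  ultimately show ?thesis using orthonormal_diff_norm[OF assms L2_zero, of "\<lambda>i. - c i"] by simp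
qed

lemma parseval_sums:
  fixes e :: "nat \<Rightarrow> real^'d \<Rightarrow> complex"
  assumes o: "orthonormal UNIV e" and f: "f \<in> closed_span UNIV e"
  shows "(\<lambda>n. (cmod (L2_inner f (e n)))\<^sup>2) sums (L2_norm f)\<^sup>2"
proof -
  let ?a = "\<lambda>n. (cmod (L2_inner f (e n)))\<^sup>2"
  have fL: "f \<in> L2_space" using f by (simp add: closed_span_def L2_closure_def)
  have le: "sum ?a F \<le> (L2_norm f)\<^sup>2" if F: "finite F" for F
    using orthonormal_diff_norm[OF o F subset_UNIV fL, of "\<lambda>i. L2_inner f (e i)"]
      zero_le_power2[of "L2_norm (\<lambda>x. f x - (\<Sum>i\<in>F. L2_inner f (e i) * e i x))"] by simp
  have summ: "summable ?a" by (rule summableI_nonneg_bounded) (auto intro: le)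
  \<comment> \<open>Among the combinations over \<open>F\<close> the one with coefficients \<open>L2_inner f (e i)\<close> is closest to \<open>f\<close>, so the
      squared norm exceeds the partial sum over \<open>F\<close> by at most the squared error of any approximation.\<close>
  have "(L2_norm f)\<^sup>2 \<le> suminf ?a + \<epsilon>" if "\<epsilon> > 0" for \<epsilon>
  proof -
    have "sqrt \<epsilon> > 0" using that by simp
    then obtain g where g: "g \<in> lin_span UNIV e" "L2_norm (\<lambda>x. f x - g x) < sqrt \<epsilon>"
      using L2_closureD[OF f[unfolded closed_span_def]] by blast
    then obtain F c where F: "finite F" "g = (\<lambda>x. \<Sum>i\<in>F. c i * e i x)" by (auto simp: lin_span_def)
    have "(L2_norm (\<lambda>x. f x - g x))\<^sup>2 < (sqrt \<epsilon>)\<^sup>2" using g(2) by (intro power_strict_mono) auto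
    then have "(L2_norm f)\<^sup>2 - sum ?a F + (\<Sum>i\<in>F. (cmod (c i - L2_inner f (e i)))\<^sup>2) < \<epsilon>"
      unfolding F(2) orthonormal_diff_norm[OF o F(1) subset_UNIV fL] using that by simp
    moreover have "(\<Sum>i\<in>F. (cmod (c i - L2_inner f (e i)))\<^sup>2) \<ge> 0" by (intro sum_nonneg) auto
    moreover have "sum ?a F \<le> suminf ?a" by (rule sum_le_suminf[OF summ F(1)]) auto
    ultimately show ?thesis by linarith
  qed
  then have "(L2_norm f)\<^sup>2 \<le> suminf ?a" by (rule field_le_epsilon)
  moreover have "suminf ?a \<le> (L2_norm f)\<^sup>2" by (rule suminf_le_const[OF summ]) (rule le, simp)
  ultimately show ?thesis using summ by (simp add: sums_iff)
qed

text \<open>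
  The case \<open>l = 1\<close> of a multi-tile, with the number of points replaced by unique existence.
\<close>

definition tile :: "(real^'d) set \<Rightarrow> bool"
  where "tile T \<longleftrightarrow> T \<in> sets lebesgue \<and> (AE \<omega> in lebesgue. \<exists>!n. \<omega> + lattice_point n \<in> T)"

lemma tile_unit_cell: "tile (unit_cell :: (real^'d) set)"
proof -
  have "\<exists>!n. \<omega> + lattice_point n \<in> unit_cell" for \<omega> :: "real^'d"
  proof -
    obtain n where n: "lattice_point n = - round_vec \<omega>" 
      using lattice_pointE[OF int_lattice_minus[OF round_vec_in_lattice]] .
    show ?thesis
    proof
      show "\<omega> + lattice_point n \<in> unit_cell" using n diff_round_in_cell[of \<omega>] by simp
      fix m assume "\<omega> + lattice_point m \<in> unit_cell"
      then have "- lattice_point m = round_vec \<omega>"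
        using diff_in_cell_iff[OF int_lattice_minus[OF lattice_point_in], of \<omega> m] by simp
      then have "lattice_point m = (lattice_point n :: real^'d)" using n by (metis minus_minus)
      then show "m = n" using lattice_point_inj by blast
    qed
  qed
  then show ?thesis by (simp add: tile_def)
qed

lemma suminf_unique_nonzero:
  fixes f :: "nat \<Rightarrow> 'a::{t2_space, topological_comm_monoid_add}"
  assumes "\<And>m. m \<noteq> n \<Longrightarrow> f m = 0"
  shows "(\<Sum>m. f m) = f n"
  using suminf_finite[of "{n}" f] assms by simp

lemma emeasure_tile:
  assumes "tile T" shows "emeasure lebesgue T = 1"
proof -
  have T: "T \<in> sets lebesgue" using assms by (simp add: tile_def)
  have "emeasure lebesgue T = (\<integral>\<^sup>+\<omega>. indicator T \<omega> \<partial>lebesgue)" using T by simp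
  also have "\<dots> = (\<integral>\<^sup>+\<omega>. (\<Sum>n. indicator T (\<omega> + lattice_point n)) * indicator unit_cell \<omega> \<partial>lebesgue)"
    using T by (intro nn_integral_periodize) auto
  also have "\<dots> = (\<integral>\<^sup>+\<omega>. indicator unit_cell (\<omega> :: real^'a) \<partial>lebesgue)"
  proof (rule nn_integral_cong_AE)
    have "AE \<omega> in lebesgue. \<exists>!n. \<omega> + lattice_point n \<in> T" using assms by (simp add: tile_def)
    then show "AE \<omega> in lebesgue. (\<Sum>n. indicator T (\<omega> + lattice_point n)) * indicator unit_cell \<omega> =
        (indicator unit_cell \<omega> :: ennreal)"
    proof eventually_elim
      case (elim \<omega>)
      then obtain n where n: "\<omega> + lattice_point n \<in> T" "\<And>m. \<omega> + lattice_point m \<in> T \<Longrightarrow> m = n"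
        by (rule ex1E) blast
      have "indicator T (\<omega> + lattice_point m) = (0 :: ennreal)" if "m \<noteq> n" for m
        using n(2)[of m] that by (meson indicator_simps(2))
      then have "(\<Sum>n. indicator T (\<omega> + lattice_point n)) = (indicator T (\<omega> + lattice_point n) :: ennreal)"
        by (rule suminf_unique_nonzero)
      then have "(\<Sum>n. indicator T (\<omega> + lattice_point n)) = (1 :: ennreal)" using n(1) by simp
      then show ?case by simp
    qed
  qed
  also have "\<dots> = emeasure lebesgue (unit_cell :: (real^'a) set)" by simp
  also have "\<dots> = 1"
    using emeasure_eq_ennreal_measure[of lebesgue "unit_cell :: (real^'a) set"] emeasure_unit_cell_finite
    by (simp add: measure_unit_cell less_top)
  finally show ?thesis .
qed

lemma integrable_indicator_tile:
  assumes "tile T" shows "integrable lebesgue (indicator T :: real^'d \<Rightarrow> complex)"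
proof -
  have "integrable lebesgue (indicator T :: real^'d \<Rightarrow> real)"
    using emeasure_tile[OF assms] assms by (intro integrable_real_indicator) (auto simp: tile_def)
  then have "integrable lebesgue (\<lambda>\<omega>. complex_of_real (indicator T \<omega>))" by (rule integrable_of_real)
  moreover have "(\<lambda>\<omega>. complex_of_real (indicator T \<omega>)) = indicator T" by (auto simp: indicator_def)
  ultimately show ?thesis by simp
qed

lemma AE_tile_periodize:
  assumes "tile T" "\<And>\<omega>. \<omega> \<notin> T \<Longrightarrow> g \<omega> = 0"
  shows "AE \<omega> in lebesgue. \<exists>n. \<omega> + lattice_point n \<in> T \<and> periodize g \<omega> = g (\<omega> + lattice_point n)"
proof -
  have "AE \<omega> in lebesgue. \<exists>!n. \<omega> + lattice_point n \<in> T" using assms by (simp add: tile_def)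
  then show ?thesis
  proof eventually_elim
    case (elim \<omega>)
    then obtain n where n: "\<omega> + lattice_point n \<in> T" "\<And>m. \<omega> + lattice_point m \<in> T \<Longrightarrow> m = n"
      by (rule ex1E) blast
    have "periodize g \<omega> = g (\<omega> + lattice_point n)"
      unfolding periodize_def by (rule suminf_unique_nonzero, rule assms(2)) (use n(2) in blast)
    with n(1) show ?case by blast
  qed
qed

lemma tile_chr_L2:
  assumes "tile T"
  shows "(\<lambda>\<omega>. indicator T \<omega> * chr k \<omega>) \<in> L2_space"
proof -
  have T[measurable]: "T \<in> sets lebesgue" using assms by (simp add: tile_def)
  have "(\<integral>\<^sup>+\<omega>. ennreal ((cmod (indicator T \<omega> * chr k \<omega>))\<^sup>2) \<partial>lebesgue) = (\<integral>\<^sup>+\<omega>. indicator T \<omega> \<partial>lebesgue)"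
    by (intro nn_integral_cong) (auto simp: indicator_def)
  also have "\<dots> < \<infinity>" using emeasure_tile[OF assms] by simp
  moreover have "(\<lambda>\<omega>. indicator T \<omega> * chr k \<omega>) \<in> borel_measurable lebesgue" by measurable
  ultimately show ?thesis by (simp add: L2_space_iff_nn)
qed

text \<open>
  The indicator of a tile has periodization 1, like that of the unit cell, and the product of two
  characters with integer frequency is periodic. So the integral over the tile equals that over the cell.
\<close>

lemma tile_chr_inner:
  assumes T: "tile T" and k: "k \<in> int_lattice" "l \<in> int_lattice"
  shows "L2_inner (\<lambda>\<omega>. indicator T \<omega> * chr k \<omega>) (\<lambda>\<omega>. indicator T \<omega> * chr l \<omega>) = (if k = l then 1 else 0)"
proof -
  have c: "AE \<omega> in lebesgue. periodize (indicator T) \<omega> = 1"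
    using AE_tile_periodize[OF T, of "indicator T"] by (auto elim!: eventually_mono)
  have "L2_inner (\<lambda>\<omega>. indicator T \<omega> * chr k \<omega>) (\<lambda>\<omega>. indicator T \<omega> * chr l \<omega>)
      = (LINT \<omega>|lebesgue. indicator T \<omega> * chr (k - l) \<omega>)"
    unfolding L2_inner_def by (intro Bochner_Integration.integral_cong) (auto simp: chr_diff_left indicator_def)
  also have "\<dots> = 1 * (LINT \<omega>|lebesgue. indicator unit_cell \<omega> * chr (k - l) \<omega>)"
    by (rule integral_mult_periodic_const[OF integrable_indicator_tile[OF T] c, where C = 1])
      (auto simp: lattice_periodic_chr k int_lattice_diff)
  finally show ?thesis using integral_unit_cell_chr[OF int_lattice_diff[OF k]] by simp
qed

text \<open>
  The restriction of \<open>g\<close> to the tile is integrable with vanishing Fourier coefficients, so its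
  periodization is zero. As an orbit meets the tile once, the periodization has a single nonzero term.
\<close>

lemma tile_chr_complete:
  assumes T: "tile T" and g: "g \<in> L2_space"
    and orth: "\<And>k. k \<in> int_lattice \<Longrightarrow> L2_inner g (\<lambda>\<omega>. indicator T \<omega> * chr k \<omega>) = 0"
  shows "AE \<omega> in lebesgue. \<omega> \<in> T \<longrightarrow> g \<omega> = 0"
proof -
  define h where "h \<omega> = g \<omega> * indicator T \<omega>" for \<omega>
  have "h = (\<lambda>\<omega>. g \<omega> * cnj (indicator T \<omega> * chr 0 \<omega>))" by (auto simp: h_def indicator_def)
  then have hi: "integrable lebesgue h" using L2_inner_integrable[OF g tile_chr_L2[OF T, of 0]] by simp
  have "(LINT \<omega>|lebesgue. h \<omega> * chr k \<omega>) = 0" if k: "k \<in> int_lattice" for k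
  proof -
    have "(LINT \<omega>|lebesgue. h \<omega> * chr k \<omega>) = L2_inner g (\<lambda>\<omega>. indicator T \<omega> * chr (- k) \<omega>)"
      unfolding L2_inner_def h_def
      by (intro Bochner_Integration.integral_cong) (auto simp: chr_minus_left indicator_def)
    then show ?thesis using orth[OF int_lattice_minus[OF k]] by simp
  qed
  then have "annihilated int_lattice h" by (simp add: annihilated_def hi)
  from periodize_zero_if_annihilated[OF this] have 1: "AE \<omega> in lebesgue. periodize h \<omega> = 0" .
  have "AE \<omega> in lebesgue. \<exists>!n. \<omega> + lattice_point n \<in> T" using T by (simp add: tile_def)
  with 1 show ?thesis
  proof eventually_elim
    case (elim \<omega>)
    show ?case
    proof
      assume w: "\<omega> \<in> T"
      obtain n where n: "lattice_point n = (0 :: real^'a)" using lattice_pointE[OF int_lattice_zero] .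
      have "periodize h \<omega> = h (\<omega> + lattice_point n)"
        unfolding periodize_def
      proof (rule suminf_unique_nonzero)
        fix m assume "m \<noteq> n"
        then have "\<omega> + lattice_point m \<notin> T" using elim(2) w n by (metis add.right_neutral)
        then show "h (\<omega> + lattice_point m) = 0" by (simp add: h_def)
      qed
      then show "g \<omega> = 0" using elim(1) n w by (simp add: h_def)
    qed
  qed
qed

section \<open>Plancherel's theorem\<close>

lemma fourier_L1_eq: "fourier_L1 f \<omega> = (LINT x|lebesgue. f x * cnj (chr \<omega> x))"
proof -
  have "exp (- 2 * complex_of_real pi * \<i> * complex_of_real (\<omega> \<bullet> x)) = cnj (chr \<omega> x)" for x
  proof -
    have "cnj (\<i> * complex_of_real (2 * pi * (\<omega> \<bullet> x))) = - 2 * complex_of_real pi * \<i> * complex_of_real (\<omega> \<bullet> x)"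
      by simp
    then show ?thesis unfolding chr_def cis_conv_exp exp_cnj by (rule arg_cong[where f = exp, symmetric])
  qed
  then show ?thesis by (simp add: fourier_L1_def mult.commute)
qed

lemma fourier_L1_integrable:
  assumes "integrable lebesgue f" shows "integrable lebesgue (\<lambda>x. f x * cnj (chr \<omega> x))"
  using integrable_mult_chr[OF assms, of "- \<omega>"] by (simp add: chr_minus_left)

lemma continuous_fourier_L1:
  assumes f: "integrable lebesgue f"
  shows "continuous_on UNIV (fourier_L1 f)"
  unfolding continuous_on_sequentially
proof (intro allI ballI impI, elim conjE)
  fix x a assume lim: "x \<longlonglongrightarrow> (a :: real^'a)"
  show "(fourier_L1 f \<circ> x) \<longlonglongrightarrow> fourier_L1 f a"
    unfolding comp_def fourier_L1_eq
  proof (rule integral_dominated_convergence[where w = "\<lambda>x. norm (f x)"])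
    have "(\<lambda>n. f y * cnj (chr (x n) y)) \<longlonglongrightarrow> f y * cnj (chr a y)" for y
    proof -
      have "(\<lambda>n. chr y (x n)) \<longlonglongrightarrow> chr y a"
        by (rule continuous_on_tendsto_compose[OF continuous_chr lim]) auto
      then show ?thesis by (intro tendsto_intros) (simp add: chr_commute[of _ y])
    qed
    then show "AE y in lebesgue. (\<lambda>n. f y * cnj (chr (x n) y)) \<longlonglongrightarrow> f y * cnj (chr a y)" by simp
    show "(\<lambda>x. f x * cnj (chr a x)) \<in> borel_measurable lebesgue" "(\<lambda>y. f y * cnj (chr (x n) y)) \<in> borel_measurable lebesgue" for n
      using borel_measurable_integrable[OF fourier_L1_integrable[OF f]] by auto
  qed (use f in \<open>auto simp: norm_mult\<close>)
qed

lemma fourier_L1_measurable: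
  "integrable lebesgue f \<Longrightarrow> fourier_L1 f \<in> borel_measurable lebesgue"
  by (intro borel_imp_lebesgue_measurable borel_measurable_continuous_onI continuous_fourier_L1)

lemma fourier_L1_add:
  "integrable lebesgue f \<Longrightarrow> integrable lebesgue g \<Longrightarrow>
    fourier_L1 (\<lambda>x. f x + g x) \<omega> = fourier_L1 f \<omega> + fourier_L1 g \<omega>"
  and fourier_L1_diff:
  "integrable lebesgue f \<Longrightarrow> integrable lebesgue g \<Longrightarrow>
    fourier_L1 (\<lambda>x. f x - g x) \<omega> = fourier_L1 f \<omega> - fourier_L1 g \<omega>"
  by (simp_all add: fourier_L1_eq ring_distribs fourier_L1_integrable)

lemma fourier_L1_cmult: "fourier_L1 (\<lambda>x. c * f x) \<omega> = c * fourier_L1 f \<omega>"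
  by (simp add: fourier_L1_eq mult.assoc)

lemma L2_integrable_on_finite:
  assumes f: "f \<in> L2_space" and E: "E \<in> sets lebesgue" "emeasure lebesgue E < \<infinity>"
    and z: "\<And>x. x \<notin> E \<Longrightarrow> f x = 0"
  shows "integrable lebesgue f"
proof -
  have [measurable]: "E \<in> sets lebesgue" by fact
  have "(\<integral>\<^sup>+\<omega>. ennreal ((cmod (indicator E \<omega>))\<^sup>2) \<partial>lebesgue) = (\<integral>\<^sup>+\<omega>. indicator E \<omega> \<partial>lebesgue)"
    by (intro nn_integral_cong) (auto simp: indicator_def)
  then have "(indicator E :: _ \<Rightarrow> complex) \<in> L2_space" using E by (simp add: L2_space_iff_nn)
  from L2_inner_integrable[OF f this] have "integrable lebesgue (\<lambda>x. f x * cnj (indicator E x))" .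
  moreover have "f x * cnj (indicator E x) = f x" for x
    by (cases "x \<in> E") (simp_all add: z)
  ultimately show ?thesis by simp
qed

text \<open>
  The values of the transform on the shifted lattice \<open>\<omega> + \<int>\<^sup>d\<close> are the Fourier coefficients of
  \<open>cnj (chr \<omega>) * f\<close>, a function with the same norm as \<open>f\<close>.
\<close>

lemma parseval_unit_cell:
  fixes f :: "real^'d \<Rightarrow> complex"
  assumes f: "f \<in> L2_space" and z: "\<And>x. x \<notin> unit_cell \<Longrightarrow> f x = 0"
  shows "(\<Sum>n. ennreal ((cmod (fourier_L1 f (\<omega> + lattice_point n)))\<^sup>2)) = ennreal ((L2_norm f)\<^sup>2)"
proof -
  define e where "e n x = indicator unit_cell x * chr (lattice_point n :: real^'d) x" for n x
  define F where "F x = cnj (chr \<omega> x) * f x" for x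
  have F: "F \<in> L2_space" unfolding F_def
    using L2_bounded_mult[OF f chr_lebesgue[of "- \<omega>"], of 1] by (simp add: chr_minus_left)
  have e: "e n \<in> L2_space" for n unfolding e_def by (rule tile_chr_L2[OF tile_unit_cell])
  have on: "orthonormal UNIV e"
    unfolding orthonormal_def using e
    by (simp add: e_def[abs_def] tile_chr_inner[OF tile_unit_cell] lattice_point_inj)
  have "F \<in> closed_span UNIV e"
  proof (rule in_closed_span_if_orthogonal[OF e F])
    fix g :: "real^'d \<Rightarrow> complex"
    assume g: "g \<in> L2_space" "\<And>n. n \<in> UNIV \<Longrightarrow> L2_inner g (e n) = 0"
    have "AE x in lebesgue. x \<in> unit_cell \<longrightarrow> g x = 0"
    proof (rule tile_chr_complete[OF tile_unit_cell g(1)])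
      fix k :: "real^'d" assume "k \<in> int_lattice"
      then obtain n where "lattice_point n = k" by (rule lattice_pointE)
      then show "L2_inner g (\<lambda>\<omega>. indicator unit_cell \<omega> * chr k \<omega>) = 0"
        using g(2)[of n] by (simp add: e_def[abs_def])
    qed
    then have "AE x in lebesgue. F x * cnj (g x) = 0"
      by eventually_elim (use z in \<open>auto simp: F_def\<close>)
    then show "L2_inner F g = 0" unfolding L2_inner_def by (rule integral_eq_zero_AE)
  qed
  from parseval_sums[OF on this]
  have s: "(\<lambda>n. (cmod (L2_inner F (e n)))\<^sup>2) sums (L2_norm F)\<^sup>2" .
  have "L2_inner F (e n) = fourier_L1 f (\<omega> + lattice_point n)" for n
    unfolding L2_inner_def fourier_L1_eq
    by (intro Bochner_Integration.integral_cong)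
      (use z in \<open>auto simp: F_def e_def indicator_def chr_add_left\<close>)
  moreover have "L2_norm F = L2_norm f" by (simp add: L2_norm_def F_def norm_mult)
  ultimately have "(\<lambda>n. (cmod (fourier_L1 f (\<omega> + lattice_point n)))\<^sup>2) sums (L2_norm f)\<^sup>2" using s by simp
  then show ?thesis by (simp add: sums_iff suminf_ennreal2)
qed

text \<open>
  Averaging Parseval's identity over the shifts \<open>\<omega>\<close> in the unit cell turns the sum over the shifted
  lattice into the integral over the whole space.
\<close>

lemma plancherel_unit_cell:
  fixes f :: "real^'d \<Rightarrow> complex"
  assumes f: "f \<in> L2_space" and z: "\<And>x. x \<notin> unit_cell \<Longrightarrow> f x = 0"
  shows "(\<integral>\<^sup>+\<omega>. ennreal ((cmod (fourier_L1 f \<omega>))\<^sup>2) \<partial>lebesgue) = ennreal ((L2_norm f)\<^sup>2)"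
proof -
  have fi: "integrable lebesgue f"
    by (rule L2_integrable_on_finite[OF f unit_cell_lebesgue emeasure_unit_cell_finite z])
  have [measurable]: "fourier_L1 f \<in> borel_measurable lebesgue" by (rule fourier_L1_measurable[OF fi])
  have "(\<integral>\<^sup>+\<omega>. ennreal ((cmod (fourier_L1 f \<omega>))\<^sup>2) \<partial>lebesgue) =
      (\<integral>\<^sup>+\<omega>. (\<Sum>n. ennreal ((cmod (fourier_L1 f (\<omega> + lattice_point n)))\<^sup>2)) * indicator unit_cell \<omega> \<partial>lebesgue)"
    by (rule nn_integral_periodize) measurable
  also have "\<dots> = (\<integral>\<^sup>+\<omega>. ennreal ((L2_norm f)\<^sup>2) * indicator (unit_cell :: (real^'d) set) \<omega> \<partial>lebesgue)"
  proof -
    have "(\<Sum>n. ennreal ((cmod (fourier_L1 f (\<omega> + lattice_point n)))\<^sup>2)) = ennreal ((L2_norm f)\<^sup>2)" for \<omega>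
      by (rule parseval_unit_cell[OF f]) (rule z)
    then show ?thesis by (simp only:)
  qed
  also have "\<dots> = ennreal ((L2_norm f)\<^sup>2)"
    using emeasure_tile[OF tile_unit_cell[where 'd='d]] by (subst nn_integral_cmult_indicator) auto
  finally show ?thesis .
qed

lemma integral_lebesgue_scale:
  fixes f :: "'a::euclidean_space \<Rightarrow> complex"
  assumes "c \<noteq> 0" and [measurable]: "f \<in> borel_measurable lebesgue"
  shows "(LINT x|lebesgue. f x) = \<bar>c\<bar> ^ DIM('a) *\<^sub>R (LINT x|lebesgue. f (c *\<^sub>R x))"
proof -
  note [measurable] = measurable_lebesgue_affine[OF assms(1), of 0]
  show ?thesis
    apply (subst lebesgue_eq_density_affine[OF assms(1), of 0])
    apply (subst integral_density)
       apply (simp_all add: measurable_distr_eq1)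
    apply (subst integral_distr)
      apply simp_all
    done
qed

lemma plancherel_scaled_cell:
  fixes f :: "real^'d \<Rightarrow> complex"
  assumes f: "f \<in> L2_space" and N: "N > 0" and z: "\<And>x. (1 / N) *\<^sub>R x \<notin> unit_cell \<Longrightarrow> f x = 0"
  shows "(\<integral>\<^sup>+\<omega>. ennreal ((cmod (fourier_L1 f \<omega>))\<^sup>2) \<partial>lebesgue) = ennreal ((L2_norm f)\<^sup>2)"
proof -
  define d where "d = DIM(real^'d)"
  define g where "g x = f (N *\<^sub>R x)" for x
  have fm[measurable]: "f \<in> borel_measurable lebesgue" using f by (rule L2_space_measurable)
  have scale: "(\<lambda>x :: real^'d. c *\<^sub>R x) \<in> lebesgue \<rightarrow>\<^sub>M lebesgue" if "c \<noteq> 0" for c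
    using measurable_lebesgue_affine[OF that, of 0] by simp
  have gm[measurable]: "g \<in> borel_measurable lebesgue"
    unfolding g_def using measurable_compose[OF scale fm, of N] N by simp
  have nf: "(\<integral>\<^sup>+x. ennreal ((cmod (f x))\<^sup>2) \<partial>lebesgue) = ennreal (N ^ d) * (\<integral>\<^sup>+x. ennreal ((cmod (g x))\<^sup>2) \<partial>lebesgue)"
    using nn_integral_lebesgue_affine[of N "\<lambda>x. ennreal ((cmod (f x))\<^sup>2)" 0] N by (simp add: g_def d_def)
  have Npos: "ennreal (N ^ d) \<noteq> 0" "ennreal (N ^ d) < \<infinity>" using N by auto
  have g: "g \<in> L2_space"
    using f nf Npos unfolding L2_space_iff_nn
    by (auto simp: ennreal_mult_less_top)
  have gz: "g x = 0" if "x \<notin> unit_cell" for x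
    unfolding g_def by (rule z) (use that N in simp)
  have gi: "integrable lebesgue g"
    by (rule L2_integrable_on_finite[OF g unit_cell_lebesgue emeasure_unit_cell_finite gz])
  have [measurable]: "fourier_L1 g \<in> borel_measurable lebesgue" by (rule fourier_L1_measurable[OF gi])
  have fg: "fourier_L1 f \<omega> = of_real (N ^ d) * fourier_L1 g (N *\<^sub>R \<omega>)" for \<omega>
  proof -
    have m: "(\<lambda>x. f x * cnj (chr \<omega> x)) \<in> borel_measurable lebesgue"
      using fm chr_lebesgue[of \<omega>] by (intro borel_measurable_times borel_measurable_cnj)
    have "chr \<omega> (N *\<^sub>R x) = chr (N *\<^sub>R \<omega>) x" for x by (simp add: chr_def mult.left_commute)
    then show ?thesis
      unfolding fourier_L1_eq using integral_lebesgue_scale[OF _ m, of N] N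
      by (simp add: g_def d_def scaleR_conv_of_real)
  qed
  have "(\<integral>\<^sup>+\<omega>. ennreal ((cmod (fourier_L1 g \<omega>))\<^sup>2) \<partial>lebesgue) =
      ennreal (N ^ d) * (\<integral>\<^sup>+\<omega>. ennreal ((cmod (fourier_L1 g (N *\<^sub>R \<omega>)))\<^sup>2) \<partial>lebesgue)"
    using nn_integral_lebesgue_affine[of N "\<lambda>x. ennreal ((cmod (fourier_L1 g x))\<^sup>2)" 0] N by (simp add: d_def)
  then have 1: "ennreal (N ^ d) * (\<integral>\<^sup>+\<omega>. ennreal ((cmod (fourier_L1 g (N *\<^sub>R \<omega>)))\<^sup>2) \<partial>lebesgue) = ennreal ((L2_norm g)\<^sup>2)"
    using plancherel_unit_cell[OF g gz] by simp
  have [measurable]: "(\<lambda>\<omega>. fourier_L1 g (N *\<^sub>R \<omega>)) \<in> borel_measurable lebesgue"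
    using measurable_compose[OF scale, of N "fourier_L1 g"] N by simp
  have "(\<integral>\<^sup>+\<omega>. ennreal ((cmod (fourier_L1 f \<omega>))\<^sup>2) \<partial>lebesgue) =
      (\<integral>\<^sup>+\<omega>. ennreal (N ^ d) * (ennreal (N ^ d) * ennreal ((cmod (fourier_L1 g (N *\<^sub>R \<omega>)))\<^sup>2)) \<partial>lebesgue)"
    using N by (intro nn_integral_cong)
      (simp add: fg norm_mult norm_power power_mult_distrib ennreal_mult' power2_eq_square mult_ac)
  also have "\<dots> = ennreal (N ^ d) * (ennreal (N ^ d) * (\<integral>\<^sup>+\<omega>. ennreal ((cmod (fourier_L1 g (N *\<^sub>R \<omega>)))\<^sup>2) \<partial>lebesgue))"
    by (simp add: nn_integral_cmult)
  also have "\<dots> = ennreal (N ^ d) * ennreal ((L2_norm g)\<^sup>2)" by (simp only: 1)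
  also have "\<dots> = ennreal ((L2_norm f)\<^sup>2)" using nf by (simp only: L2_norm_sq_nn[OF f] L2_norm_sq_nn[OF g])
  finally show ?thesis .
qed

text \<open>
  Truncation to cubes, which are scaled copies of the unit cell, and not to balls, so that Plancherel's
  identity for the truncated functions follows by scaling. The factor \<open>Suc n\<close> avoids a division by 0.
\<close>

definition truncate_cell :: "nat \<Rightarrow> (real^'d \<Rightarrow> complex) \<Rightarrow> real^'d \<Rightarrow> complex"
  where "truncate_cell n f x = (if (1 / real (Suc n)) *\<^sub>R x \<in> unit_cell then f x else 0)"

lemma truncate_cell_eq: "truncate_cell n f x = indicator {x. (1 / real (Suc n)) *\<^sub>R x \<in> unit_cell} x * f x"
  by (simp add: truncate_cell_def indicator_def)

lemma scaled_cell_lebesgue: "{x :: real^'d. (1 / real (Suc n)) *\<^sub>R x \<in> unit_cell} \<in> sets lebesgue"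
proof -
  have "(\<lambda>x :: real^'d. (1 / real (Suc n)) *\<^sub>R x) \<in> borel_measurable lebesgue"
    by (intro borel_imp_lebesgue_measurable borel_measurable_continuous_onI continuous_intros)
  from measurable_sets[OF this unit_cell_borel] show ?thesis by (simp add: vimage_def)
qed

lemma truncate_cell_L2:
  assumes "f \<in> L2_space" shows "truncate_cell n f \<in> L2_space"
  unfolding truncate_cell_eq[abs_def]
  by (rule L2_bounded_mult[OF assms, where C = 1])
    (use scaled_cell_lebesgue in \<open>auto simp: indicator_def\<close>)

lemma truncate_cell_integrable:
  assumes "f \<in> L2_space" shows "integrable lebesgue (truncate_cell n f)"
proof (rule L2_integrable_on_finite[OF truncate_cell_L2[OF assms] scaled_cell_lebesgue])
  have "{x :: real^'a. (1 / real (Suc n)) *\<^sub>R x \<in> unit_cell} \<subseteq> cbox (- (\<chi> i. Suc n / 2)) (\<chi> i. Suc n / 2)"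
  proof
    fix x :: "real^'a" assume "x \<in> {x. (1 / real (Suc n)) *\<^sub>R x \<in> unit_cell}"
    then have "- (1/2) < x $ i / real (Suc n) \<and> x $ i / real (Suc n) \<le> 1/2" for i
      by (simp add: unit_cell_def)
    then show "x \<in> cbox (- (\<chi> i. Suc n / 2)) (\<chi> i. Suc n / 2)"
      by (simp add: mem_box_cart pos_less_divide_eq pos_divide_le_eq less_imp_le)
  qed
  then have "emeasure lebesgue {x :: real^'a. (1 / real (Suc n)) *\<^sub>R x \<in> unit_cell} \<le>
      emeasure lebesgue (cbox (- (\<chi> i. Suc n / 2)) (\<chi> i. Suc n / 2) :: (real^'a) set)"
    by (intro emeasure_mono) auto
  also have "\<dots> < \<infinity>" using emeasure_lborel_cbox_finite by simp
  finally show "emeasure lebesgue {x :: real^'a. (1 / real (Suc n)) *\<^sub>R x \<in> unit_cell} < \<infinity>" .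
qed (simp add: truncate_cell_def)

lemma truncate_cell_eventually: "eventually (\<lambda>n. truncate_cell n f x = f x) sequentially"
proof -
  have "eventually (\<lambda>n. \<forall>i. 2 * \<bar>x $ i\<bar> < real (Suc n)) sequentially"
  proof (rule eventually_all_finite)
    fix i
    obtain N where "2 * \<bar>x $ i\<bar> < real N" using reals_Archimedean2 by blast
    then show "eventually (\<lambda>n. 2 * \<bar>x $ i\<bar> < real (Suc n)) sequentially"
      by (intro eventually_sequentiallyI[of N]) simp
  qed
  then show ?thesis
  proof eventually_elim
    case (elim n)
    have "- (1/2) < (1 / real (Suc n)) * x $ i \<and> (1 / real (Suc n)) * x $ i \<le> 1/2" for i
    proof -
      have "2 * \<bar>x $ i\<bar> < real (Suc n)" using elim by blast
      then have "\<bar>x $ i\<bar> / real (Suc n) < 1/2" by (simp add: divide_less_eq)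
      then have "\<bar>(1 / real (Suc n)) * x $ i\<bar> < 1/2" by (simp add: abs_mult)
      then show ?thesis by linarith
    qed
    then show ?case by (simp add: truncate_cell_def unit_cell_def)
  qed
qed

lemma truncate_cell_tendsto: "(\<lambda>n. truncate_cell n f x) \<longlonglongrightarrow> f x"
  by (rule tendsto_eventually[OF truncate_cell_eventually])

lemma truncate_cell_norm_tendsto:
  fixes f :: "real^'d \<Rightarrow> complex"
  assumes f: "f \<in> L2_space"
  shows "(\<lambda>n. L2_norm (\<lambda>x. truncate_cell n f x - f x)) \<longlonglongrightarrow> 0"
proof -
  have "(\<lambda>n. LINT x|lebesgue. (cmod (truncate_cell n f x - f x))\<^sup>2) \<longlonglongrightarrow> (LINT (x::real^'d)|lebesgue. (0 :: real))"
  proof (rule integral_dominated_convergence[where w = "\<lambda>x. (cmod (f x))\<^sup>2"])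
    have "(\<lambda>n. (cmod (truncate_cell n f x - f x))\<^sup>2) \<longlonglongrightarrow> (cmod (f x - f x))\<^sup>2" for x
      by (intro tendsto_intros truncate_cell_tendsto)
    then show "AE x in lebesgue. (\<lambda>n. (cmod (truncate_cell n f x - f x))\<^sup>2) \<longlonglongrightarrow> 0" by simp
    show "AE x in lebesgue. norm ((cmod (truncate_cell n f x - f x))\<^sup>2) \<le> (cmod (f x))\<^sup>2" for n
      by (auto simp: truncate_cell_def)
    show "(\<lambda>x. (cmod (truncate_cell n f x - f x))\<^sup>2) \<in> borel_measurable lebesgue" for n
      using L2_space_measurable[OF L2_diff[OF truncate_cell_L2[OF f] f]] by simp
  qed (use L2_space_integrable[OF f] in auto)
  then have "(\<lambda>n. sqrt (LINT x|lebesgue. (cmod (truncate_cell n f x - f x))\<^sup>2)) \<longlonglongrightarrow> sqrt 0"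
    by (intro tendsto_real_sqrt) simp
  then show ?thesis by (simp add: L2_norm_def)
qed

lemma plancherel_truncated:
  assumes f: "f \<in> L2_space" and z: "\<And>x. (1 / real (Suc n)) *\<^sub>R x \<notin> unit_cell \<Longrightarrow> f x = 0"
    and fi: "integrable lebesgue f"
  shows "fourier_L1 f \<in> L2_space" "L2_norm (fourier_L1 f) = L2_norm f"
proof -
  have p: "(\<integral>\<^sup>+\<omega>. ennreal ((cmod (fourier_L1 f \<omega>))\<^sup>2) \<partial>lebesgue) = ennreal ((L2_norm f)\<^sup>2)"
    by (rule plancherel_scaled_cell[OF f, of "real (Suc n)"]) (auto intro: z)
  then show L2: "fourier_L1 f \<in> L2_space"
    by (simp add: L2_space_iff_nn fourier_L1_measurable[OF fi])
  have "ennreal ((L2_norm (fourier_L1 f))\<^sup>2) = ennreal ((L2_norm f)\<^sup>2)"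
    using p L2_norm_sq_nn[OF L2] by simp
  then have "(L2_norm (fourier_L1 f))\<^sup>2 = (L2_norm f)\<^sup>2" by (subst (asm) ennreal_inj) auto
  then show "L2_norm (fourier_L1 f) = L2_norm f" by (rule power2_eq_imp_eq) auto
qed

lemma plancherel_truncate_cell:
  assumes "f \<in> L2_space"
  shows "fourier_L1 (truncate_cell n f) \<in> L2_space"
    "L2_norm (fourier_L1 (truncate_cell n f)) = L2_norm (truncate_cell n f)"
  by (rule plancherel_truncated[of _ n];
      simp add: truncate_cell_def[of n f] truncate_cell_L2 truncate_cell_integrable assms)+

lemma truncate_cell_norm_le:
  assumes "f \<in> L2_space"
  shows "L2_norm (truncate_cell n f) \<le> L2_norm f"
  unfolding L2_norm_def using L2_space_integrable[OF assms] L2_space_integrable[OF truncate_cell_L2[OF assms]]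
  by (intro real_sqrt_le_mono integral_mono) (auto simp: truncate_cell_def)

text \<open>
  The transforms of the truncations converge pointwise, by dominated convergence, because \<open>f\<close> is
  integrable. With this inequality applied to the error of the truncation, the convergence also holds
  in \<open>L\<^sup>2\<close>, and the inequality becomes an equality below.
\<close>

lemma plancherel_L1_L2_le:
  assumes f: "f \<in> L2_space" "integrable lebesgue f"
  shows "fourier_L1 f \<in> L2_space" "L2_norm (fourier_L1 f) \<le> L2_norm f"
proof -
  have "(\<lambda>n. fourier_L1 (truncate_cell n f) \<omega>) \<longlonglongrightarrow> fourier_L1 f \<omega>" for \<omega>
    unfolding fourier_L1_eq
  proof (rule integral_dominated_convergence[where w = "\<lambda>x. norm (f x)"])
    show "AE x in lebesgue. (\<lambda>n. truncate_cell n f x * cnj (chr \<omega> x)) \<longlonglongrightarrow> f x * cnj (chr \<omega> x)"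
      by (intro always_eventually allI tendsto_mult truncate_cell_tendsto tendsto_const)
    show "(\<lambda>x. truncate_cell n f x * cnj (chr \<omega> x)) \<in> borel_measurable lebesgue" for n
      by (rule borel_measurable_integrable[OF fourier_L1_integrable[OF truncate_cell_integrable[OF f(1)]]])
    show "AE x in lebesgue. norm (truncate_cell n f x * cnj (chr \<omega> x)) \<le> norm (f x)" for n
      by (auto simp: truncate_cell_def norm_mult)
  qed (use f borel_measurable_integrable[OF fourier_L1_integrable[OF f(2)]] in auto)
  then have lim: "AE \<omega> in lebesgue. (\<lambda>n. fourier_L1 (truncate_cell n f) \<omega>) \<longlonglongrightarrow> fourier_L1 f \<omega>" by simp
  have ev: "eventually (\<lambda>n. L2_norm (fourier_L1 (truncate_cell n f)) \<le> L2_norm f) sequentially"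
    by (simp add: plancherel_truncate_cell[OF f(1)] truncate_cell_norm_le[OF f(1)])
  show "fourier_L1 f \<in> L2_space" "L2_norm (fourier_L1 f) \<le> L2_norm f"
    using L2_Fatou[OF plancherel_truncate_cell(1)[OF f(1)] fourier_L1_measurable[OF f(2)] lim ev] by auto
qed

lemma plancherel_L1_L2:
  assumes f: "f \<in> L2_space" "integrable lebesgue f"
  shows "L2_norm (fourier_L1 f) = L2_norm f"
proof -
  let ?t = "\<lambda>n. truncate_cell n f"
  have "L2_norm (\<lambda>\<omega>. fourier_L1 (?t n) \<omega> - fourier_L1 f \<omega>) \<le> L2_norm (\<lambda>x. ?t n x - f x)" for n
  proof -
    have "L2_norm (fourier_L1 (\<lambda>x. ?t n x - f x)) \<le> L2_norm (\<lambda>x. ?t n x - f x)"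
      by (intro plancherel_L1_L2_le L2_diff truncate_cell_L2 Bochner_Integration.integrable_diff truncate_cell_integrable f)
    moreover have "fourier_L1 (\<lambda>x. ?t n x - f x) = (\<lambda>\<omega>. fourier_L1 (?t n) \<omega> - fourier_L1 f \<omega>)"
      by (rule ext) (intro fourier_L1_diff truncate_cell_integrable f)
    ultimately show ?thesis by simp
  qed
  then have "(\<lambda>n. L2_norm (\<lambda>\<omega>. fourier_L1 (?t n) \<omega> - fourier_L1 f \<omega>)) \<longlonglongrightarrow> 0"
    by (intro Lim_null_comparison[OF _ truncate_cell_norm_tendsto[OF f(1)]] always_eventually allI)
      (simp add: real_norm_def)
  then have "(\<lambda>n. L2_norm (fourier_L1 (?t n))) \<longlonglongrightarrow> L2_norm (fourier_L1 f)"
    by (intro L2_norm_tendsto plancherel_truncate_cell(1) plancherel_L1_L2_le f)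
  moreover have "(\<lambda>n. L2_norm (?t n)) \<longlonglongrightarrow> L2_norm f"
    by (intro L2_norm_tendsto truncate_cell_L2 truncate_cell_norm_tendsto f)
  ultimately show ?thesis
    unfolding plancherel_truncate_cell(2)[OF f(1)] by (rule LIMSEQ_unique)
qed

section \<open>The Fourier transform on \<open>L\<^sup>2\<close>\<close>

text \<open>
  The relation from which \<open>fourier_L2\<close> chooses a representative. Working with the relation makes
  linearity, isometry and the behaviour under translations consequences of the same
  properties of \<open>fourier_L1\<close>, and its uniqueness transfers them to the chosen representative.
\<close>

definition fourier_limit :: "(real^'d \<Rightarrow> complex) \<Rightarrow> (real^'d \<Rightarrow> complex) \<Rightarrow> bool"
  where "fourier_limit f g \<longleftrightarrow> g \<in> L2_space \<and>
    (\<exists>h :: nat \<Rightarrow> real^'d \<Rightarrow> complex.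
       (\<forall>n. h n \<in> L1_space \<inter> L2_space \<and> fourier_L1 (h n) \<in> L2_space) \<and>
       (\<lambda>n. L2_norm (\<lambda>x. h n x - f x)) \<longlonglongrightarrow> 0 \<and>
       (\<lambda>n. L2_norm (\<lambda>\<omega>. fourier_L1 (h n) \<omega> - g \<omega>)) \<longlonglongrightarrow> 0)"

lemma fourier_limitI:
  assumes "g \<in> L2_space" "\<And>n. h n \<in> L2_space" "\<And>n. integrable lebesgue (h n)"
    "(\<lambda>n. L2_norm (\<lambda>x. h n x - f x)) \<longlonglongrightarrow> 0"
    "(\<lambda>n. L2_norm (\<lambda>\<omega>. fourier_L1 (h n) \<omega> - g \<omega>)) \<longlonglongrightarrow> 0"
  shows "fourier_limit f g"
  unfolding fourier_limit_def
proof (intro conjI exI[of _ h] allI)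
  show "h n \<in> L1_space \<inter> L2_space" for n using assms by (simp add: L1_space_def)
  show "fourier_L1 (h n) \<in> L2_space" for n by (rule plancherel_L1_L2_le(1)[OF assms(2,3)])
qed (use assms in auto)

lemma fourier_limitE:
  assumes "fourier_limit f g"
  obtains h where "g \<in> L2_space" "\<And>n. h n \<in> L2_space" "\<And>n. integrable lebesgue (h n)"
    "(\<lambda>n. L2_norm (\<lambda>x. h n x - f x)) \<longlonglongrightarrow> 0"
    "(\<lambda>n. L2_norm (\<lambda>\<omega>. fourier_L1 (h n) \<omega> - g \<omega>)) \<longlonglongrightarrow> 0"
  using assms by (auto simp: fourier_limit_def L1_space_def)

lemma fourier_limit_exists:
  assumes f: "f \<in> L2_space"
  shows "\<exists>g. fourier_limit f g"
proof -
  let ?t = "\<lambda>n. truncate_cell n f"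
  have t: "?t n \<in> L2_space" "integrable lebesgue (?t n)" for n
    by (rule truncate_cell_L2[OF f], rule truncate_cell_integrable[OF f])
  have iso: "L2_norm (\<lambda>\<omega>. fourier_L1 (?t m) \<omega> - fourier_L1 (?t n) \<omega>) = L2_norm (\<lambda>x. ?t m x - ?t n x)" for m n
  proof -
    have "L2_norm (fourier_L1 (\<lambda>x. ?t m x - ?t n x)) = L2_norm (\<lambda>x. ?t m x - ?t n x)"
      by (intro plancherel_L1_L2 L2_diff Bochner_Integration.integrable_diff t)
    moreover have "fourier_L1 (\<lambda>x. ?t m x - ?t n x) = (\<lambda>\<omega>. fourier_L1 (?t m) \<omega> - fourier_L1 (?t n) \<omega>)"
      by (rule ext) (intro fourier_L1_diff t)
    ultimately show ?thesis by simp
  qed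
  have Cauchy: "\<exists>N. \<forall>m\<ge>N. \<forall>n\<ge>N. L2_norm (\<lambda>\<omega>. fourier_L1 (?t m) \<omega> - fourier_L1 (?t n) \<omega>) < e" if e: "e > 0" for e
  proof -
    obtain N where N: "\<And>n. n \<ge> N \<Longrightarrow> L2_norm (\<lambda>x. ?t n x - f x) < e / 2"
      using LIMSEQ_D[OF truncate_cell_norm_tendsto[OF f], of "e/2"] e by auto
    have "L2_norm (\<lambda>x. ?t m x - ?t n x) < e" if "m \<ge> N" "n \<ge> N" for m n
    proof -
      have "L2_norm (\<lambda>x. ?t m x - ?t n x) \<le> L2_norm (\<lambda>x. ?t m x - f x) + L2_norm (\<lambda>x. f x - ?t n x)"
        by (rule L2_norm_triangle_diff[OF t(1) f t(1)])
      then show ?thesis using N[OF that(1)] N[OF that(2)] L2_norm_minus_commute[of f "?t n"] by linarith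
    qed
    then show ?thesis unfolding iso by blast
  qed
  obtain g where "g \<in> L2_space" "(\<lambda>n. L2_norm (\<lambda>\<omega>. fourier_L1 (?t n) \<omega> - g \<omega>)) \<longlonglongrightarrow> 0"
    using L2_complete[OF plancherel_truncate_cell(1)[OF f] Cauchy] by blast
  then have "fourier_limit f g"
    by (intro fourier_limitI[of g ?t] t truncate_cell_norm_tendsto f)
  then show ?thesis by blast
qed

lemma fourier_L2_limit:
  assumes "f \<in> L2_space" shows "fourier_limit f (fourier_L2 f)"
  using someI_ex[OF fourier_limit_exists[OF assms]]
  unfolding fourier_L2_def fourier_limit_def by simp

lemma fourier_L2_in_L2: "f \<in> L2_space \<Longrightarrow> fourier_L2 f \<in> L2_space"
  using fourier_L2_limit by (auto simp: fourier_limit_def)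

lemma fourier_limit_norm:
  assumes "fourier_limit f g" "f \<in> L2_space"
  shows "L2_norm g = L2_norm f"
proof -
  obtain h where h: "g \<in> L2_space" "\<And>n. h n \<in> L2_space" "\<And>n. integrable lebesgue (h n)"
    "(\<lambda>n. L2_norm (\<lambda>x. h n x - f x)) \<longlonglongrightarrow> 0"
    "(\<lambda>n. L2_norm (\<lambda>\<omega>. fourier_L1 (h n) \<omega> - g \<omega>)) \<longlonglongrightarrow> 0"
    by (rule fourier_limitE[OF assms(1)]) (rule that)
  have "(\<lambda>n. L2_norm (fourier_L1 (h n))) \<longlonglongrightarrow> L2_norm g"
    by (rule L2_norm_tendsto[OF plancherel_L1_L2_le(1)[OF h(2,3)] h(1,5)])
  moreover have "(\<lambda>n. L2_norm (h n)) \<longlonglongrightarrow> L2_norm f"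
    by (rule L2_norm_tendsto[OF h(2) assms(2) h(4)])
  ultimately show ?thesis unfolding plancherel_L1_L2[OF h(2,3)] by (rule LIMSEQ_unique)
qed

lemma fourier_limit_lincomb:
  assumes "fourier_limit f g" "f \<in> L2_space" "fourier_limit f' g'" "f' \<in> L2_space"
  shows "fourier_limit (\<lambda>x. f x + c * f' x) (\<lambda>\<omega>. g \<omega> + c * g' \<omega>)"
proof -
  obtain h where h: "g \<in> L2_space" "\<And>n. h n \<in> L2_space" "\<And>n. integrable lebesgue (h n)"
    "(\<lambda>n. L2_norm (\<lambda>x. h n x - f x)) \<longlonglongrightarrow> 0"
    "(\<lambda>n. L2_norm (\<lambda>\<omega>. fourier_L1 (h n) \<omega> - g \<omega>)) \<longlonglongrightarrow> 0"
    by (rule fourier_limitE[OF assms(1)]) (rule that)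
  obtain k where k: "g' \<in> L2_space" "\<And>n. k n \<in> L2_space" "\<And>n. integrable lebesgue (k n)"
    "(\<lambda>n. L2_norm (\<lambda>x. k n x - f' x)) \<longlonglongrightarrow> 0"
    "(\<lambda>n. L2_norm (\<lambda>\<omega>. fourier_L1 (k n) \<omega> - g' \<omega>)) \<longlonglongrightarrow> 0"
    by (rule fourier_limitE[OF assms(3)]) (rule that)
  have est: "(\<lambda>n. L2_norm (\<lambda>x. (a n x + c * b n x) - (p x + c * q x))) \<longlonglongrightarrow> 0"
    if L: "\<And>n. a n \<in> L2_space" "\<And>n. b n \<in> L2_space" "p \<in> L2_space" "q \<in> L2_space"
      and lim: "(\<lambda>n. L2_norm (\<lambda>x. a n x - p x)) \<longlonglongrightarrow> 0" "(\<lambda>n. L2_norm (\<lambda>x. b n x - q x)) \<longlonglongrightarrow> 0"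
    for a b :: "nat \<Rightarrow> real^'a \<Rightarrow> complex" and p q
  proof (rule Lim_null_comparison)
    have "L2_norm (\<lambda>x. (a n x + c * b n x) - (p x + c * q x)) \<le>
        L2_norm (\<lambda>x. a n x - p x) + cmod c * L2_norm (\<lambda>x. b n x - q x)" for n
    proof -
      have "L2_norm (\<lambda>x. (a n x - p x) + c * (b n x - q x)) \<le>
          L2_norm (\<lambda>x. a n x - p x) + L2_norm (\<lambda>x. c * (b n x - q x))"
        by (intro L2_norm_triangle L2_diff L2_cmult L)
      moreover have "(\<lambda>x. (a n x - p x) + c * (b n x - q x)) = (\<lambda>x. (a n x + c * b n x) - (p x + c * q x))"
        by (auto simp: algebra_simps)
      ultimately show ?thesis by (simp only: L2_norm_cmult)
    qed
    then show "eventually (\<lambda>n. norm (L2_norm (\<lambda>x. (a n x + c * b n x) - (p x + c * q x))) \<le>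
        L2_norm (\<lambda>x. a n x - p x) + cmod c * L2_norm (\<lambda>x. b n x - q x)) sequentially" by simp
    have "(\<lambda>n. L2_norm (\<lambda>x. a n x - p x) + cmod c * L2_norm (\<lambda>x. b n x - q x)) \<longlonglongrightarrow> 0 + cmod c * 0"
      by (intro tendsto_add tendsto_mult lim tendsto_const)
    then show "(\<lambda>n. L2_norm (\<lambda>x. a n x - p x) + cmod c * L2_norm (\<lambda>x. b n x - q x)) \<longlonglongrightarrow> 0" by simp
  qed
  have F: "fourier_L1 (\<lambda>x. h n x + c * k n x) = (\<lambda>\<omega>. fourier_L1 (h n) \<omega> + c * fourier_L1 (k n) \<omega>)" for n
    by (rule ext) (simp add: fourier_L1_add h(3) k(3) fourier_L1_cmult)
  show ?thesis
  proof (rule fourier_limitI[where h = "\<lambda>n x. h n x + c * k n x"])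
    show "(\<lambda>n. L2_norm (\<lambda>x. h n x + c * k n x - (f x + c * f' x))) \<longlonglongrightarrow> 0"
      by (rule est[OF h(2) k(2) assms(2,4) h(4) k(4)])
    show "(\<lambda>n. L2_norm (\<lambda>\<omega>. fourier_L1 (\<lambda>x. h n x + c * k n x) \<omega> - (g \<omega> + c * g' \<omega>))) \<longlonglongrightarrow> 0"
      unfolding F by (rule est[OF plancherel_L1_L2_le(1)[OF h(2,3)] plancherel_L1_L2_le(1)[OF k(2,3)] h(1) k(1) h(5) k(5)])
  qed (auto intro!: L2_add L2_cmult h k)
qed

text \<open>
  The difference of two limits is a limit for the difference of the two functions, so by isometry its
  norm is zero.
\<close>

lemma fourier_limit_unique:
  assumes "fourier_limit f g" "fourier_limit f' g'" "f \<in> L2_space" "f' \<in> L2_space"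
    "AE x in lebesgue. f x = f' x"
  shows "AE \<omega> in lebesgue. g \<omega> = g' \<omega>"
proof -
  have L: "g \<in> L2_space" "g' \<in> L2_space" using assms by (auto simp: fourier_limit_def)
  have "L2_norm (\<lambda>\<omega>. g \<omega> + (- 1) * g' \<omega>) = L2_norm (\<lambda>x. f x + (- 1) * f' x)"
    by (intro fourier_limit_norm fourier_limit_lincomb assms L2_add L2_cmult)
  also have "\<dots> = 0"
  proof -
    have "(\<lambda>x. f x + (- 1) * f' x) \<in> L2_space" by (intro L2_add L2_cmult assms)
    moreover have "AE x in lebesgue. f x + (- 1) * f' x = 0" using assms(5) by eventually_elim simp
    ultimately show ?thesis using L2_norm_zero_iff by blast
  qed
  finally have "L2_norm (\<lambda>\<omega>. g \<omega> + (- 1) * g' \<omega>) = 0" .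
  moreover have "(\<lambda>\<omega>. g \<omega> + (- 1) * g' \<omega>) \<in> L2_space" by (intro L2_add L2_cmult L)
  ultimately have "AE \<omega> in lebesgue. g \<omega> + (- 1) * g' \<omega> = 0" using L2_norm_zero_iff by blast
  then show ?thesis by eventually_elim simp
qed

lemma fourier_L2_unique:
  "fourier_limit f g \<Longrightarrow> f \<in> L2_space \<Longrightarrow> AE \<omega> in lebesgue. fourier_L2 f \<omega> = g \<omega>"
  by (rule fourier_limit_unique[OF fourier_L2_limit]) auto

lemma fourier_L2_norm: "f \<in> L2_space \<Longrightarrow> L2_norm (fourier_L2 f) = L2_norm f"
  by (rule fourier_limit_norm[OF fourier_L2_limit])

lemma fourier_L2_lincomb:
  assumes "f \<in> L2_space" "g \<in> L2_space"
  shows "AE \<omega> in lebesgue. fourier_L2 (\<lambda>x. f x + c * g x) \<omega> = fourier_L2 f \<omega> + c * fourier_L2 g \<omega>"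
  by (rule fourier_L2_unique) (intro fourier_limit_lincomb fourier_L2_limit assms L2_add L2_cmult)+

lemma fourier_L2_zero: "AE \<omega> in lebesgue. fourier_L2 (\<lambda>x. 0) \<omega> = 0"
  by (rule fourier_L2_unique[OF _ L2_zero])
    (rule fourier_limitI[where h = "\<lambda>n x. 0"]; simp add: L2_zero L2_norm_def fourier_L1_def)

lemma fourier_L2_add:
  assumes "f \<in> L2_space" "g \<in> L2_space"
  shows "AE \<omega> in lebesgue. fourier_L2 (\<lambda>x. f x + g x) \<omega> = fourier_L2 f \<omega> + fourier_L2 g \<omega>"
  using fourier_L2_lincomb[OF assms, of 1] by simp

lemma fourier_L2_diff:
  assumes "f \<in> L2_space" "g \<in> L2_space"
  shows "AE \<omega> in lebesgue. fourier_L2 (\<lambda>x. f x - g x) \<omega> = fourier_L2 f \<omega> - fourier_L2 g \<omega>"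
  using fourier_L2_lincomb[OF assms, of "-1"] by simp

lemma fourier_L2_cmult:
  assumes "f \<in> L2_space"
  shows "AE \<omega> in lebesgue. fourier_L2 (\<lambda>x. c * f x) \<omega> = c * fourier_L2 f \<omega>"
  using fourier_L2_lincomb[OF L2_zero assms, of c] fourier_L2_zero by eventually_elim simp

text \<open>
  Polarization: the values \<open>c = 0, 1, -1, \<i>, -\<i>\<close> suffice.
\<close>

lemma L2_inner_eq_if_norms_eq:
  assumes L: "f \<in> L2_space" "g \<in> L2_space" "f' \<in> L2_space" "g' \<in> L2_space"
    and n: "\<And>c. L2_norm (\<lambda>x. f' x + c * g' x) = L2_norm (\<lambda>x. f x + c * g x)"
  shows "L2_inner f' g' = L2_inner f g"
proof -
  have eq: "(L2_norm f')\<^sup>2 + 2 * Re (cnj c * L2_inner f' g') + (cmod c * L2_norm g')\<^sup>2 =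
      (L2_norm f)\<^sup>2 + 2 * Re (cnj c * L2_inner f g) + (cmod c * L2_norm g)\<^sup>2" for c
    using arg_cong[OF n[of c], of "\<lambda>t. t\<^sup>2"]
    unfolding L2_norm_add_sq[OF L(1) L2_cmult[OF L(2)]] L2_norm_add_sq[OF L(3) L2_cmult[OF L(4)]]
      L2_inner_cmult_right L2_norm_cmult .
  have "(L2_norm f')\<^sup>2 = (L2_norm f)\<^sup>2" using eq[of 0] by simp
  with eq[of 1] eq[of "-1"] eq[of \<i>] eq[of "-\<i>"] show ?thesis
    by (simp add: complex_eq_iff)
qed

theorem fourier_L2_inner:
  assumes "f \<in> L2_space" "g \<in> L2_space"
  shows "L2_inner (fourier_L2 f) (fourier_L2 g) = L2_inner f g"
proof (rule L2_inner_eq_if_norms_eq[OF assms assms[THEN fourier_L2_in_L2]])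
  fix c
  show "L2_norm (\<lambda>\<omega>. fourier_L2 f \<omega> + c * fourier_L2 g \<omega>) = L2_norm (\<lambda>x. f x + c * g x)"
    by (rule fourier_limit_norm) (intro fourier_limit_lincomb fourier_L2_limit assms L2_add L2_cmult)+
qed

lemma translation_L2:
  assumes "f \<in> L2_space" shows "translation t f \<in> L2_space"
proof -
  have m: "translation t f \<in> borel_measurable lebesgue"
    using measurable_translation[OF L2_space_measurable[OF assms], of "- t"] by (simp add: translation_def)
  have "integrable lebesgue (\<lambda>x. (cmod (translation t f x))\<^sup>2)"
    using integrable_translation[OF L2_space_integrable[OF assms], of "- t"] by (simp add: translation_def)
  with m show ?thesis by (simp add: L2_space_def)
qed

lemma translation_norm:
  assumes "f \<in> L2_space" shows "L2_norm (translation t f) = L2_norm f"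
  using integral_translation[of "\<lambda>x. (cmod (f x))\<^sup>2" "- t"] borel_measurable_integrable[OF L2_space_integrable[OF assms]]
  by (simp add: L2_norm_def translation_def)

lemma translation_integrable:
  "integrable lebesgue f \<Longrightarrow> integrable lebesgue (translation t f)"
  using integrable_translation[of f "- t"] by (simp add: translation_def)

lemma L2_cnj_chr_mult: "f \<in> L2_space \<Longrightarrow> (\<lambda>\<omega>. cnj (chr t \<omega>) * f \<omega>) \<in> L2_space"
  using L2_bounded_mult[of f "chr (- t)" 1] by (simp add: chr_minus_left)

lemma L2_chr_mult: "f \<in> L2_space \<Longrightarrow> (\<lambda>\<omega>. chr t \<omega> * f \<omega>) \<in> L2_space"
  using L2_bounded_mult[of f "chr t" 1] by simp

lemma L2_norm_chr_mult: "L2_norm (\<lambda>\<omega>. cnj (chr t \<omega>) * f \<omega>) = L2_norm f"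
  by (simp add: L2_norm_def norm_mult)

lemma fourier_L1_translation:
  assumes "integrable lebesgue f"
  shows "fourier_L1 (translation t f) \<omega> = cnj (chr t \<omega>) * fourier_L1 f \<omega>"
proof -
  have "fourier_L1 (translation t f) \<omega> = (LINT x|lebesgue. translation t f (x + t) * cnj (chr \<omega> (x + t)))"
    unfolding fourier_L1_eq
    by (rule integral_translation[symmetric])
      (rule borel_measurable_integrable[OF fourier_L1_integrable[OF translation_integrable[OF assms]]])
  also have "\<dots> = (LINT x|lebesgue. cnj (chr t \<omega>) * (f x * cnj (chr \<omega> x)))"
    by (intro Bochner_Integration.integral_cong) (auto simp: translation_def chr_add_right chr_commute[of \<omega> t])
  finally show ?thesis by (simp add: fourier_L1_eq)
qed

theorem fourier_L2_translation:
  assumes f: "f \<in> L2_space"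
  shows "AE \<omega> in lebesgue. fourier_L2 (translation t f) \<omega> = cnj (chr t \<omega>) * fourier_L2 f \<omega>"
proof (rule fourier_L2_unique[OF _ translation_L2[OF f]])
  obtain h where h: "fourier_L2 f \<in> L2_space" "\<And>n. h n \<in> L2_space" "\<And>n. integrable lebesgue (h n)"
    "(\<lambda>n. L2_norm (\<lambda>x. h n x - f x)) \<longlonglongrightarrow> 0"
    "(\<lambda>n. L2_norm (\<lambda>\<omega>. fourier_L1 (h n) \<omega> - fourier_L2 f \<omega>)) \<longlonglongrightarrow> 0"
    by (rule fourier_limitE[OF fourier_L2_limit[OF f]]) (rule that)
  show "fourier_limit (translation t f) (\<lambda>\<omega>. cnj (chr t \<omega>) * fourier_L2 f \<omega>)"
  proof (rule fourier_limitI[where h = "\<lambda>n. translation t (h n)"])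
    have "L2_norm (\<lambda>x. translation t (h n) x - translation t f x) = L2_norm (\<lambda>x. h n x - f x)" for n
      using translation_norm[OF L2_diff[OF h(2) f], of t n] by (simp add: translation_def)
    then show "(\<lambda>n. L2_norm (\<lambda>x. translation t (h n) x - translation t f x)) \<longlonglongrightarrow> 0" using h(4) by simp
    have "L2_norm (\<lambda>\<omega>. fourier_L1 (translation t (h n)) \<omega> - cnj (chr t \<omega>) * fourier_L2 f \<omega>) =
        L2_norm (\<lambda>\<omega>. fourier_L1 (h n) \<omega> - fourier_L2 f \<omega>)" for n
      using L2_norm_chr_mult[of t "\<lambda>\<omega>. fourier_L1 (h n) \<omega> - fourier_L2 f \<omega>"]
      by (simp add: fourier_L1_translation[OF h(3)] right_diff_distrib)
    then show "(\<lambda>n. L2_norm (\<lambda>\<omega>. fourier_L1 (translation t (h n)) \<omega> - cnj (chr t \<omega>) * fourier_L2 f \<omega>)) \<longlonglongrightarrow> 0"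
      using h(5) by simp
  qed (auto intro!: L2_cnj_chr_mult translation_L2 translation_integrable h)
qed

lemma fourier_L2_eq_L1:
  assumes "f \<in> L2_space" "integrable lebesgue f"
  shows "AE \<omega> in lebesgue. fourier_L2 f \<omega> = fourier_L1 f \<omega>"
  by (rule fourier_L2_unique[OF _ assms(1)])
    (rule fourier_limitI[where h = "\<lambda>n. f"]; simp add: assms plancherel_L1_L2_le L2_norm_def)

lemma fourier_L1_modulation: "fourier_L1 (\<lambda>x. chr t x * f x) \<omega> = fourier_L1 f (\<omega> - t)"
  unfolding fourier_L1_eq by (simp add: chr_diff_left mult_ac)

text \<open>
  By isometry the range is closed, so it suffices that a function \<open>u\<close> orthogonal to the range vanishes.
  The range is invariant under multiplication by characters, whence \<open>u * cnj B\<close> has zero Fourier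
  transform and vanishes a.e. for each \<open>B\<close> in the range. For \<open>B\<close> take the transform of the indicator of
  the unit cell. It is continuous with value 1 at 0, and its translates, which are transforms of modulated
  indicators, lie in the range as well. Countably many of them have no common zero.
\<close>

theorem fourier_L2_surj:
  fixes g :: "real^'d \<Rightarrow> complex"
  assumes g: "g \<in> L2_space"
  obtains f where "f \<in> L2_space" "AE \<omega> in lebesgue. fourier_L2 f \<omega> = g \<omega>"
proof -
  define R where "R = {g :: real^'d \<Rightarrow> complex. g \<in> L2_space \<and> (\<exists>f\<in>L2_space. AE \<omega> in lebesgue. fourier_L2 f \<omega> = g \<omega>)}"
  have mem: "g \<in> R" if "g \<in> L2_space" "f \<in> L2_space" "AE \<omega> in lebesgue. fourier_L2 f \<omega> = g \<omega>" for f g :: "real^'d \<Rightarrow> complex"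
    using that unfolding R_def by blast
  have subR: "closed_L2_subspace R"
    unfolding closed_L2_subspace_def
  proof (intro conjI ballI allI subsetI)
    show "g \<in> L2_space" if "g \<in> R" for g using that by (simp add: R_def)
    show "(\<lambda>x. 0) \<in> R" by (rule mem[OF L2_zero L2_zero fourier_L2_zero])
    fix g assume "g \<in> R"
    then obtain f where f: "g \<in> L2_space" "f \<in> L2_space" "AE \<omega> in lebesgue. fourier_L2 f \<omega> = g \<omega>" unfolding R_def by blast
    show "(\<lambda>x. c * g x) \<in> R" for c
    proof (rule mem[OF L2_cmult[OF f(1)] L2_cmult[OF f(2)]])
      show "AE \<omega> in lebesgue. fourier_L2 (\<lambda>x. c * f x) \<omega> = c * g \<omega>"
        using fourier_L2_cmult[OF f(2), of c] f(3) by eventually_elim simp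
    qed
    fix g' assume "g' \<in> R"
    then obtain f' where f': "g' \<in> L2_space" "f' \<in> L2_space" "AE \<omega> in lebesgue. fourier_L2 f' \<omega> = g' \<omega>" unfolding R_def by blast
    show "(\<lambda>x. g x + g' x) \<in> R"
    proof (rule mem[OF L2_add[OF f(1) f'(1)] L2_add[OF f(2) f'(2)]])
      show "AE \<omega> in lebesgue. fourier_L2 (\<lambda>x. f x + f' x) \<omega> = g \<omega> + g' \<omega>"
        using fourier_L2_add[OF f(2) f'(2)] f(3) f'(3) by eventually_elim simp
    qed
  next
    fix g assume g: "g \<in> L2_closure R"
    have gL: "g \<in> L2_space" using g by (simp add: L2_closure_def)
    obtain G where G: "\<And>n. G n \<in> R" "(\<lambda>n. L2_norm (\<lambda>x. G n x - g x)) \<longlonglongrightarrow> 0"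
      using L2_closureE_seq[OF g] by blast
    have "\<forall>n. \<exists>f. G n \<in> L2_space \<and> f \<in> L2_space \<and> (AE \<omega> in lebesgue. fourier_L2 f \<omega> = G n \<omega>)"
      using G(1) unfolding R_def by blast
    then obtain f where "\<forall>n. G n \<in> L2_space \<and> f n \<in> L2_space \<and> (AE \<omega> in lebesgue. fourier_L2 (f n) \<omega> = G n \<omega>)"
      by (rule choice[THEN exE])
    then have f: "\<And>n. G n \<in> L2_space" "\<And>n. f n \<in> L2_space" "\<And>n. AE \<omega> in lebesgue. fourier_L2 (f n) \<omega> = G n \<omega>"
      by blast+
    \<comment> \<open>Stated for preimages \<open>u\<close>, \<open>v\<close> of \<open>a\<close>, \<open>b\<close>, so that it applies to the approximating
        sequence and to its limit.\<close>
    have iso: "L2_norm (\<lambda>x. u x - v x) = L2_norm (\<lambda>x. a x - b x)"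
      if "u \<in> L2_space" "v \<in> L2_space" "a \<in> L2_space" "b \<in> L2_space"
        "AE \<omega> in lebesgue. fourier_L2 u \<omega> = a \<omega>" "AE \<omega> in lebesgue. fourier_L2 v \<omega> = b \<omega>"
      for u v a b :: "real^'d \<Rightarrow> complex"
    proof -
      have "AE \<omega> in lebesgue. fourier_L2 (\<lambda>x. u x - v x) \<omega> = a \<omega> - b \<omega>"
        using fourier_L2_diff[OF that(1,2)] that(5,6) by eventually_elim simp
      then have "L2_norm (fourier_L2 (\<lambda>x. u x - v x)) = L2_norm (\<lambda>x. a x - b x)"
        by (rule L2_norm_cong_AE) (intro L2_space_measurable fourier_L2_in_L2 L2_diff that)+
      then show ?thesis using fourier_L2_norm[OF L2_diff[OF that(1,2)]] by simp
    qed
    have Cauchy: "\<exists>N. \<forall>m\<ge>N. \<forall>n\<ge>N. L2_norm (\<lambda>x. f m x - f n x) < e" if e: "e > 0" for e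
    proof -
      obtain N where N: "\<And>n. n \<ge> N \<Longrightarrow> L2_norm (\<lambda>x. G n x - g x) < e / 2"
        using LIMSEQ_D[OF G(2), of "e/2"] e by auto
      have "L2_norm (\<lambda>x. f m x - f n x) < e" if "m \<ge> N" "n \<ge> N" for m n
      proof -
        have "L2_norm (\<lambda>x. G m x - G n x) \<le> L2_norm (\<lambda>x. G m x - g x) + L2_norm (\<lambda>x. g x - G n x)"
          by (rule L2_norm_triangle_diff[OF f(1) gL f(1)])
        moreover have "L2_norm (\<lambda>x. f m x - f n x) = L2_norm (\<lambda>x. G m x - G n x)"
          by (rule iso[OF f(2) f(2) f(1) f(1) f(3) f(3)])
        ultimately show ?thesis
          using N[OF that(1)] N[OF that(2)] L2_norm_minus_commute[of g "G n"] by linarith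
      qed
      then show ?thesis by blast
    qed
    obtain F where F: "F \<in> L2_space" "(\<lambda>n. L2_norm (\<lambda>x. f n x - F x)) \<longlonglongrightarrow> 0"
      using L2_complete[OF f(2) Cauchy] by blast
    have FL: "fourier_L2 F \<in> L2_space" by (rule fourier_L2_in_L2[OF F(1)])
    have "L2_norm (\<lambda>x. fourier_L2 F x - g x) \<le> L2_norm (\<lambda>x. f n x - F x) + L2_norm (\<lambda>x. G n x - g x)" for n
    proof -
      have "L2_norm (\<lambda>x. f n x - F x) = L2_norm (\<lambda>x. G n x - fourier_L2 F x)"
        by (rule iso[OF f(2) F(1) f(1) FL f(3)]) simp
      then show ?thesis
        using L2_norm_triangle_diff[OF FL f(1) gL, of n] L2_norm_minus_commute[of "fourier_L2 F" "G n"] by simp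
    qed
    moreover have "(\<lambda>n. L2_norm (\<lambda>x. f n x - F x) + L2_norm (\<lambda>x. G n x - g x)) \<longlonglongrightarrow> 0 + 0"
      by (rule tendsto_add[OF F(2) G(2)])
    ultimately have "L2_norm (\<lambda>x. fourier_L2 F x - g x) \<le> 0 + 0"
      by (intro LIMSEQ_le_const) auto
    then have "L2_norm (\<lambda>x. fourier_L2 F x - g x) = 0" using L2_norm_nonneg[of "\<lambda>x. fourier_L2 F x - g x"] by linarith
    then have "AE x in lebesgue. fourier_L2 F x - g x = 0" using L2_norm_zero_iff[OF L2_diff[OF FL gL]] by blast
    then have "AE x in lebesgue. fourier_L2 F x = g x" by eventually_elim simp
    then show "g \<in> R" by (rule mem[OF gL F(1)])
  qed
  have "g \<in> R"
  proof (rule in_closed_L2_subspace_if_orthogonal[OF subR g])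
    fix u :: "real^'d \<Rightarrow> complex"
    assume u: "u \<in> L2_space" "\<And>v. v \<in> R \<Longrightarrow> L2_inner u v = 0"
    define b where "b = (indicator unit_cell :: real^'d \<Rightarrow> complex)"
    have b: "b \<in> L2_space" using tile_chr_L2[OF tile_unit_cell, of 0] by (simp add: b_def)
    have bi: "integrable lebesgue b" unfolding b_def by (rule integrable_indicator_unit_cell)
    define B where "B = fourier_L1 b"
    have B0: "B 0 = 1" by (simp add: B_def fourier_L1_eq b_def integral_unit_cell_one)
    have contB: "continuous_on UNIV B" unfolding B_def by (rule continuous_fourier_L1[OF bi])
    have zero: "AE \<omega> in lebesgue. u \<omega> * cnj (B (\<omega> - t)) = 0" for t
    proof (rule fourier_uniqueness)
      define bt where "bt x = chr t x * b x" for x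
      have bt: "bt \<in> L2_space" "integrable lebesgue bt"
        using L2_chr_mult[OF b] integrable_mult_chr[OF bi, of t] by (simp_all add: bt_def[abs_def] mult.commute)
      have BtB: "fourier_L1 bt \<omega> = B (\<omega> - t)" for \<omega>
        unfolding bt_def B_def by (rule fourier_L1_modulation)
      have BtL: "(\<lambda>\<omega>. B (\<omega> - t)) \<in> L2_space"
        using plancherel_L1_L2_le(1)[OF bt] by (simp add: BtB[symmetric])
      show "integrable lebesgue (\<lambda>\<omega>. u \<omega> * cnj (B (\<omega> - t)))" by (rule L2_inner_integrable[OF u(1) BtL])
      fix v
      have "(\<lambda>\<omega>. cnj (chr v \<omega>) * B (\<omega> - t)) \<in> R"
      proof (rule mem[OF L2_cnj_chr_mult[OF BtL] translation_L2[OF bt(1)]])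
        show "AE \<omega> in lebesgue. fourier_L2 (translation v bt) \<omega> = cnj (chr v \<omega>) * B (\<omega> - t)"
          using fourier_L2_translation[OF bt(1), of v] fourier_L2_eq_L1[OF bt] by eventually_elim (simp add: BtB)
      qed
      from u(2)[OF this] show "(LINT \<omega>|lebesgue. u \<omega> * cnj (B (\<omega> - t)) * chr v \<omega>) = 0"
        by (simp add: L2_inner_def mult_ac)
    qed
    have "open (B -` (- {0}))" using open_vimage[of "- {0}" B] contB by auto
    moreover have "0 \<in> B -` (- {0})" using B0 by simp
    ultimately have "\<exists>e>0. \<forall>y. dist y 0 < e \<longrightarrow> y \<in> B -` (- {0})"
      unfolding open_dist by blast
    then obtain e where e: "e > 0" "\<And>\<omega>. dist \<omega> 0 < e \<Longrightarrow> B \<omega> \<noteq> 0" by auto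
    \<comment> \<open>Translates of \<open>B\<close> by the points of a countable dense set: each point is within distance \<open>e\<close> of one of them.\<close>
    obtain D :: "(real^'d) set" where D: "countable D" "\<And>X. open X \<Longrightarrow> X \<noteq> {} \<Longrightarrow> \<exists>d\<in>D. d \<in> X"
      using countable_dense_setE by blast
    have "AE \<omega> in lebesgue. \<forall>t\<in>D. u \<omega> * cnj (B (\<omega> - t)) = 0"
      using zero by (intro AE_ball_countable[THEN iffD2] D) auto
    then have "AE \<omega> in lebesgue. u \<omega> = 0"
    proof eventually_elim
      case (elim \<omega>)
      obtain t where t: "t \<in> D" "t \<in> ball \<omega> e" using D(2)[of "ball \<omega> e"] e(1) by auto
      then have "dist (\<omega> - t) 0 < e" by (simp add: dist_norm)
      then have "B (\<omega> - t) \<noteq> 0" by (rule e(2))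
      moreover have "u \<omega> * cnj (B (\<omega> - t)) = 0" using elim t(1) by blast
      ultimately show ?case by simp
    qed
    then have "AE \<omega> in lebesgue. g \<omega> * cnj (u \<omega>) = 0" by eventually_elim simp
    then show "L2_inner g u = 0" unfolding L2_inner_def by (rule integral_eq_zero_AE)
  qed
  then show ?thesis using that unfolding R_def by blast
qed

section \<open>Paley--Wiener spaces\<close>

lemma L2_indicator_mult:
  assumes "f \<in> L2_space" "E \<in> sets lebesgue"
  shows "(\<lambda>x. indicator E x * f x) \<in> L2_space"
  by (rule L2_bounded_mult[OF assms(1), where C = 1]) (use assms in \<open>auto simp: indicator_def\<close>)

text \<open>
  For closedness, let \<open>w\<close> be the part of the transform of \<open>f\<close> outside \<open>\<Omega>\<close> and \<open>w'\<close> its preimage under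
  the transform. The members of the space are orthogonal to \<open>w'\<close>, hence so is \<open>f\<close>, which
  means that \<open>w\<close> is orthogonal to itself.
\<close>

lemma paley_wiener_closed:
  assumes \<Omega>: "\<Omega> \<in> sets lebesgue"
  shows "closed_L2_subspace (paley_wiener \<Omega>)"
  unfolding closed_L2_subspace_def
proof (intro conjI ballI allI subsetI)
  show L2: "f \<in> L2_space" if "f \<in> paley_wiener \<Omega>" for f
    using that by (simp add: paley_wiener_def)
  show "(\<lambda>x. 0) \<in> paley_wiener \<Omega>"
    using fourier_L2_zero by (auto simp: paley_wiener_def L2_zero elim: eventually_mono)
  fix f assume f: "f \<in> paley_wiener \<Omega>"
  then have f0: "AE \<omega> in lebesgue. \<omega> \<notin> \<Omega> \<longrightarrow> fourier_L2 f \<omega> = 0" by (simp add: paley_wiener_def)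
  show "(\<lambda>x. c * f x) \<in> paley_wiener \<Omega>" for c
  proof -
    have "AE \<omega> in lebesgue. \<omega> \<notin> \<Omega> \<longrightarrow> fourier_L2 (\<lambda>x. c * f x) \<omega> = 0"
      using f0 fourier_L2_cmult[OF L2[OF f], of c] by eventually_elim simp
    then show ?thesis by (simp add: paley_wiener_def L2_cmult L2[OF f])
  qed
  fix g assume g: "g \<in> paley_wiener \<Omega>"
  then have g0: "AE \<omega> in lebesgue. \<omega> \<notin> \<Omega> \<longrightarrow> fourier_L2 g \<omega> = 0" by (simp add: paley_wiener_def)
  have "AE \<omega> in lebesgue. \<omega> \<notin> \<Omega> \<longrightarrow> fourier_L2 (\<lambda>x. f x + g x) \<omega> = 0"
    using f0 g0 fourier_L2_add[OF L2[OF f] L2[OF g]] by eventually_elim simp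
  then show "(\<lambda>x. f x + g x) \<in> paley_wiener \<Omega>" by (simp add: paley_wiener_def L2_add L2[OF f] L2[OF g])
next
  fix f assume f: "f \<in> L2_closure (paley_wiener \<Omega>)"
  have fL: "f \<in> L2_space" using f by (simp add: L2_closure_def)
  have FL: "fourier_L2 f \<in> L2_space" by (rule fourier_L2_in_L2[OF fL])
  define w where "w \<omega> = indicator (- \<Omega>) \<omega> * fourier_L2 f \<omega>" for \<omega>
  have w: "w \<in> L2_space" unfolding w_def by (rule L2_indicator_mult[OF FL]) (simp add: Compl_in_sets_lebesgue \<Omega>)
  obtain w' where w': "w' \<in> L2_space" "AE \<omega> in lebesgue. fourier_L2 w' \<omega> = w \<omega>"
    using fourier_L2_surj[OF w] .
  have inner: "L2_inner g w' = L2_inner (fourier_L2 g) w" if g: "g \<in> L2_space" for g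
  proof -
    have "L2_inner g w' = L2_inner (fourier_L2 g) (fourier_L2 w')" by (rule fourier_L2_inner[symmetric, OF g w'(1)])
    also have "\<dots> = L2_inner (fourier_L2 g) w"
      by (rule L2_inner_cong_AE) (use g w w' fourier_L2_in_L2 in auto)
    finally show ?thesis .
  qed
  have "paley_wiener \<Omega> \<subseteq> {f \<in> L2_space. L2_inner f w' = 0}"
  proof
    fix g assume g: "g \<in> paley_wiener \<Omega>"
    then have gL: "g \<in> L2_space" and g0: "AE \<omega> in lebesgue. \<omega> \<notin> \<Omega> \<longrightarrow> fourier_L2 g \<omega> = 0"
      by (simp_all add: paley_wiener_def)
    have "AE \<omega> in lebesgue. fourier_L2 g \<omega> * cnj (w \<omega>) = 0"
      using g0 by eventually_elim (auto simp: w_def indicator_def)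
    then have "L2_inner (fourier_L2 g) w = 0" unfolding L2_inner_def by (rule integral_eq_zero_AE)
    then show "g \<in> {f \<in> L2_space. L2_inner f w' = 0}" using gL inner[OF gL] by simp
  qed
  then have "f \<in> L2_closure {f \<in> L2_space. L2_inner f w' = 0}"
    using f unfolding L2_closure_def by blast
  then have "f \<in> {f \<in> L2_space. L2_inner f w' = 0}"
    by (rule closed_L2_subspaceD(6)[OF closed_L2_subspace_orthogonal[OF w'(1)]])
  then have "L2_inner (fourier_L2 f) w = 0" using inner[OF fL] by simp
  moreover have "L2_inner (fourier_L2 f) w = L2_inner w w"
    unfolding L2_inner_def by (intro Bochner_Integration.integral_cong) (auto simp: w_def indicator_def)
  ultimately have "L2_norm w = 0" using L2_inner_self[OF w] by simp
  then have "AE \<omega> in lebesgue. w \<omega> = 0" using L2_norm_zero_iff[OF w] by simp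
  then have "AE \<omega> in lebesgue. \<omega> \<notin> \<Omega> \<longrightarrow> fourier_L2 f \<omega> = 0"
    by eventually_elim (auto simp: w_def indicator_def split: if_splits)
  then show "f \<in> paley_wiener \<Omega>" by (simp add: paley_wiener_def fL)
qed

lemma paley_wiener_translation:
  assumes "f \<in> paley_wiener \<Omega>" shows "translation t f \<in> paley_wiener \<Omega>"
proof -
  have f: "f \<in> L2_space" "AE \<omega> in lebesgue. \<omega> \<notin> \<Omega> \<longrightarrow> fourier_L2 f \<omega> = 0"
    using assms by (simp_all add: paley_wiener_def)
  have "AE \<omega> in lebesgue. \<omega> \<notin> \<Omega> \<longrightarrow> fourier_L2 (translation t f) \<omega> = 0"
    using f(2) fourier_L2_translation[OF f(1), of t] by eventually_elim simp
  then show ?thesis by (simp add: paley_wiener_def translation_L2 f(1))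
qed

lemma L2_inner_eq_fourier_integral:
  assumes "f \<in> L2_space" "g \<in> L2_space"
    "AE \<omega> in lebesgue. fourier_L2 f \<omega> * cnj (fourier_L2 g \<omega>) = h \<omega>" "h \<in> borel_measurable lebesgue"
  shows "L2_inner f g = (LINT \<omega>|lebesgue. h \<omega>)"
proof -
  have "L2_inner f g = L2_inner (fourier_L2 f) (fourier_L2 g)" by (rule fourier_L2_inner[symmetric, OF assms(1,2)])
  also have "\<dots> = (LINT \<omega>|lebesgue. h \<omega>)"
    unfolding L2_inner_def
    by (intro integral_cong_AE assms borel_measurable_integrable[OF L2_inner_integrable] fourier_L2_in_L2)
  finally show ?thesis .
qed

lemma L2_inner_translation_right:
  assumes "f \<in> L2_space" "g \<in> L2_space"
  shows "L2_inner f (translation t g) = (LINT \<omega>|lebesgue. fourier_L2 f \<omega> * cnj (fourier_L2 g \<omega>) * chr t \<omega>)"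
proof (rule L2_inner_eq_fourier_integral[OF assms(1) translation_L2[OF assms(2)]])
  show "AE \<omega> in lebesgue. fourier_L2 f \<omega> * cnj (fourier_L2 (translation t g) \<omega>) =
      fourier_L2 f \<omega> * cnj (fourier_L2 g \<omega>) * chr t \<omega>"
    using fourier_L2_translation[OF assms(2), of t] by eventually_elim simp
  show "(\<lambda>\<omega>. fourier_L2 f \<omega> * cnj (fourier_L2 g \<omega>) * chr t \<omega>) \<in> borel_measurable lebesgue"
    by (intro borel_measurable_times chr_lebesgue borel_measurable_integrable[OF L2_inner_integrable]
        fourier_L2_in_L2 assms)
qed

lemma L2_inner_translation_left:
  assumes "f \<in> L2_space" "g \<in> L2_space"
  shows "L2_inner (translation t g) f = (LINT \<omega>|lebesgue. fourier_L2 g \<omega> * cnj (fourier_L2 f \<omega>) * chr (- t) \<omega>)"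
proof (rule L2_inner_eq_fourier_integral[OF translation_L2[OF assms(2)] assms(1)])
  show "AE \<omega> in lebesgue. fourier_L2 (translation t g) \<omega> * cnj (fourier_L2 f \<omega>) =
      fourier_L2 g \<omega> * cnj (fourier_L2 f \<omega>) * chr (- t) \<omega>"
    using fourier_L2_translation[OF assms(2), of t] by eventually_elim (simp add: chr_minus_left)
  show "(\<lambda>\<omega>. fourier_L2 g \<omega> * cnj (fourier_L2 f \<omega>) * chr (- t) \<omega>) \<in> borel_measurable lebesgue"
    by (intro borel_measurable_times chr_lebesgue borel_measurable_integrable[OF L2_inner_integrable]
        fourier_L2_in_L2 assms)
qed

lemma integer_shifts_L2:
  assumes "\<forall>j\<in>{1..l}. \<phi> j \<in> L2_space" "i \<in> shift_index l"
  shows "integer_shifts \<phi> i \<in> L2_space"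
  using assms by (auto simp: shift_index_def integer_shifts_def intro!: translation_L2)

text \<open>
  A case of Wiener's theorem on translation invariant subspaces of \<open>L\<^sup>2\<close>. Integer shifts generate the
  space, but by invariance a function orthogonal to it is orthogonal to all real
  translates of the generators, and these detect the product of the transforms completely.
\<close>

theorem translation_invariant_shift_space_eq_paley_wiener:
  fixes \<phi> :: "nat \<Rightarrow> real^'d \<Rightarrow> complex"
  assumes \<phi>: "\<forall>j\<in>{1..l}. \<phi> j \<in> L2_space" and ti: "translation_invariant (shift_space l \<phi>)"
  defines "\<Omega> \<equiv> {\<omega>. \<exists>j\<in>{1..l}. fourier_L2 (\<phi> j) \<omega> \<noteq> 0}"
  shows "\<Omega> \<in> sets lebesgue" "shift_space l \<phi> = paley_wiener \<Omega>"
proof -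
  have m: "fourier_L2 (\<phi> j) \<in> borel_measurable lebesgue" if "j \<in> {1..l}" for j
    using \<phi> that by (intro L2_space_measurable fourier_L2_in_L2) auto
  have "{\<omega>. fourier_L2 (\<phi> j) \<omega> \<noteq> 0} \<in> sets lebesgue" if "j \<in> {1..l}" for j
    using measurable_sets[OF m[OF that], of "- {0}"] by (simp add: vimage_def)
  then have "(\<Union>j\<in>{1..l}. {\<omega>. fourier_L2 (\<phi> j) \<omega> \<noteq> 0}) \<in> sets lebesgue" by (intro sets.finite_UN) auto
  moreover have "(\<Union>j\<in>{1..l}. {\<omega>. fourier_L2 (\<phi> j) \<omega> \<noteq> 0}) = \<Omega>" by (auto simp: \<Omega>_def)
  ultimately show \<Omega>: "\<Omega> \<in> sets lebesgue" by simp
  have e: "integer_shifts \<phi> i \<in> L2_space" if "i \<in> shift_index l" for i by (rule integer_shifts_L2[OF \<phi> that])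
  have cl: "closed_L2_subspace (shift_space l \<phi>)" unfolding shift_space_def by (rule closed_span_subspace[OF e])
  have "\<phi> j \<in> paley_wiener \<Omega>" if "j \<in> {1..l}" for j
    using that \<phi> by (auto simp: paley_wiener_def \<Omega>_def)
  then have sub: "shift_space l \<phi> \<subseteq> paley_wiener \<Omega>"
    unfolding shift_space_def
    by (intro closed_span_minimal paley_wiener_closed \<Omega>)
      (auto simp: shift_index_def integer_shifts_def intro!: paley_wiener_translation)
  have "paley_wiener \<Omega> \<subseteq> shift_space l \<phi>"
  proof
    fix f assume f: "f \<in> paley_wiener \<Omega>"
    then have fL: "f \<in> L2_space" and f0: "AE \<omega> in lebesgue. \<omega> \<notin> \<Omega> \<longrightarrow> fourier_L2 f \<omega> = 0"
      by (simp_all add: paley_wiener_def)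
    show "f \<in> shift_space l \<phi>"
    proof (rule in_closed_L2_subspace_if_orthogonal[OF cl fL])
      fix g assume g: "g \<in> L2_space" "\<And>v. v \<in> shift_space l \<phi> \<Longrightarrow> L2_inner g v = 0"
      have "AE \<omega> in lebesgue. fourier_L2 g \<omega> * cnj (fourier_L2 (\<phi> j) \<omega>) = 0" if j: "j \<in> {1..l}" for j
      proof (rule fourier_uniqueness)
        have pj: "\<phi> j \<in> L2_space" using \<phi> j by blast
        show "integrable lebesgue (\<lambda>\<omega>. fourier_L2 g \<omega> * cnj (fourier_L2 (\<phi> j) \<omega>))"
          by (intro L2_inner_integrable fourier_L2_in_L2 g pj)
        have "(0, j) \<in> shift_index l" using j by (simp add: shift_index_def int_lattice_zero)
        from in_closed_span[of "(0, j)" "shift_index l" "integer_shifts \<phi>", OF this e[OF this]] have "\<phi> j \<in> shift_space l \<phi>"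
          by (simp add: integer_shifts_def translation_def shift_space_def)
        then have "translation t (\<phi> j) \<in> shift_space l \<phi>" for t
          using ti by (auto simp: translation_invariant_def)
        from g(2)[OF this] L2_inner_translation_right[OF g(1) pj]
        show "(LINT \<omega>|lebesgue. fourier_L2 g \<omega> * cnj (fourier_L2 (\<phi> j) \<omega>) * chr t \<omega>) = 0" for t by simp
      qed
      then have "AE \<omega> in lebesgue. \<forall>j\<in>{1..l}. fourier_L2 g \<omega> * cnj (fourier_L2 (\<phi> j) \<omega>) = 0"
        by (intro AE_ball_countable[THEN iffD2]) auto
      with f0 have "AE \<omega> in lebesgue. fourier_L2 f \<omega> * cnj (fourier_L2 g \<omega>) = 0"
        by eventually_elim (auto simp: \<Omega>_def)
      then show "L2_inner f g = 0"
        using L2_inner_eq_fourier_integral[OF fL g(1), of "\<lambda>_. 0"] by simp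
    qed
  qed
  with sub show "shift_space l \<phi> = paley_wiener \<Omega>" by blast
qed

section \<open>Counting the points of the spectrum on an orbit\<close>

text \<open>
  The lower Riesz bound keeps \<open>e i0\<close> at distance at least \<open>sqrt A\<close> from the closed span of the other
  vectors: in a difference of \<open>e i0\<close> and a combination of the others the coefficient of \<open>e i0\<close> is 1. So
  the component of \<open>e i0\<close> orthogonal to that span is nonzero and can be normalized.
\<close>

lemma riesz_basis_biorthogonal:
  assumes R: "riesz_basis I e V" and i0: "i0 \<in> I"
  obtains \<psi> where "\<psi> \<in> L2_space" "\<And>i. i \<in> I \<Longrightarrow> L2_inner (e i) \<psi> = (if i = i0 then 1 else 0)"
proof -
  have eL: "e i \<in> L2_space" if "i \<in> I" for i using R that by (simp add: riesz_basis_def)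
  obtain A B where "A > 0" and AB: "\<forall>F c. finite F \<and> F \<subseteq> I \<longrightarrow>
      A * (\<Sum>i\<in>F. (cmod (c i))\<^sup>2) \<le> (L2_norm (\<lambda>x. \<Sum>i\<in>F. c i * e i x))\<^sup>2 \<and>
      (L2_norm (\<lambda>x. \<Sum>i\<in>F. c i * e i x))\<^sup>2 \<le> B * (\<Sum>i\<in>F. (cmod (c i))\<^sup>2)"
    using R unfolding riesz_basis_def by (elim conjE exE) (rule that)
  have A: "A > 0" "\<And>F c. finite F \<Longrightarrow> F \<subseteq> I \<Longrightarrow>
      A * (\<Sum>i\<in>F. (cmod (c i))\<^sup>2) \<le> (L2_norm (\<lambda>x. \<Sum>i\<in>F. c i * e i x))\<^sup>2"
    using \<open>A > 0\<close> AB by simp_all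
  define W where "W = closed_span (I - {i0}) e"
  have W: "closed_L2_subspace W" unfolding W_def by (rule closed_span_subspace) (simp add: eL)
  obtain p where p: "p \<in> W" "\<And>v. v \<in> W \<Longrightarrow> L2_inner (\<lambda>x. e i0 x - p x) v = 0"
    using L2_projection[OF W eL[OF i0]] by blast
  have pL: "p \<in> L2_space" using closed_L2_subspaceD(1)[OF W p(1)] .
  define r where "r x = e i0 x - p x" for x
  have rL: "r \<in> L2_space" unfolding r_def by (intro L2_diff eL i0 pL)
  have rorth: "L2_inner v r = 0" if "v \<in> W" for v
    using p(2)[OF that] by (subst L2_inner_commute) (simp add: r_def[abs_def])
  have er: "L2_inner (e i0) r = complex_of_real ((L2_norm r)\<^sup>2)"
  proof -
    have "L2_inner r r = L2_inner (e i0) r - L2_inner p r"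
      unfolding r_def[abs_def] by (rule L2_inner_diff_left[OF eL[OF i0] pL rL[unfolded r_def[abs_def]]])
    then show ?thesis using rorth[OF p(1)] L2_inner_self[OF rL] by simp
  qed
  have nz: "L2_norm r \<noteq> 0"
  proof
    assume 0: "L2_norm r = 0"
    have "sqrt A > 0" using A(1) by simp
    then obtain s where s: "s \<in> lin_span (I - {i0}) e" "L2_norm (\<lambda>x. p x - s x) < sqrt A"
      using L2_closureD[OF p(1)[unfolded W_def closed_span_def]] by blast
    then obtain F c where F: "finite F" "F \<subseteq> I - {i0}" "s = (\<lambda>x. \<Sum>i\<in>F. c i * e i x)"
      by (auto simp: lin_span_def)
    have sL: "s \<in> L2_space" using s(1) lin_span_subset_L2[of "I - {i0}" e] eL by blast
    define b where "b i = (if i = i0 then 1 else - c i)" for i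
    have eq: "(\<lambda>x. \<Sum>i\<in>insert i0 F. b i * e i x) = (\<lambda>x. e i0 x - s x)"
    proof
      fix x
      have "(\<Sum>i\<in>F. b i * e i x) = - s x"
        unfolding F(3) sum_negf[symmetric] by (intro sum.cong) (use F(2) in \<open>auto simp: b_def\<close>)
      then show "(\<Sum>i\<in>insert i0 F. b i * e i x) = e i0 x - s x"
        using F(1,2) by (subst sum.insert) (auto simp: b_def)
    qed
    have lower: "A * (\<Sum>i\<in>insert i0 F. (cmod (b i))\<^sup>2) \<le> (L2_norm (\<lambda>x. \<Sum>i\<in>insert i0 F. b i * e i x))\<^sup>2"
      by (rule A(2)) (use F i0 in auto)
    have ge1: "1 \<le> (\<Sum>i\<in>insert i0 F. (cmod (b i))\<^sup>2)"
    proof -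
      have "(\<Sum>i\<in>insert i0 F. (cmod (b i))\<^sup>2) = 1 + (\<Sum>i\<in>F. (cmod (b i))\<^sup>2)"
        using F(1,2) by (subst sum.insert) (auto simp: b_def)
      then show ?thesis using sum_nonneg[of F "\<lambda>i. (cmod (b i))\<^sup>2"] by simp
    qed
    have "L2_norm (\<lambda>x. e i0 x - s x) < sqrt A"
      using L2_norm_triangle_diff[OF eL[OF i0] pL sL] 0 s(2) by (simp add: r_def[abs_def])
    then have upper: "(L2_norm (\<lambda>x. e i0 x - s x))\<^sup>2 < A"
      using power_strict_mono[of "L2_norm (\<lambda>x. e i0 x - s x)" "sqrt A" 2] A(1) by simp
    have "A * 1 \<le> A * (\<Sum>i\<in>insert i0 F. (cmod (b i))\<^sup>2)"
      by (rule mult_left_mono[OF ge1]) (use A(1) in simp)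
    with lower[unfolded eq] upper show False by linarith
  qed
  show ?thesis
  proof (rule that)
    define \<psi> where "\<psi> x = complex_of_real (1 / (L2_norm r)\<^sup>2) * r x" for x
    show "\<psi> \<in> L2_space" unfolding \<psi>_def by (rule L2_cmult[OF rL])
    fix i assume i: "i \<in> I"
    have inner: "L2_inner (e i) \<psi> = complex_of_real (1 / (L2_norm r)\<^sup>2) * L2_inner (e i) r"
      unfolding \<psi>_def[abs_def] by (subst L2_inner_cmult_right) simp
    show "L2_inner (e i) \<psi> = (if i = i0 then 1 else 0)"
    proof (cases "i = i0")
      case True
      then show ?thesis unfolding inner using er nz by simp
    next
      case False
      then have "e i \<in> W" unfolding W_def using i by (intro in_closed_span eL) auto
      then show ?thesis unfolding inner using False rorth by simp
    qed
  qed
qed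

lemma periodize_translated_cell:
  assumes b: "\<And>\<omega>. \<omega> - lattice_point m \<notin> unit_cell \<Longrightarrow> b \<omega> = 0"
  shows "periodize b \<omega> = b (\<omega> - round_vec \<omega> + lattice_point m)"
proof -
  obtain n where n: "lattice_point n = lattice_point m - round_vec \<omega>"
    using lattice_pointE[OF int_lattice_diff[OF lattice_point_in round_vec_in_lattice]] .
  have "periodize b \<omega> = b (\<omega> + lattice_point n)"
    unfolding periodize_def
  proof (rule suminf_unique_nonzero)
    fix k assume k: "k \<noteq> n"
    have "lattice_point m - lattice_point k \<noteq> round_vec \<omega>"
    proof
      assume "lattice_point m - lattice_point k = round_vec \<omega>"
      then have "lattice_point k = lattice_point m - round_vec \<omega>" by (simp add: algebra_simps)
      then show False using n k lattice_point_inj by metis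
    qed
    then have "\<omega> - (lattice_point m - lattice_point k) \<notin> unit_cell"
      using diff_in_cell_iff[OF int_lattice_diff[OF lattice_point_in lattice_point_in]] by blast
    then show "b (\<omega> + lattice_point k) = 0" by (intro b) (simp add: algebra_simps)
  qed
  then show ?thesis using n by (simp add: algebra_simps)
qed

lemma periodize_measurable:
  assumes "b \<in> borel_measurable lebesgue"
  shows "periodize b \<in> borel_measurable lebesgue"
  unfolding periodize_def[abs_def] using measurable_translation[OF assms] by measurable

lemma indicator_sums_nat_imp_card:
  assumes "(\<lambda>n. indicator S n :: real) sums real l"
  shows "finite S" "card S = l"
proof -
  have "(\<lambda>n. indicator S n :: real) \<longlonglongrightarrow> 0" using assms by (intro summable_LIMSEQ_zero sums_summable)
  then obtain N where N: "\<And>n. n \<ge> N \<Longrightarrow> norm (indicator S n - 0 :: real) < 1"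
    using LIMSEQ_D[of _ "0::real" 1] by (metis zero_less_one)
  have "n \<notin> S" if "n \<ge> N" for n
    using N[OF that] by (cases "n \<in> S") simp_all
  then have "S \<subseteq> {..<N}" by (meson lessThan_iff not_le subsetI)
  then show fin: "finite S" by (rule finite_subset) simp
  have "(\<lambda>n. indicator S n :: real) sums (\<Sum>n\<in>S. indicator S n)" by (rule sums_finite[OF fin]) simp
  also have "(\<Sum>n\<in>S. indicator S n :: real) = real (card S)" by simp
  finally have "(\<lambda>n. indicator S n :: real) sums real (card S)" .
  from sums_unique2[OF assms this] show "card S = l" by simp
qed

text \<open>
  The lattice is symmetric, so the orbit may be enumerated with \<open>+\<close> instead of \<open>-\<close>.
\<close>

lemma multi_tile_iff_sums:
  fixes \<Omega> :: "(real^'d) set"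
  shows "multi_tile l \<Omega> \<longleftrightarrow> \<Omega> \<in> sets lebesgue \<and>
    (AE \<omega> in lebesgue. (\<lambda>n. indicator \<Omega> (\<omega> + lattice_point n) :: real) sums real l)"
proof -
  have bij: "bij_betw (\<lambda>n. - lattice_point n :: real^'d) UNIV int_lattice"
  proof -
    have "bij_betw uminus (int_lattice :: (real^'d) set) int_lattice"
      by (rule bij_betw_byWitness[where f' = uminus]) (auto simp: int_lattice_minus)
    from bij_betw_trans[OF bij_lattice_point this] show ?thesis by (simp add: comp_def)
  qed
  have "((\<lambda>k. indicator \<Omega> (\<omega> - k) :: real) has_sum real l) int_lattice \<longleftrightarrow>
      (\<lambda>n. indicator \<Omega> (\<omega> + lattice_point n) :: real) sums real l" for \<omega>
  proof -
    have "((\<lambda>k. indicator \<Omega> (\<omega> - k) :: real) has_sum real l) int_lattice \<longleftrightarrow>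
        ((\<lambda>n. indicator \<Omega> (\<omega> + lattice_point n) :: real) has_sum real l) UNIV"
      using has_sum_reindex_bij_betw[OF bij, of "\<lambda>k. indicator \<Omega> (\<omega> - k) :: real" "real l"] by simp
    also have "\<dots> \<longleftrightarrow> (\<lambda>n. indicator \<Omega> (\<omega> + lattice_point n) :: real) sums real l"
      by (auto intro: has_sum_imp_sums sums_nonneg_imp_has_sum)
    finally show ?thesis .
  qed
  then show ?thesis by (simp add: multi_tile_def)
qed

text \<open>
  With \<open>\<Phi> j\<close> and \<open>\<Psi> j\<close> the transforms of the generators and of the biorthogonal functions, let
  \<open>h i j = \<Phi> i * cnj (\<Psi> j)\<close>. Biorthogonality prescribes the Fourier coefficients of \<open>h i j\<close>, so its
  periodization is 1 for \<open>i = j\<close> and 0 otherwise.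
  
  It remains to see that \<open>\<Sum>j\<in>{1..l}. h j j\<close> is the indicator of \<open>\<Omega>\<close>. This is the expansion of
  functions in the basis, evaluated at one point of an orbit. It is proved weakly, in order to avoid
  a convergence argument on the orbits: a test function \<open>w\<close> is built that is orthogonal to
  all basis vectors exactly because of the periodizations just computed. Since the basis spans all
  functions on \<open>\<Omega>\<close>, the function \<open>w\<close> vanishes on \<open>\<Omega>\<close>, and this is the desired identity.
\<close>

theorem multi_tile_if_riesz_basis:
  fixes \<phi> :: "nat \<Rightarrow> real^'d \<Rightarrow> complex"
  assumes R: "riesz_basis (shift_index l) (integer_shifts \<phi>) (paley_wiener \<Omega>)"
    and \<phi>: "\<forall>j\<in>{1..l}. \<phi> j \<in> L2_space"
    and \<Omega>: "\<Omega> \<in> sets lebesgue" and off: "\<And>\<omega> j. \<omega> \<notin> \<Omega> \<Longrightarrow> j \<in> {1..l} \<Longrightarrow> fourier_L2 (\<phi> j) \<omega> = 0"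
  shows "multi_tile l \<Omega>"
proof -
  let ?I = "shift_index l :: ((real^'d) \<times> nat) set"
  let ?e = "integer_shifts \<phi>"
  have "\<forall>j\<in>{1..l}. \<exists>\<psi>\<in>L2_space. \<forall>i\<in>?I. L2_inner (?e i) \<psi> = (if i = (0, j) then 1 else 0)"
  proof
    fix j assume "j \<in> {1..l}"
    then have "(0, j) \<in> ?I" by (simp add: shift_index_def int_lattice_zero)
    from riesz_basis_biorthogonal[OF R this]
    show "\<exists>\<psi>\<in>L2_space. \<forall>i\<in>?I. L2_inner (?e i) \<psi> = (if i = (0, j) then 1 else 0)" by metis
  qed
  then obtain \<psi> where \<psi>: "\<And>j. j \<in> {1..l} \<Longrightarrow> \<psi> j \<in> L2_space"
    "\<And>i j. j \<in> {1..l} \<Longrightarrow> i \<in> ?I \<Longrightarrow> L2_inner (?e i) (\<psi> j) = (if i = (0, j) then 1 else 0)"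
    using bchoice[of "{1..l}" "\<lambda>j \<psi>. \<psi> \<in> L2_space \<and> (\<forall>i\<in>?I. L2_inner (?e i) \<psi> = (if i = (0, j) then 1 else 0))"]
    by blast
  define \<Phi> where "\<Phi> j = fourier_L2 (\<phi> j)" for j
  define \<Psi> where "\<Psi> j = fourier_L2 (\<psi> j)" for j
  define h where "h i j \<omega> = \<Phi> i \<omega> * cnj (\<Psi> j \<omega>)" for i j \<omega>
  have \<phi>L: "\<phi> j \<in> L2_space" if "j \<in> {1..l}" for j using \<phi> that by blast
  have \<Phi>L: "\<Phi> j \<in> L2_space" if "j \<in> {1..l}" for j unfolding \<Phi>_def by (rule fourier_L2_in_L2[OF \<phi>L[OF that]])
  have \<Psi>L: "\<Psi> j \<in> L2_space" if "j \<in> {1..l}" for j unfolding \<Psi>_def by (rule fourier_L2_in_L2[OF \<psi>(1)[OF that]])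
  have hi: "integrable lebesgue (h i j)" if "i \<in> {1..l}" "j \<in> {1..l}" for i j
    unfolding h_def by (rule L2_inner_integrable[OF \<Phi>L[OF that(1)] \<Psi>L[OF that(2)]])
  have per: "AE \<omega> in lebesgue. periodize (h i j) \<omega> = (if i = j then 1 else 0)"
    if ij: "i \<in> {1..l}" "j \<in> {1..l}" for i j
  proof (rule periodize_const_if_fourier_coefficients[OF hi[OF ij]])
    fix k :: "real^'d" assume k: "k \<in> int_lattice"
    have "(- k, i) \<in> ?I" using ij k by (simp add: shift_index_def int_lattice_minus)
    from \<psi>(2)[OF ij(2) this] L2_inner_translation_left[OF \<psi>(1)[OF ij(2)] \<phi>L[OF ij(1)], of "- k"]
    show "(LINT \<omega>|lebesgue. h i j \<omega> * chr k \<omega>) = (if k = 0 then if i = j then 1 else 0 else 0)"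
      by (simp add: h_def \<Phi>_def \<Psi>_def integer_shifts_def)
  qed
  have on_cell: "AE \<omega> in lebesgue. \<omega> \<in> \<Omega> \<and> \<omega> - lattice_point m \<in> unit_cell \<and> (\<forall>j\<in>{1..l}. cmod (\<Phi> j \<omega>) \<le> real M)
      \<longrightarrow> (\<Sum>j\<in>{1..l}. h j j \<omega>) = 1" for m M
  proof -
    \<comment> \<open>On \<open>E\<close> all \<open>\<Phi> j\<close> are bounded, and an orbit meets \<open>E\<close> at most once. Therefore the periodic
        extension \<open>P j\<close> of \<open>\<Phi> j\<close> from \<open>E\<close> is bounded and agrees with \<open>\<Phi> j\<close> on \<open>E\<close>.\<close>
    define E where "E = {\<omega> :: real^'d. \<omega> - lattice_point m \<in> unit_cell} \<inter> (\<Inter>j\<in>{1..l}. {\<omega>. cmod (\<Phi> j \<omega>) \<le> real M})"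
    define b where "b j \<omega> = indicator E \<omega> * \<Phi> j \<omega>" for j \<omega>
    define P where "P j = periodize (b j)" for j
    have Cm: "{\<omega> :: real^'d. \<omega> - lattice_point m \<in> unit_cell} \<in> sets lebesgue"
      using measurable_sets[OF measurable_add_right_lebesgue unit_cell_lebesgue, of "- lattice_point m"]
      by (simp add: vimage_def)
    have "{\<omega>. cmod (\<Phi> j \<omega>) \<le> real M} \<in> sets lebesgue" if "j \<in> {1..l}" for j
    proof -
      have "(\<lambda>\<omega>. cmod (\<Phi> j \<omega>)) \<in> borel_measurable lebesgue" using L2_space_measurable[OF \<Phi>L[OF that]] by simp
      from measurable_sets[OF this, of "{..real M}"] show ?thesis by (simp add: vimage_def)
    qed
    then have Em: "E \<in> sets lebesgue"
      unfolding E_def using Cm by (cases "l = 0") (auto intro!: sets.Int sets.finite_INT)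
    have b0: "b j \<omega> = 0" if "\<omega> - lattice_point m \<notin> unit_cell" for j \<omega>
      using that by (simp add: b_def E_def)
    have bL: "b j \<in> L2_space" if "j \<in> {1..l}" for j
      unfolding b_def by (rule L2_indicator_mult[OF \<Phi>L[OF that] Em])
    have Pf: "P j \<omega> = b j (\<omega> - round_vec \<omega> + lattice_point m)" for j \<omega>
      unfolding P_def by (rule periodize_translated_cell) (rule b0)
    have Pper: "lattice_periodic (P j)" for j by (simp add: lattice_periodic_def Pf round_vec_add)
    have bB: "cmod (b j \<omega>) \<le> real M" if "j \<in> {1..l}" for j \<omega>
      using that by (auto simp: b_def E_def indicator_def)
    have PB: "cmod (P j \<omega>) \<le> real M" if "j \<in> {1..l}" for j \<omega> unfolding Pf by (rule bB[OF that])
    have Pm: "P j \<in> borel_measurable lebesgue" if "j \<in> {1..l}" for j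
      unfolding P_def by (rule periodize_measurable[OF L2_space_measurable[OF bL[OF that]]])
    have Cfin: "emeasure lebesgue {\<omega> :: real^'d. \<omega> - lattice_point m \<in> unit_cell} < \<infinity>"
    proof -
      have "emeasure lebesgue {\<omega> :: real^'d. \<omega> - lattice_point m \<in> unit_cell} =
          (\<integral>\<^sup>+\<omega>. indicator {\<omega> :: real^'d. \<omega> - lattice_point m \<in> unit_cell} \<omega> \<partial>lebesgue)"
        by (rule nn_integral_indicator[OF Cm, symmetric])
      also have "\<dots> = (\<integral>\<^sup>+\<omega>. indicator unit_cell ((\<omega> :: real^'d) + - lattice_point m) \<partial>lebesgue)"
        by (rule nn_integral_cong) (simp add: indicator_def)
      also have "\<dots> = (\<integral>\<^sup>+\<omega>. indicator (unit_cell :: (real^'d) set) \<omega> \<partial>lebesgue)"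
        by (rule nn_integral_translation) simp
      finally show ?thesis using emeasure_unit_cell_finite by simp
    qed
    have Efin: "emeasure lebesgue E < \<infinity>"
      using emeasure_mono[of E "{\<omega>. \<omega> - lattice_point m \<in> unit_cell}" lebesgue] Cm Cfin
      by (auto simp: E_def)
    have EL: "(indicator E :: real^'d \<Rightarrow> complex) \<in> L2_space"
    proof -
      have "(\<integral>\<^sup>+\<omega>. ennreal ((cmod (indicator E \<omega>))\<^sup>2) \<partial>lebesgue) = (\<integral>\<^sup>+\<omega>. indicator E \<omega> \<partial>lebesgue)"
        by (intro nn_integral_cong) (auto simp: indicator_def)
      then show ?thesis using Em Efin by (simp add: L2_space_iff_nn)
    qed
    have bi: "integrable lebesgue (b j)" if "j \<in> {1..l}" for j
      by (rule L2_integrable_on_finite[OF bL[OF that] Em Efin]) (simp add: b_def)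
    \<comment> \<open>Integrating the transform \<open>f\<close> of a finite combination of the basis vectors against \<open>cnj w\<close> gives the
        integral over \<open>E\<close> of the difference between \<open>f\<close> and its expansion in the basis.\<close>
    define w where "w \<omega> = indicator E \<omega> - (\<Sum>j\<in>{1..l}. cnj (P j \<omega>) * \<Psi> j \<omega>)" for \<omega>
    have PL: "(\<lambda>\<omega>. cnj (P j \<omega>) * \<Psi> j \<omega>) \<in> L2_space" if "j \<in> {1..l}" for j
      using L2_bounded_mult[OF \<Psi>L[OF that], of "\<lambda>\<omega>. cnj (P j \<omega>)" "real M"] PB[OF that] borel_measurable_cnj[OF Pm[OF that]]
      by simp
    have wL: "w \<in> L2_space" unfolding w_def by (intro L2_diff EL L2_sum PL)
    obtain w' where w': "w' \<in> L2_space" "AE \<omega> in lebesgue. fourier_L2 w' \<omega> = w \<omega>"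
      using fourier_L2_surj[OF wL] .
    have orth: "L2_inner (?e i) w' = 0" if iI: "i \<in> ?I" for i
    proof -
      obtain k a where i: "i = (k, a)" "k \<in> int_lattice" "a \<in> {1..l}" using iI by (auto simp: shift_index_def)
      have kl: "- k \<in> int_lattice" by (rule int_lattice_minus[OF i(2)])
      define G where "G j \<omega> = h a j \<omega> * (P j \<omega> * chr (- k) \<omega>)" for j \<omega>
      have Pcm: "(\<lambda>\<omega>. P j \<omega> * chr (- k) \<omega>) \<in> borel_measurable lebesgue" if "j \<in> {1..l}" for j
        using Pm[OF that] chr_lebesgue by (rule borel_measurable_times)
      have Pcper: "lattice_periodic (\<lambda>\<omega>. P j \<omega> * chr (- k) \<omega>)" for j
        using Pper[of j] lattice_periodic_chr[OF kl] by (simp add: lattice_periodic_def)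
      have PcB: "cmod (P j \<omega> * chr (- k) \<omega>) \<le> real M" if "j \<in> {1..l}" for j \<omega>
        using PB[OF that] by (simp add: norm_mult)
      have Gi: "integrable lebesgue (G j)" if "j \<in> {1..l}" for j
        unfolding G_def by (rule integrable_mult_bounded[OF hi[OF i(3) that] Pcm[OF that] PcB[OF that]])
      \<comment> \<open>Only \<open>j = a\<close> contributes, and then the result is that of integrating \<open>\<Phi> a * chr (- k)\<close> over \<open>E\<close>.\<close>
      have GI: "(LINT \<omega>|lebesgue. G j \<omega>) =
          (if a = j then 1 else 0) * (LINT \<omega>|lebesgue. indicator unit_cell \<omega> * (P j \<omega> * chr (- k) \<omega>))" if "j \<in> {1..l}" for j
        unfolding G_def
        by (rule integral_mult_periodic_const[OF hi[OF i(3) that] per[OF i(3) that] Pcper Pcm[OF that] PcB[OF that]])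
      have bci: "integrable lebesgue (\<lambda>\<omega>. b a \<omega> * chr (- k) \<omega>)" by (rule integrable_mult_chr[OF bi[OF i(3)]])
      have bI: "(LINT \<omega>|lebesgue. b a \<omega> * chr (- k) \<omega>) =
          (LINT \<omega>|lebesgue. indicator unit_cell \<omega> * (P a \<omega> * chr (- k) \<omega>))"
        unfolding P_def
        using integral_mult_periodic[OF bi[OF i(3)] lattice_periodic_chr[OF kl] chr_lebesgue, of 1]
        by (simp add: mult.assoc)
      have "L2_inner (?e i) w' = (LINT \<omega>|lebesgue. b a \<omega> * chr (- k) \<omega> - (\<Sum>j\<in>{1..l}. G j \<omega>))"
      proof (rule L2_inner_eq_fourier_integral[OF integer_shifts_L2[OF \<phi> iI] w'(1)])
        show "AE \<omega> in lebesgue. fourier_L2 (?e i) \<omega> * cnj (fourier_L2 w' \<omega>) = b a \<omega> * chr (- k) \<omega> - (\<Sum>j\<in>{1..l}. G j \<omega>)"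
          using fourier_L2_translation[OF \<phi>L[OF i(3)], of k] w'(2)
        proof eventually_elim
          case (elim \<omega>)
          have "fourier_L2 (?e i) \<omega> * cnj (fourier_L2 w' \<omega>) = chr (- k) \<omega> * \<Phi> a \<omega> * cnj (w \<omega>)"
            using elim by (simp add: i(1) integer_shifts_def chr_minus_left \<Phi>_def)
          also have "cnj (w \<omega>) = indicator E \<omega> - (\<Sum>j\<in>{1..l}. P j \<omega> * cnj (\<Psi> j \<omega>))"
            by (simp add: w_def indicator_def)
          finally show ?case
            by (simp add: b_def G_def h_def algebra_simps sum_distrib_left)
        qed
        show "(\<lambda>\<omega>. b a \<omega> * chr (- k) \<omega> - (\<Sum>j\<in>{1..l}. G j \<omega>)) \<in> borel_measurable lebesgue"
          by (intro borel_measurable_diff borel_measurable_sum borel_measurable_integrable bci Gi)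
      qed
      also have "\<dots> = (LINT \<omega>|lebesgue. b a \<omega> * chr (- k) \<omega>) - (\<Sum>j\<in>{1..l}. LINT \<omega>|lebesgue. G j \<omega>)"
        by (subst Bochner_Integration.integral_diff) (auto intro!: bci Gi Bochner_Integration.integrable_sum Bochner_Integration.integral_sum)
      also have "(\<Sum>j\<in>{1..l}. LINT \<omega>|lebesgue. G j \<omega>) =
          (\<Sum>j\<in>{1..l}. if a = j then (LINT \<omega>|lebesgue. indicator unit_cell \<omega> * (P j \<omega> * chr (- k) \<omega>)) else 0)"
        by (intro sum.cong refl) (simp add: GI)
      also have "\<dots> = (LINT \<omega>|lebesgue. indicator unit_cell \<omega> * (P a \<omega> * chr (- k) \<omega>))"
        using i(3) by (subst sum.delta') auto
      finally show ?thesis by (simp add: bI)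
    qed
    have V: "closed_span ?I ?e = paley_wiener \<Omega>" using R by (simp add: riesz_basis_def)
    define u where "u \<omega> = indicator \<Omega> \<omega> * w \<omega>" for \<omega>
    have uL: "u \<in> L2_space" unfolding u_def by (rule L2_indicator_mult[OF wL \<Omega>])
    obtain u' where u': "u' \<in> L2_space" "AE \<omega> in lebesgue. fourier_L2 u' \<omega> = u \<omega>"
      using fourier_L2_surj[OF uL] .
    have "AE \<omega> in lebesgue. \<omega> \<notin> \<Omega> \<longrightarrow> fourier_L2 u' \<omega> = 0" using u'(2) by eventually_elim (simp add: u_def)
    then have "u' \<in> closed_span ?I ?e" unfolding V by (simp add: paley_wiener_def u'(1))
    from closed_span_orthogonal[OF integer_shifts_L2[OF \<phi>] w'(1) orth this]
    have "L2_inner u' w' = 0" by blast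
    moreover have "L2_inner u' w' = L2_inner u u"
    proof -
      have "L2_inner u' w' = (LINT \<omega>|lebesgue. u \<omega> * cnj (u \<omega>))"
      proof (rule L2_inner_eq_fourier_integral[OF u'(1) w'(1)])
        show "AE \<omega> in lebesgue. fourier_L2 u' \<omega> * cnj (fourier_L2 w' \<omega>) = u \<omega> * cnj (u \<omega>)"
          using u'(2) w'(2) by eventually_elim (simp add: u_def indicator_def)
      qed (rule borel_measurable_integrable[OF L2_inner_integrable[OF uL uL]])
      then show ?thesis by (simp add: L2_inner_def)
    qed
    ultimately have "L2_norm u = 0" using L2_inner_self[OF uL] by simp
    then have "AE \<omega> in lebesgue. u \<omega> = 0" using L2_norm_zero_iff[OF uL] by simp
    then show ?thesis
    proof eventually_elim
      case (elim \<omega>)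
      show ?case
      proof
        assume A: "\<omega> \<in> \<Omega> \<and> \<omega> - lattice_point m \<in> unit_cell \<and> (\<forall>j\<in>{1..l}. cmod (\<Phi> j \<omega>) \<le> real M)"
        then have E: "\<omega> \<in> E" by (simp add: E_def)
        have "lattice_point m = round_vec \<omega>" using A diff_in_cell_iff[of "lattice_point m" \<omega>] by simp
        then have P: "P j \<omega> = \<Phi> j \<omega>" for j using E by (simp add: Pf b_def)
        have "w \<omega> = 0" using elim A by (simp add: u_def)
        then have "(\<Sum>j\<in>{1..l}. cnj (P j \<omega>) * \<Psi> j \<omega>) = 1" using E by (simp add: w_def)
        then have "cnj (\<Sum>j\<in>{1..l}. cnj (P j \<omega>) * \<Psi> j \<omega>) = 1" by simp
        then show "(\<Sum>j\<in>{1..l}. h j j \<omega>) = 1" by (simp add: h_def P)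
      qed
    qed
  qed
  \<comment> \<open>Countably many of the sets \<open>E\<close> cover the space.\<close>
  have "AE \<omega> in lebesgue. \<forall>m M. \<omega> \<in> \<Omega> \<and> \<omega> - lattice_point m \<in> unit_cell \<and> (\<forall>j\<in>{1..l}. cmod (\<Phi> j \<omega>) \<le> real M)
      \<longrightarrow> (\<Sum>j\<in>{1..l}. h j j \<omega>) = 1"
    unfolding AE_all_countable using on_cell by blast
  then have trace: "AE \<omega> in lebesgue. (\<Sum>j\<in>{1..l}. h j j \<omega>) = indicator \<Omega> \<omega>"
  proof eventually_elim
    case (elim \<omega>)
    show ?case
    proof (cases "\<omega> \<in> \<Omega>")
      case True
      obtain m where m: "lattice_point m = round_vec \<omega>" using lattice_pointE[OF round_vec_in_lattice] .
      obtain M where M: "(\<Sum>j\<in>{1..l}. cmod (\<Phi> j \<omega>)) \<le> real M" using real_arch_simple by blast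
      have "cmod (\<Phi> j \<omega>) \<le> real M" if "j \<in> {1..l}" for j
        using member_le_sum[of j "{1..l}" "\<lambda>j. cmod (\<Phi> j \<omega>)"] that M by simp
      moreover have "\<omega> - lattice_point m \<in> unit_cell" using m diff_round_in_cell[of \<omega>] by simp
      ultimately have "(\<Sum>j\<in>{1..l}. h j j \<omega>) = 1" using elim True by blast
      then show ?thesis using True by simp
    next
      case False
      then show ?thesis using off by (auto simp: h_def \<Phi>_def intro!: sum.neutral)
    qed
  qed
  have "AE \<omega> in lebesgue. \<forall>n. (\<Sum>j\<in>{1..l}. h j j (\<omega> + lattice_point n)) = indicator \<Omega> (\<omega> + lattice_point n)"
    unfolding AE_all_countable by (intro allI AE_translation[OF trace])
  moreover have "AE \<omega> in lebesgue. \<forall>j\<in>{1..l}. periodize (h j j) \<omega> = 1 \<and> summable (\<lambda>n. norm (h j j (\<omega> + lattice_point n)))"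
  proof (intro AE_ball_countable[THEN iffD2] ballI)
    fix j assume j: "j \<in> {1..l}"
    show "AE \<omega> in lebesgue. periodize (h j j) \<omega> = 1 \<and> summable (\<lambda>n. norm (h j j (\<omega> + lattice_point n)))"
      using per[OF j j] AE_summable_periodize[OF hi[OF j j]] by eventually_elim simp
  qed simp
  ultimately have "AE \<omega> in lebesgue. (\<lambda>n. indicator \<Omega> (\<omega> + lattice_point n) :: real) sums real l"
  proof eventually_elim
    case (elim \<omega>)
    have "(\<lambda>n. h j j (\<omega> + lattice_point n)) sums 1" if "j \<in> {1..l}" for j
      using elim(2) that summable_norm_cancel[of "\<lambda>n. h j j (\<omega> + lattice_point n)"]
      by (auto simp: sums_iff periodize_def)
    then have "(\<lambda>n. \<Sum>j\<in>{1..l}. h j j (\<omega> + lattice_point n)) sums (\<Sum>j\<in>{1..l}. 1)" by (rule sums_sum)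
    then have "(\<lambda>n. indicator \<Omega> (\<omega> + lattice_point n) :: complex) sums of_nat l" using elim(1) by simp
    then have "(\<lambda>n. Re (indicator \<Omega> (\<omega> + lattice_point n))) sums Re (of_nat l)" by (rule sums_Re)
    moreover have "Re (indicator \<Omega> x) = indicator \<Omega> x" for x :: "real^'d" by (simp add: indicator_def)
    ultimately show ?case by simp
  qed
  then show ?thesis unfolding multi_tile_iff_sums using \<Omega> by blast
qed

section \<open>Cutting a multi-tile into tiles\<close>

lemma rank_range:
  fixes S :: "nat set"
  assumes S: "finite S" "card S = l" and m: "m \<in> S"
  shows "card {k \<in> S. k \<le> m} \<in> {1..l}"
proof -
  have "card {k \<in> S. k \<le> m} \<le> l" unfolding S(2)[symmetric] by (rule card_mono[OF S(1)]) auto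
  moreover have "{k \<in> S. k \<le> m} \<noteq> {}" using m by auto
  then have "0 < card {k \<in> S. k \<le> m}" using S(1) by (simp only: card_gt_0_iff) simp
  ultimately show ?thesis unfolding atLeastAtMost_iff by linarith
qed

lemma ex1_rank:
  fixes S :: "nat set"
  assumes S: "finite S" "card S = l" and j: "j \<in> {1..l}"
  shows "\<exists>!m. m \<in> S \<and> card {k \<in> S. k \<le> m} = j"
proof -
  let ?r = "\<lambda>m. card {k \<in> S. k \<le> m}"
  have mono: "?r m < ?r n" if "m \<in> S" "n \<in> S" "m < n" for m n
  proof (rule psubset_card_mono)
    have "n \<in> {k \<in> S. k \<le> n}" "n \<notin> {k \<in> S. k \<le> m}" using that by auto
    moreover have "{k \<in> S. k \<le> m} \<subseteq> {k \<in> S. k \<le> n}" using that by auto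
    ultimately show "{k \<in> S. k \<le> m} \<subset> {k \<in> S. k \<le> n}" by blast
  qed (use S in simp)
  have inj: "inj_on ?r S"
  proof (rule inj_onI)
    fix m n assume "m \<in> S" "n \<in> S" "?r m = ?r n"
    then show "m = n" using mono[of m n] mono[of n m] by (cases m n rule: linorder_cases) auto
  qed
  have "?r ` S \<subseteq> {1..l}" using rank_range[OF S] by blast
  moreover have "card (?r ` S) = card {1..l}" using card_image[OF inj] S(2) by simp
  ultimately have "?r ` S = {1..l}" by (intro card_subset_eq) auto
  then obtain m where "m \<in> S" "?r m = j" using j by (metis (no_types, lifting) imageE)
  then show ?thesis using inj unfolding inj_on_def by blast
qed

definition orbit_indices :: "(real^'d) set \<Rightarrow> real^'d \<Rightarrow> nat set"
  where "orbit_indices \<Omega> \<theta> = {n. \<theta> + lattice_point n \<in> \<Omega>}"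

text \<open>
  The points of \<open>\<Omega>\<close> that are the \<open>j\<close>-th of their orbit. A point is recorded by its representative
  in the unit cell and its index \<open>m\<close> in the enumeration of the lattice, and the points of an orbit are
  ordered by this index. Only finitely many indices are below \<open>m\<close>, so the rank
  is finite, and measurable in the point, even on orbits that meet \<open>\<Omega>\<close> infinitely often.
\<close>

definition layer :: "(real^'d) set \<Rightarrow> nat \<Rightarrow> (real^'d) set"
  where "layer \<Omega> j = {\<omega>. \<exists>m. \<omega> - lattice_point m \<in> unit_cell \<and> \<omega> \<in> \<Omega> \<and>
    card {k \<in> orbit_indices \<Omega> (\<omega> - lattice_point m). k \<le> m} = j}"

lemma layer_cell_iff:
  assumes "\<theta> \<in> unit_cell"
  shows "\<theta> + lattice_point m \<in> layer \<Omega> j \<longleftrightarrow>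
    m \<in> orbit_indices \<Omega> \<theta> \<and> card {k \<in> orbit_indices \<Omega> \<theta>. k \<le> m} = j"
proof -
  have "\<theta> + lattice_point m - lattice_point n \<in> unit_cell \<longleftrightarrow> n = m" for n
  proof -
    have "\<theta> + lattice_point m - lattice_point n \<in> unit_cell \<longleftrightarrow> lattice_point n = round_vec \<theta> + lattice_point m"
      using diff_in_cell_iff[OF lattice_point_in, of "\<theta> + lattice_point m" n]
      by (simp add: round_vec_add)
    then show ?thesis using round_vec_cell[OF assms] lattice_point_inj[of n m, where 'a = 'a] by simp
  qed
  then show ?thesis by (simp add: layer_def orbit_indices_def)
qed

text \<open>
  For a fixed index \<open>m\<close> the rank is a finite sum of indicators of translates of \<open>\<Omega>\<close>.
\<close>

lemma layer_measurable:
  fixes \<Omega> :: "(real^'d) set"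
  assumes \<Omega>: "\<Omega> \<in> sets lebesgue"
  shows "layer \<Omega> j \<in> sets lebesgue"
proof -
  have c: "card {k \<in> orbit_indices \<Omega> \<theta>. k \<le> m} = j \<longleftrightarrow>
      (\<Sum>k\<le>m. indicator \<Omega> (\<theta> + lattice_point k) :: real) = real j" for \<theta> m
  proof -
    have "(\<Sum>k\<le>m. indicator \<Omega> (\<theta> + lattice_point k) :: real) = (\<Sum>k\<in>{k \<in> orbit_indices \<Omega> \<theta>. k \<le> m}. 1)"
      by (rule sum.mono_neutral_cong_right) (auto simp: orbit_indices_def indicator_def split: if_splits)
    then show ?thesis by simp
  qed
  have t: "{\<omega> :: real^'d. \<omega> - t \<in> A} \<in> sets lebesgue" if "A \<in> sets lebesgue" for t A
    using measurable_sets[OF measurable_add_right_lebesgue that, of "- t"] by (simp add: vimage_def)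
  have s: "{\<omega>. (\<Sum>k\<le>m. indicator \<Omega> (\<omega> - lattice_point m + lattice_point k) :: real) = real j} \<in> sets lebesgue" for m
  proof -
    have "(\<lambda>\<omega>. indicator \<Omega> (\<omega> + t) :: real) \<in> borel_measurable lebesgue" for t
      by (rule measurable_translation) (use \<Omega> in simp)
    then have "(\<lambda>\<omega>. indicator \<Omega> (\<omega> + (lattice_point k - lattice_point m)) :: real) \<in> borel_measurable lebesgue" for k
      by blast
    then have "(\<lambda>\<omega>. \<Sum>k\<le>m. indicator \<Omega> (\<omega> + (lattice_point k - lattice_point m)) :: real) \<in> borel_measurable lebesgue"
      by (rule borel_measurable_sum)
    from measurable_sets[OF this, of "{real j}"] show ?thesis by (simp add: vimage_def algebra_simps)
  qed
  have "layer \<Omega> j = (\<Union>m. {\<omega>. \<omega> - lattice_point m \<in> unit_cell} \<inter> \<Omega> \<inter>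
      {\<omega>. (\<Sum>k\<le>m. indicator \<Omega> (\<omega> - lattice_point m + lattice_point k) :: real) = real j})"
    by (auto simp: layer_def c)
  also have "\<dots> \<in> sets lebesgue"
  proof (intro sets.countable_UN image_subsetI)
    fix m
    show "{\<omega>. \<omega> - lattice_point m \<in> unit_cell} \<inter> \<Omega> \<inter>
      {\<omega>. (\<Sum>k\<le>m. indicator \<Omega> (\<omega> - lattice_point m + lattice_point k) :: real) = real j} \<in> sets lebesgue"
      by (intro sets.Int t s \<Omega> unit_cell_lebesgue)
  qed
  finally show ?thesis .
qed

lemma layer_subset: "layer \<Omega> j \<subseteq> \<Omega>"
  by (auto simp: layer_def)

lemma layer_disjoint:
  assumes "\<omega> \<in> layer \<Omega> i" "\<omega> \<in> layer \<Omega> j"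
  shows "i = j"
proof -
  obtain m where m: "\<omega> - lattice_point m \<in> unit_cell"
    "card {k \<in> orbit_indices \<Omega> (\<omega> - lattice_point m). k \<le> m} = i"
    using assms(1) by (auto simp: layer_def)
  obtain n where n: "\<omega> - lattice_point n \<in> unit_cell"
    "card {k \<in> orbit_indices \<Omega> (\<omega> - lattice_point n). k \<le> n} = j"
    using assms(2) by (auto simp: layer_def)
  have "lattice_point m = (lattice_point n :: real^'a)"
    using m(1) n(1) diff_in_cell_iff[OF lattice_point_in, of \<omega>] by simp
  then have "m = n" using lattice_point_inj by blast
  then show ?thesis using m n by simp
qed

lemma multi_tile_orbit:
  assumes "multi_tile l \<Omega>"
  shows "AE \<omega> in lebesgue. finite (orbit_indices \<Omega> \<omega>) \<and> card (orbit_indices \<Omega> \<omega>) = l"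
proof -
  have "AE \<omega> in lebesgue. (\<lambda>n. indicator \<Omega> (\<omega> + lattice_point n) :: real) sums real l"
    using assms by (simp add: multi_tile_iff_sums)
  then show ?thesis
  proof eventually_elim
    case (elim \<omega>)
    have "(\<lambda>n. indicator \<Omega> (\<omega> + lattice_point n) :: real) = indicator (orbit_indices \<Omega> \<omega>)"
      by (auto simp: orbit_indices_def indicator_def)
    then show ?case using indicator_sums_nat_imp_card elim by metis
  qed
qed

lemma layer_tile:
  fixes \<Omega> :: "(real^'d) set"
  assumes mt: "multi_tile l \<Omega>" and j: "j \<in> {1..l}"
  shows "tile (layer \<Omega> j)"
proof -
  have "AE \<omega> in lebesgue. \<exists>!n. \<omega> + lattice_point n \<in> layer \<Omega> j"
  proof (rule AE_unit_cell_extend)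
    fix q
    show "AE \<omega> in lebesgue. \<omega> \<in> unit_cell \<longrightarrow> (\<exists>!n. \<omega> + lattice_point q + lattice_point n \<in> layer \<Omega> j)"
      using multi_tile_orbit[OF mt]
    proof eventually_elim
      case (elim \<omega>)
      show ?case
      proof
        assume w: "\<omega> \<in> unit_cell"
        have "\<exists>!m. \<omega> + lattice_point m \<in> layer \<Omega> j"
          unfolding layer_cell_iff[OF w] by (rule ex1_rank[OF _ _ j]) (use elim in auto)
        then obtain m where m: "\<omega> + lattice_point m \<in> layer \<Omega> j" "\<And>m'. \<omega> + lattice_point m' \<in> layer \<Omega> j \<Longrightarrow> m' = m"
          by (rule ex1E) blast
        obtain n where n: "lattice_point n = lattice_point m - (lattice_point q :: real^'d)"
          using lattice_pointE[OF int_lattice_diff[OF lattice_point_in lattice_point_in]] .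
        show "\<exists>!n. \<omega> + lattice_point q + lattice_point n \<in> layer \<Omega> j"
        proof (rule ex1I[of _ n])
          show "\<omega> + lattice_point q + lattice_point n \<in> layer \<Omega> j" using m(1) n by (simp add: algebra_simps)
          fix n' assume n': "\<omega> + lattice_point q + lattice_point n' \<in> layer \<Omega> j"
          obtain m' where m': "lattice_point m' = lattice_point q + (lattice_point n' :: real^'d)"
            using lattice_pointE[OF int_lattice_add[OF lattice_point_in lattice_point_in]] .
          have "m' = m" by (rule m(2)) (use n' m' in \<open>simp add: algebra_simps\<close>)
          then have "lattice_point n' = (lattice_point n :: real^'d)" using n m' by (simp add: algebra_simps)
          then show "n' = n" using lattice_point_inj by blast
        qed
      qed
    qed
  qed
  moreover have "\<Omega> \<in> sets lebesgue" using mt by (simp add: multi_tile_def)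
  ultimately show ?thesis by (simp add: tile_def layer_measurable)
qed

lemma layer_cover:
  assumes mt: "multi_tile l \<Omega>"
  shows "AE \<omega> in lebesgue. \<omega> \<in> \<Omega> \<longrightarrow> (\<exists>j\<in>{1..l}. \<omega> \<in> layer \<Omega> j)"
proof (rule AE_unit_cell_extend)
  fix q
  show "AE \<omega> in lebesgue. \<omega> \<in> unit_cell \<longrightarrow>
      \<omega> + lattice_point q \<in> \<Omega> \<longrightarrow> (\<exists>j\<in>{1..l}. \<omega> + lattice_point q \<in> layer \<Omega> j)"
    using multi_tile_orbit[OF mt]
  proof eventually_elim
    case (elim \<omega>)
    show ?case
    proof (intro impI)
      assume w: "\<omega> \<in> unit_cell" and q: "\<omega> + lattice_point q \<in> \<Omega>"
      then have qS: "q \<in> orbit_indices \<Omega> \<omega>" by (simp add: orbit_indices_def)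
      show "\<exists>j\<in>{1..l}. \<omega> + lattice_point q \<in> layer \<Omega> j"
        unfolding layer_cell_iff[OF w] using rank_range[of "orbit_indices \<Omega> \<omega>" l q] elim qS by blast
    qed
  qed
qed

text \<open>
  The generators are the inverse transforms of the indicators of the layers. The transform of the
  shift by \<open>k\<close> of the \<open>j\<close>-th generator is then \<open>chr (- k)\<close> on the \<open>j\<close>-th layer. These functions
  are orthonormal: within a layer because it is a tile, and across layers because of disjoint
  supports. They are complete because the layers cover \<open>\<Omega>\<close> up to a null set.
\<close>

theorem paley_wiener_multi_tile_in_TI_riesz_spaces:
  fixes \<Omega> :: "(real^'d) set"
  assumes mt: "multi_tile l \<Omega>"
  shows "paley_wiener \<Omega> \<in> TI_riesz_spaces l"
proof -
  have \<Omega>: "\<Omega> \<in> sets lebesgue" using mt by (simp add: multi_tile_def)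
  have T: "tile (layer \<Omega> j)" if "j \<in> {1..l}" for j by (rule layer_tile[OF mt that])
  have "\<forall>j\<in>{1..l}. \<exists>f. f \<in> L2_space \<and> (AE \<omega> in lebesgue. fourier_L2 f \<omega> = indicator (layer \<Omega> j) \<omega>)"
  proof
    fix j assume j: "j \<in> {1..l}"
    have "(indicator (layer \<Omega> j) :: real^'d \<Rightarrow> complex) \<in> L2_space"
      using tile_chr_L2[OF T[OF j], of 0] by simp
    then show "\<exists>f. f \<in> L2_space \<and> (AE \<omega> in lebesgue. fourier_L2 f \<omega> = indicator (layer \<Omega> j) \<omega>)"
      by (rule fourier_L2_surj) blast
  qed
  from bchoice[OF this] obtain \<phi> where
    "\<forall>j\<in>{1..l}. \<phi> j \<in> L2_space \<and> (AE \<omega> in lebesgue. fourier_L2 (\<phi> j) \<omega> = indicator (layer \<Omega> j) \<omega>)" ..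
  then have \<phi>: "\<forall>j\<in>{1..l}. \<phi> j \<in> L2_space"
    and F\<phi>: "\<And>j. j \<in> {1..l} \<Longrightarrow> AE \<omega> in lebesgue. fourier_L2 (\<phi> j) \<omega> = indicator (layer \<Omega> j) \<omega>" by blast+
  let ?I = "shift_index l :: ((real^'d) \<times> nat) set"
  let ?e = "integer_shifts \<phi>"
  let ?u = "\<lambda>(k, j) \<omega>. indicator (layer \<Omega> j) \<omega> * chr (- k) \<omega>"
  have eL: "?e i \<in> L2_space" if "i \<in> ?I" for i by (rule integer_shifts_L2[OF \<phi> that])
  have uL: "?u i \<in> L2_space" if "i \<in> ?I" for i
    using that tile_chr_L2[OF T] by (auto simp: shift_index_def)
  have Fe: "AE \<omega> in lebesgue. fourier_L2 (?e i) \<omega> = ?u i \<omega>" if iI: "i \<in> ?I" for i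
  proof -
    obtain k j where i: "i = (k, j)" "j \<in> {1..l}" using iI by (auto simp: shift_index_def)
    have "\<phi> j \<in> L2_space" using \<phi> i(2) by blast
    from fourier_L2_translation[OF this, of k] F\<phi>[OF i(2)] show ?thesis
      by eventually_elim (simp add: i(1) integer_shifts_def chr_minus_left)
  qed
  have inner: "L2_inner g (?e i) = L2_inner (fourier_L2 g) (?u i)" if g: "g \<in> L2_space" and iI: "i \<in> ?I" for g i
  proof -
    have "L2_inner g (?e i) = L2_inner (fourier_L2 g) (fourier_L2 (?e i))"
      by (rule fourier_L2_inner[symmetric, OF g eL[OF iI]])
    also have "\<dots> = L2_inner (fourier_L2 g) (?u i)"
      by (rule L2_inner_cong_AE) (use Fe[OF iI] uL[OF iI] fourier_L2_in_L2[OF g] fourier_L2_in_L2[OF eL[OF iI]] in auto)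
    finally show ?thesis .
  qed
  have on: "orthonormal ?I ?e"
    unfolding orthonormal_def
  proof (intro conjI ballI)
    fix i i' assume i: "i \<in> ?I" and i': "i' \<in> ?I"
    obtain k j where kj: "i = (k, j)" "k \<in> int_lattice" "j \<in> {1..l}" using i by (auto simp: shift_index_def)
    obtain k' j' where kj': "i' = (k', j')" "k' \<in> int_lattice" "j' \<in> {1..l}" using i' by (auto simp: shift_index_def)
    have "L2_inner (?e i) (?e i') = L2_inner (fourier_L2 (?e i)) (?u i')" by (rule inner[OF eL[OF i] i'])
    also have "\<dots> = L2_inner (?u i) (?u i')"
      by (rule L2_inner_cong_AE) (use Fe[OF i] uL[OF i] uL[OF i'] fourier_L2_in_L2[OF eL[OF i]] in auto)
    also have "\<dots> = (if i = i' then 1 else 0)"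
    proof (cases "j = j'")
      case True
      then show ?thesis
        using tile_chr_inner[OF T[OF kj(3)] int_lattice_minus[OF kj(2)] int_lattice_minus[OF kj'(2)]]
        by (simp add: kj(1) kj'(1))
    next
      case False
      then have disj: "\<omega> \<notin> layer \<Omega> j \<or> \<omega> \<notin> layer \<Omega> j'" for \<omega> using layer_disjoint[of \<omega> \<Omega> j j'] by blast
      have "?u i \<omega> * cnj (?u i' \<omega>) = 0" for \<omega>
      proof (cases "\<omega> \<in> layer \<Omega> j")
        case True
        then have "\<omega> \<notin> layer \<Omega> j'" using disj[of \<omega>] by blast
        then show ?thesis by (simp add: kj(1) kj'(1))
      qed (simp add: kj(1) kj'(1))
      then have "L2_inner (?u i) (?u i') = 0" unfolding L2_inner_def by (simp only: Bochner_Integration.integral_zero)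
      then show ?thesis using False kj(1) kj'(1) by simp
    qed
    finally show "L2_inner (?e i) (?e i') = (if i = i' then 1 else 0)" .
  qed (rule eL)
  have "?e i \<in> paley_wiener \<Omega>" if iI: "i \<in> ?I" for i
  proof -
    have "AE \<omega> in lebesgue. \<omega> \<notin> \<Omega> \<longrightarrow> fourier_L2 (?e i) \<omega> = 0"
      using Fe[OF iI]
    proof eventually_elim
      case (elim \<omega>)
      then show ?case using layer_subset[of \<Omega> "snd i"] by (auto simp: indicator_def split: prod.splits)
    qed
    then show ?thesis by (simp add: paley_wiener_def eL[OF iI])
  qed
  then have sub: "closed_span ?I ?e \<subseteq> paley_wiener \<Omega>"
    by (rule closed_span_minimal[OF paley_wiener_closed[OF \<Omega>]])
  have "paley_wiener \<Omega> \<subseteq> closed_span ?I ?e"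
  proof
    fix f assume f: "f \<in> paley_wiener \<Omega>"
    then have fL: "f \<in> L2_space" and f0: "AE \<omega> in lebesgue. \<omega> \<notin> \<Omega> \<longrightarrow> fourier_L2 f \<omega> = 0"
      by (simp_all add: paley_wiener_def)
    show "f \<in> closed_span ?I ?e"
    proof (rule in_closed_span_if_orthogonal[OF eL fL])
      fix g assume g: "g \<in> L2_space" "\<And>i. i \<in> ?I \<Longrightarrow> L2_inner g (?e i) = 0"
      have "AE \<omega> in lebesgue. \<omega> \<in> layer \<Omega> j \<longrightarrow> fourier_L2 g \<omega> = 0" if j: "j \<in> {1..l}" for j
      proof (rule tile_chr_complete[OF T[OF j] fourier_L2_in_L2[OF g(1)]])
        fix k :: "real^'d" assume "k \<in> int_lattice"
        then have "(- k, j) \<in> ?I" using j by (simp add: shift_index_def int_lattice_minus)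
        from g(2)[OF this] inner[OF g(1) this]
        show "L2_inner (fourier_L2 g) (\<lambda>\<omega>. indicator (layer \<Omega> j) \<omega> * chr k \<omega>) = 0" by simp
      qed
      then have "AE \<omega> in lebesgue. \<forall>j\<in>{1..l}. \<omega> \<in> layer \<Omega> j \<longrightarrow> fourier_L2 g \<omega> = 0"
        by (intro AE_ball_countable[THEN iffD2]) auto
      with layer_cover[OF mt] f0 have "AE \<omega> in lebesgue. fourier_L2 f \<omega> * cnj (fourier_L2 g \<omega>) = 0"
        by eventually_elim auto
      then show "L2_inner f g = 0"
        using L2_inner_eq_fourier_integral[OF fL g(1), of "\<lambda>_. 0"] by simp
    qed
  qed
  with sub have V: "closed_span ?I ?e = paley_wiener \<Omega>" by blast
  have "riesz_basis ?I ?e (paley_wiener \<Omega>)"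
    unfolding riesz_basis_def
  proof (intro conjI ballI V eL)
    show "\<exists>A>0. \<exists>B>0. \<forall>F c. finite F \<and> F \<subseteq> ?I \<longrightarrow>
       A * (\<Sum>i\<in>F. (cmod (c i))\<^sup>2) \<le> (L2_norm (\<lambda>x. \<Sum>i\<in>F. c i * ?e i x))\<^sup>2 \<and>
       (L2_norm (\<lambda>x. \<Sum>i\<in>F. c i * ?e i x))\<^sup>2 \<le> B * (\<Sum>i\<in>F. (cmod (c i))\<^sup>2)"
    proof (rule exI[of _ 1], rule conjI[OF zero_less_one], rule exI[of _ 1], rule conjI[OF zero_less_one],
        intro allI impI, elim conjE)
      fix F c assume "finite F" "F \<subseteq> ?I"
      from orthonormal_sum_norm[OF on this, of c]
      show "1 * (\<Sum>i\<in>F. (cmod (c i))\<^sup>2) \<le> (L2_norm (\<lambda>x. \<Sum>i\<in>F. c i * ?e i x))\<^sup>2 \<and>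
         (L2_norm (\<lambda>x. \<Sum>i\<in>F. c i * ?e i x))\<^sup>2 \<le> 1 * (\<Sum>i\<in>F. (cmod (c i))\<^sup>2)" by simp
    qed
  qed
  moreover have "translation_invariant (paley_wiener \<Omega>)"
    unfolding translation_invariant_def using paley_wiener_translation by blast
  ultimately show ?thesis
    unfolding TI_riesz_spaces_def shift_space_def using \<phi> V by blast
qed

section \<open>The characterization\<close>

theorem proposition4p3:
  fixes l :: nat and V :: "(real^'d \<Rightarrow> complex) set"
  assumes "closed_L2_subspace V"
  shows "V \<in> TI_riesz_spaces l \<longleftrightarrow>
    (\<exists>\<Omega>. \<Omega> \<in> sets lebesgue \<and> multi_tile l \<Omega> \<and> V = paley_wiener \<Omega>)"
proof
  assume "V \<in> TI_riesz_spaces l"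
  then obtain \<phi> where \<phi>: "\<forall>j\<in>{1..l}. \<phi> j \<in> L2_space" and V: "V = shift_space l \<phi>"
    and ti: "translation_invariant V" and R: "riesz_basis (shift_index l) (integer_shifts \<phi>) V"
    unfolding TI_riesz_spaces_def by blast
  define \<Omega> where "\<Omega> = {\<omega>. \<exists>j\<in>{1..l}. fourier_L2 (\<phi> j) \<omega> \<noteq> 0}"
  have \<Omega>: "\<Omega> \<in> sets lebesgue" and PW: "V = paley_wiener \<Omega>"
    unfolding \<Omega>_def V
    by (rule translation_invariant_shift_space_eq_paley_wiener[OF \<phi> ti[unfolded V]])+
  have "multi_tile l \<Omega>"
    by (rule multi_tile_if_riesz_basis[OF R[unfolded PW] \<phi> \<Omega>]) (auto simp: \<Omega>_def)
  with \<Omega> PW show "\<exists>\<Omega>. \<Omega> \<in> sets lebesgue \<and> multi_tile l \<Omega> \<and> V = paley_wiener \<Omega>" by blast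
next
  assume "\<exists>\<Omega>. \<Omega> \<in> sets lebesgue \<and> multi_tile l \<Omega> \<and> V = paley_wiener \<Omega>"
  then show "V \<in> TI_riesz_spaces l" using paley_wiener_multi_tile_in_TI_riesz_spaces by blast
qed

end
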